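(* Let $\Sigma$ be a finite non-empty alphabet, $\upsilon\notin\Sigma$ a variable, $\mathcal F\subseteq W^{<\omega}(\Sigma ; \upsilon)$ a tree and $\vec{w} \in W^\omega (\Sigma ; \upsilon)$. Case 1. If the family $\mathcal F_h \cap VRW^{<\omega}(\vec{w})$ is not pointwise closed, then there exists a variable reduction $\vec{u}\prec\vec{w}$ such that $VRW^{<\omega}(\vec{u})\subseteq \mathcal F$. Case 2. If the family $\mathcal F_h \cap VRW^{<\omega}(\vec{w})$ is pointwise closed, then $$\zeta_{\vec{w}}^{\mathcal F} = \sup \{sO_{\vec{u}} (\mathcal F_h\cap VRW^{<\omega}(\vec{w})) : \vec{u}\prec\vec{w}\}$$ is a countable ordinal, and for countable ordinals $\xi$: 2(i) if $\xi+1 <\zeta_{\vec{w}}^{\mathcal F}$, then there exists $\vec{u}\prec\vec{w}$ such that $W^{\xi}(\Sigma ; \upsilon)\cap VRW^{<\omega}(\vec{u})\subseteq \mathcal F$; 2(ii) if $\xi>\zeta_{\vec{w}}^{\mathcal F}$, then for every $\vec{u} \prec \vec{w}$ there exists $\vec{u}_1 \prec \vec{u}$ such that $W^{\xi}(\Sigma ; \upsilon)\cap VRW^{<\omega}(\vec{u}_1) \subseteq W^{<\omega}(\Sigma ; \upsilon)\setminus \mathcal F$ (equivalently $\mathcal F\cap VRW^{<\omega}(\vec{u}_1) \subseteq (W^{\xi}(\Sigma ; \upsilon))^* \setminus W^{\xi}(\Sigma ; \upsilon)$); 2(iii) if $\xi+1 = \zeta_{\vec{w}}^{\mathcal F}$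 or $\xi = \zeta_{\vec{w}}^{\mathcal F}$, then there exists $\vec{u} \prec \vec{w}$ such that either $W^{\xi}(\Sigma ; \upsilon)\cap VRW^{<\omega}(\vec{u})\subseteq \mathcal F$ or $W^{\xi}(\Sigma ; \upsilon)\cap VRW^{<\omega}(\vec{u}) \subseteq W^{<\omega}(\Sigma ; \upsilon)\setminus \mathcal F$.
   Context: $\mathbb N=\{1,2,\ldots\}$. Words. $\Sigma$ is a finite non-empty alphabet and $\upsilon\notin\Sigma$ is the variable. $W(\Sigma)$ is the set of words over $\Sigma$, i.e. non-empty finite sequences of elements of $\Sigma$; $\ast$ is concatenation. $W(\Sigma;\upsilon)=W(\Sigma\cup\{\upsilon\})\setminus W(\Sigma)$ is the set of variable words. For $w\in W(\Sigma;\upsilon)$ and $\alpha\in\Sigma\cup\{\upsilon\}$, $w(\alpha)$ is $w$ with every occurrence of $\upsilon$ replaced by $\alpha$. $W^{<\omega}(\Sigma;\upsilon)$ is the set of finite sequences (including $\emptyset$) of variable words; $W^{\omega}(\Sigma;\upsilon)$ is the set of infinite sequences of variable words. For variable words, $w_1\propto w_2$ means that $w_1$ is a proper initial segment of $w_2$ and the word $w_2-w_1$ with $w_2=w_1\ast(w_2-w_1)$ is a variable word. For a family $\mathcal H$ of finite sequences of words, $\mathcal H^*$ consists of $\emptyset$ and all initial segments (including the sequence itself) of elements of $\mathcal H$; $\mathcal H$ is a tree if $\mathcal H^*=\mathcal H$. For a non-empty finite sequence $\mathbf w=(w_1,\ldots,w_l)$ of words over $\Sigma\cup\{\upsilon\}$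 write $w_i=\alpha_{k_i}\alpha_{k_i+1}\cdots\alpha_{k_{i+1}-1}$ with $1=k_1<\cdots<k_{l+1}$ and put $d(\mathbf w)=\{k_2<\cdots<k_l\}$ ($=\emptyset$ if $l=1$). Reductions. Let $\vec w=(w_n)_{n\in\mathbb N}\in W^{\omega}(\Sigma;\upsilon)$ and let $\mathbf t$ be a finite or infinite sequence of words $t_i=\alpha_{k_i}\cdots\alpha_{k_{i+1}-1}$ over $\Sigma\cup\{\upsilon\}$ ($1=k_1<k_2<\cdots$). Then $\vec w[\mathbf t]$ is the sequence with $i$-th term $w_{k_i}(\alpha_{k_i})\ast\cdots\ast w_{k_{i+1}-1}(\alpha_{k_{i+1}-1})$; $\vec w[\emptyset]=\emptyset$. $VRW^{<\omega}(\vec w)=\{\vec w[\mathbf t]:\mathbf t\in W^{<\omega}(\Sigma;\upsilon)\}$; $VRW(\vec w)$ is the set of words $u$ with $(u)\in VRW^{<\omega}(\vec w)$. $\vec u\prec\vec w$ ($\vec u$ is a variable reduction of $\vec w$) means $\vec u=\vec w[\vec t]$ for some $\vec t\in W^{\omega}(\Sigma;\upsilon)$. For a finite sequence $\mathbf w=(w_1,\ldots,w_n)$ of variable words, $VRW^{<\omega}(\mathbf w)$ is the set of sequences $(u_1,\ldots,u_l)$ with $u_i=w_{k_i}(\alpha_{k_i})\ast\cdots\ast w_{k_{i+1}-1}(\alpha_{k_{i+1}-1})$, where $1=k_1<\cdots<k_{l+1}=n+1$, $\alpha_j\in\Sigma\cup\{\upsilon\}$ and each $u_i$ is a variable word. $\mathcal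 F_h$ is the largest hereditary subfamily of $\mathcal F\cup\{\emptyset\}$, explicitly $\emptyset$ together with all $\mathbf t\in\mathcal F$ such that $VRW^{<\omega}(\mathbf t_1)\subseteq\mathcal F$ for every non-empty initial segment $\mathbf t_1$ of $\mathbf t$ (including $\mathbf t_1=\mathbf t$). Schreier system. For every non-zero countable limit ordinal $\lambda$ fix a strictly increasing sequence $(\lambda_n)_{n\in\mathbb N}$ of successor ordinals smaller than $\lambda$ with $\sup_n\lambda_n=\lambda$. For sets of naturals $s<t$ means every element of $s$ is smaller than every element of $t$. Families $\mathcal A_\xi$ ($\xi<\omega_1$): (1) $\mathcal A_0=\{\emptyset\}$, $\mathcal A_1=\{\{n\}:n\in\mathbb N\}$; (2) $\mathcal A_{\zeta+1}=\{\{n\}\cup s_1: n\in\mathbb N,\ \{n\}<s_1,\ s_1\in\mathcal A_\zeta\}$; (3i) $\mathcal A_{\omega^{\beta+1}}=\{\bigcup_{i=1}^n s_i: n=\min s_1,\ s_1<\cdots<s_n,\ s_1,\ldots,s_n\in\mathcal A_{\omega^\beta}\}$; (3ii) for a non-zero countable limit ordinal $\lambda$, $\mathcal A_{\omega^\lambda}=\{s\neq\emptyset: s\in\mathcal A_{\omega^{\lambda_n}}\text{ with }n=\min s\}$; (3iii) for a limit ordinal $\xi$ with $\omega^{\alpha}<\xi<\omega^{\alpha+1}$, $0<\alpha<\omega_1$, with Cantor normal form $\xi=\omega^\alpha p+\sum_{i=1}^m\omega^{a_i}p_i$ ($m\ge0$, $p,p_i\geq1$, $\alpha>a_1>\cdots>a_m>0$),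 $\mathcal A_\xi$ is the set of all $s=s_0\cup\bigcup_{i=1}^m s_i$ with $s_m<\cdots<s_1<s_0$, where $s_0$ is a union of $p$ sets $s^0_1<\cdots<s^0_p$ from $\mathcal A_{\omega^\alpha}$ and each $s_i$ is a union of $p_i$ sets $s^i_1<\cdots<s^i_{p_i}$ from $\mathcal A_{\omega^{a_i}}$. $W^0(\Sigma;\upsilon)$ is the set of one-term sequences of variable words; for countable $\xi\ge1$, $W^\xi(\Sigma;\upsilon)$ is the set of non-empty $\mathbf w\in W^{<\omega}(\Sigma;\upsilon)$ with $d(\mathbf w)\in\mathcal A_\xi$. Topology. Let $D=\mathbb N\times(\Sigma\cup\{\upsilon\})$ and $[D]^{<\omega}$ the set of finite subsets of $D$. A finite sequence of words with terms $w_i=\alpha_{k_i}\cdots\alpha_{k_{i+1}-1}$ ($1=k_1<k_2<\cdots$) is identified with the characteristic function in $\{0,1\}^{[D]^{<\omega}}$ of the set of all blocks $\{(j,\alpha_j):k_i\le j\le k_{i+1}-1\}$; $\emptyset$ is identified with $0$. A family is pointwise closed if the corresponding set of characteristic functions is closed in the product topology of $\{0,1\}^{[D]^{<\omega}}$. Strong Cantor–Bendixson index. For $\mathcal H\subseteq VRW^{<\omega}(\vec w)$ and $\vec u\prec\vec w$, for $\mathbf t=(t_1,\ldots,t_k)\in\mathcal H\cap VRW^{<\omega}(\vec u)$ let $A_{\mathbf t}=\{w\in VRW(\vec u): t_1\ast\cdots\ast t_k\propto w,\ (t_1,\ldots,t_k,w-t_1\ast\cdots\ast t_k)\notin\mathcal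 H\}$ (and $A_\emptyset=\{w\in VRW(\vec u):(w)\notin\mathcal H\}$). $(\mathcal H)^0_{\vec u}$ is the set of $\mathbf t\in\mathcal H\cap VRW^{<\omega}(\vec u)$ such that $A_{\mathbf t}$ contains no infinite sequence $w_1\propto w_2\propto\cdots$; $(\mathcal H)^{\zeta+1}_{\vec u}=((\mathcal H)^{\zeta}_{\vec u})^0_{\vec u}$; $(\mathcal H)^{\xi}_{\vec u}=\bigcap_{\beta<\xi}(\mathcal H)^\beta_{\vec u}$ for limit $\xi$. $sO_{\vec u}(\mathcal H)$ is the smallest countable ordinal $\xi$ with $(\mathcal H)^\xi_{\vec u}=\emptyset$. *)

theory Defs
  imports "HOL-Analysis.Analysis" "HOL-Library.Countable_Set_Type"
begin

section \<open>Countable ordinals\<close>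

text \<open>
  The countable ordinals are the elements of a well-order of type \<open>\<omega>\<^sub>1\<close>, realised as the
  cardinal successor of the cardinal of the natural numbers.
\<close>

unbundle cardinal_syntax

typedef omega1 = "Field (cardSuc |UNIV :: nat set| )"
  using Field_cardSuc_not_empty card_of_Card_order by blast

lemma Well_order_cardSuc_nat: "Well_order (cardSuc |UNIV :: nat set| )"
  by (rule cardSuc_Well_order[OF card_of_Card_order])

instantiation omega1 :: wellorder
begin

definition less_eq_omega1 :: "omega1 \<Rightarrow> omega1 \<Rightarrow> bool" where
  "x \<le> y \<longleftrightarrow> (Rep_omega1 x, Rep_omega1 y) \<in> cardSuc |UNIV :: nat set|"

definition less_omega1 :: "omega1 \<Rightarrow> omega1 \<Rightarrow> bool" where
  "(x :: omega1) < y \<longleftrightarrow> x \<le> y \<and> x \<noteq> y"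

instance
proof -
  let ?r = "cardSuc |UNIV :: nat set|"
  have wo: "Well_order ?r" by (rule Well_order_cardSuc_nat)
  have refl: "Refl ?r" and trans: "trans ?r" and anti: "antisym ?r" and tot: "Total ?r"
    and wf: "wf (?r - Id)"
    using wo by (auto simp: well_order_on_def linear_order_on_def partial_order_on_def
        preorder_on_def)
  have le_refl: "x \<le> x" for x :: omega1
    using refl Rep_omega1[of x] by (auto simp: refl_on_def less_eq_omega1_def)
  have le_anti: "x = y" if "x \<le> y" "y \<le> x" for x y :: omega1
    using that anti unfolding less_eq_omega1_def antisym_def
    by (metis Rep_omega1_inject)
  have le_trans: "x \<le> z" if "x \<le> y" "y \<le> z" for x y z :: omega1
    using that trans unfolding less_eq_omega1_def trans_def by blast
  have le_total: "x \<le> y \<or> y \<le> x" for x y :: omega1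
    using tot refl Rep_omega1[of x] Rep_omega1[of y]
    by (cases "Rep_omega1 x = Rep_omega1 y")
       (auto simp: total_on_def refl_on_def less_eq_omega1_def)
  have wf': "wf {(x, y). (x :: omega1) < y}"
    by (rule wf_subset[OF wf_inv_image[OF wf, of Rep_omega1]])
       (auto simp: inv_image_def less_omega1_def less_eq_omega1_def Rep_omega1_inject)
  show "OFCLASS(omega1, wellorder_class)"
  proof (intro_classes, goal_cases)
    case (1 x y) show ?case using le_anti by (auto simp: less_omega1_def)
  next
    case (2 x) show ?case by (rule le_refl)
  next
    case (3 x y z) then show ?case by (rule le_trans)
  next
    case (4 x y) then show ?case by (rule le_anti)
  next
    case (5 x y) show ?case by (rule le_total)
  next
    case (6 P a)
    show ?case using wf' by (rule wf_induct_rule) (use 6 in auto)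
  qed
qed

end

lemma countable_lessThan_omega1: "countable {..< x :: omega1}"
proof -
  let ?r = "cardSuc |UNIV :: nat set|"
  have co: "Card_order ?r" by (rule cardSuc_Card_order[OF card_of_Card_order])
  have "|underS ?r (Rep_omega1 x)| <o ?r"
    using card_of_underS[OF co] Rep_omega1 by blast
  then have "|underS ?r (Rep_omega1 x)| \<le>o |UNIV :: nat set|"
    using cardSuc_ordLeq_ordLess[OF card_of_Card_order card_of_Card_order] by blast
  then have c: "countable (underS ?r (Rep_omega1 x))"
    by (simp add: countable_card_of_nat)
  have "Rep_omega1 ` {..<x} \<subseteq> underS ?r (Rep_omega1 x)"
    by (auto simp: underS_def less_omega1_def less_eq_omega1_def Rep_omega1_inject)
  then have "countable (Rep_omega1 ` {..<x})"
    using c countable_subset by blast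
  then show ?thesis
    by (rule countable_image_inj_on) (auto simp: inj_on_def Rep_omega1_inject)
qed

lemma uncountable_omega1: "uncountable (UNIV :: omega1 set)"
proof
  let ?r = "cardSuc |UNIV :: nat set|"
  assume "countable (UNIV :: omega1 set)"
  then have "countable (range Rep_omega1)" by blast
  then have "countable (Field ?r)"
    using type_definition.Rep_range[OF type_definition_omega1] by simp
  then have "|Field ?r| \<le>o |UNIV :: nat set|" by (simp add: countable_card_of_nat)
  moreover have "|Field ?r| =o ?r"
    by (rule card_of_Field_ordIso[OF cardSuc_Card_order[OF card_of_Card_order]])
  ultimately have "?r \<le>o |UNIV :: nat set|"
    using ordIso_symmetric ordIso_ordLeq_trans by blast
  moreover have "|UNIV :: nat set| <o ?r"
    by (rule cardSuc_greater[OF card_of_Card_order])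
  ultimately show False using not_ordLess_ordLeq by blast
qed

lemma bdd_above_countable_omega1:
  assumes "countable (A :: omega1 set)"
  shows "bdd_above A"
proof (rule ccontr)
  assume n: "\<not> bdd_above A"
  have "UNIV = (\<Union>a\<in>A. {..<a})"
  proof (intro equalityI subsetI)
    fix x :: omega1
    from n obtain a where "a \<in> A" "\<not> a \<le> x" by (auto simp: bdd_above_def)
    then show "x \<in> (\<Union>a\<in>A. {..<a})" by (auto simp: not_le)
  qed auto
  moreover have "countable (\<Union>a\<in>A. {..<a})"
    using assms countable_lessThan_omega1 by blast
  ultimately show False using uncountable_omega1 by metis
qed

lemma ex_greater_omega1: "\<exists>y. (x :: omega1) < y"
proof (rule ccontr)
  assume "\<not> ?thesis"
  then have "UNIV = insert x {..<x}" by (auto simp: not_less order_le_less)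
  then show False
    using uncountable_omega1 countable_lessThan_omega1[of x] by (metis countable_insert)
qed

instantiation omega1 :: conditionally_complete_linorder
begin

definition inf_omega1 :: "omega1 \<Rightarrow> omega1 \<Rightarrow> omega1" where "inf_omega1 = min"
definition sup_omega1 :: "omega1 \<Rightarrow> omega1 \<Rightarrow> omega1" where "sup_omega1 = max"
definition Inf_omega1 :: "omega1 set \<Rightarrow> omega1" where "Inf (X :: omega1 set) = (LEAST x. x \<in> X)"
definition Sup_omega1 :: "omega1 set \<Rightarrow> omega1" where "Sup (X :: omega1 set) = (LEAST z. \<forall>x\<in>X. x \<le> z)"

instance
proof
  fix x :: omega1 and X :: "omega1 set"
  show "Inf X \<le> x" if "x \<in> X" "bdd_below X"
    using that by (simp add: Inf_omega1_def Least_le)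
  show "x \<le> Inf X" if "X \<noteq> {}" "\<And>y. y \<in> X \<Longrightarrow> x \<le> y"
    using that unfolding Inf_omega1_def ex_in_conv[symmetric] by (rule LeastI2_ex)
  show "x \<le> Sup X" if "x \<in> X" "bdd_above X"
  proof -
    from that(2) have "\<exists>z. \<forall>x\<in>X. x \<le> z" by (auto simp: bdd_above_def)
    then have "\<forall>x\<in>X. x \<le> Sup X" unfolding Sup_omega1_def by (rule LeastI_ex)
    then show ?thesis using that(1) by blast
  qed
  show "Sup X \<le> x" if "X \<noteq> {}" "\<And>y. y \<in> X \<Longrightarrow> y \<le> x"
    unfolding Sup_omega1_def by (rule Least_le) (use that in blast)
qed (auto simp: inf_omega1_def sup_omega1_def)

end

unbundle no cardinal_syntax

definition osuc :: "omega1 \<Rightarrow> omega1" where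
  "osuc x = (LEAST y. x < y)"

lemma less_osuc: "x < osuc x"
  unfolding osuc_def using ex_greater_omega1 by (rule LeastI_ex)

lemma osuc_le_iff: "osuc x \<le> y \<longleftrightarrow> x < y"
  by (metis Least_le less_le_trans less_osuc osuc_def)

lemma less_osuc_iff: "x < osuc y \<longleftrightarrow> x \<le> y"
  by (metis osuc_le_iff not_less)

lemma osuc_inject: "osuc x = osuc y \<longleftrightarrow> x = y"
  by (metis antisym less_osuc_iff less_osuc)

instantiation omega1 :: "{zero, one}"
begin
definition zero_omega1 :: omega1 where "0 = (LEAST x :: omega1. True)"
definition one_omega1 :: omega1 where "1 = osuc 0"
instance ..
end

lemma zero_le_omega1: "0 \<le> (x :: omega1)"
  unfolding zero_omega1_def by (rule Least_le) simp

lemma osuc_neq_zero: "osuc x \<noteq> 0"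
  by (metis less_osuc not_less zero_le_omega1)

definition is_succ :: "omega1 \<Rightarrow> bool" where
  "is_succ x \<longleftrightarrow> (\<exists>y. x = osuc y)"

definition is_limit :: "omega1 \<Rightarrow> bool" where
  "is_limit x \<longleftrightarrow> x \<noteq> 0 \<and> \<not> is_succ x"

text \<open>
  Transfinite recursion with value \<open>z\<close> at \<open>0\<close>, step \<open>s\<close> at successors, and the operator \<open>l\<close>
  applied to the set of all earlier values at limits (see the three equations below).
\<close>

function orec :: "'b \<Rightarrow> ('b \<Rightarrow> 'b) \<Rightarrow> ('b set \<Rightarrow> 'b) \<Rightarrow> omega1 \<Rightarrow> 'b" where
  "orec z s l x =
     (if x = 0 then z
      else if is_succ x then s (orec z s l (THE y. x = osuc y))
      else l (orec z s l ` {..<x}))"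
  by pat_completeness auto
termination
proof (relation "inv_image {(x, y). x < y} (\<lambda>(z, s, l, x). x)", goal_cases)
  case 1 show ?case by (intro wf_inv_image wf)
next
  case (2 z s l x)
  then obtain y where y: "x = osuc y" by (auto simp: is_succ_def)
  then have "(THE y. x = osuc y) = y" by (auto simp: osuc_inject)
  then show ?case using y less_osuc by simp
next
  case (3 z s l x xa) then show ?case by simp
qed

declare orec.simps [simp del]

lemma orec_zero: "orec z s l 0 = z"
  by (simp add: orec.simps)

lemma orec_succ: "orec z s l (osuc x) = s (orec z s l x)"
  by (subst orec.simps) (auto simp: is_succ_def osuc_inject osuc_neq_zero)

lemma orec_limit: "is_limit x \<Longrightarrow> orec z s l x = l (orec z s l ` {..<x})"
  by (subst orec.simps) (auto simp: is_limit_def)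

instantiation omega1 :: "{plus, times}"
begin
definition plus_omega1 :: "omega1 \<Rightarrow> omega1 \<Rightarrow> omega1" where
  "(x :: omega1) + y = orec x osuc Sup y"
definition times_omega1 :: "omega1 \<Rightarrow> omega1 \<Rightarrow> omega1" where
  "(x :: omega1) * y = orec 0 (\<lambda>z. z + x) Sup y"
instance ..
end

definition ofin :: "nat \<Rightarrow> omega1" where
  "ofin n = (osuc ^^ n) 0"

definition omega :: omega1 where
  "omega = Sup (range ofin)"

definition omega_pow :: "omega1 \<Rightarrow> omega1" where
  "omega_pow x = orec 1 (\<lambda>z. z * omega) Sup x"

text \<open>\<open>\<omega>\<^bsup>a 0\<^esup> p 0 + (\<omega>\<^bsup>a 1\<^esup> p 1 + (\<dots> + (\<omega>\<^bsup>a m\<^esup> p m + 0)))\<close>\<close>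

definition omega_sum :: "nat \<Rightarrow> (nat \<Rightarrow> omega1) \<Rightarrow> (nat \<Rightarrow> nat) \<Rightarrow> omega1" where
  "omega_sum m a p = foldr (\<lambda>i x. omega_pow (a i) * ofin (p i) + x) [0..<Suc m] 0"


section \<open>The Schreier system\<close>

text \<open>The set of positive integers is \<open>{1..}\<close>; values \<open>L \<eta> 0\<close> are never used.\<close>

definition fundamental_system :: "(omega1 \<Rightarrow> nat \<Rightarrow> omega1) \<Rightarrow> bool" where
  "fundamental_system L \<longleftrightarrow>
     (\<forall>\<eta>. is_limit \<eta> \<longrightarrow>
        strict_mono_on {1..} (L \<eta>) \<and>
        (\<forall>n\<ge>1. is_succ (L \<eta> n) \<and> L \<eta> n < \<eta>) \<and>
        Sup (L \<eta> ` {1..}) = \<eta>)"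

definition set_less :: "nat set \<Rightarrow> nat set \<Rightarrow> bool" where
  "set_less s t \<longleftrightarrow> (\<forall>x\<in>s. \<forall>y\<in>t. x < y)"

text \<open>
  \<open>schreier L \<xi> s\<close> means that \<open>s\<close> belongs to the family \<open>\<A>\<^sub>\<xi>\<close> built from the fundamental
  sequences \<open>L\<close>. Each rule reduces membership at \<open>\<xi>\<close> to membership at smaller ordinals, so the
  inductive predicate is the transfinite recursion on \<open>\<xi>\<close>. In the last rule \<open>a 0\<close>, \<open>p 0\<close> are
  the leading exponent and coefficient of the Cantor normal form, and the \<open>i\<close>-th part
  is the union of \<open>s i 0 < \<dots> < s i (p i - 1)\<close>.
\<close>

inductive schreier :: "(omega1 \<Rightarrow> nat \<Rightarrow> omega1) \<Rightarrow> omega1 \<Rightarrow> nat set \<Rightarrow> bool"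
  for L :: "omega1 \<Rightarrow> nat \<Rightarrow> omega1" where
  zero: "schreier L 0 {}"
| one: "n \<ge> 1 \<Longrightarrow> schreier L 1 {n}"
| succ: "n \<ge> 1 \<Longrightarrow> schreier L \<zeta> s \<Longrightarrow> set_less {n} s \<Longrightarrow> schreier L (osuc \<zeta>) (insert n s)"
| pow_succ:
    "n \<ge> 1 \<Longrightarrow> s 1 \<noteq> {} \<Longrightarrow> n = Min (s 1) \<Longrightarrow>
     (\<And>i. i \<in> {1..n} \<Longrightarrow> schreier L (omega_pow \<beta>) (s i)) \<Longrightarrow>
     (\<And>i. i \<in> {1..<n} \<Longrightarrow> set_less (s i) (s (Suc i))) \<Longrightarrow>
     schreier L (omega_pow (osuc \<beta>)) (\<Union>i\<in>{1..n}. s i)"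
| pow_limit:
    "is_limit \<eta> \<Longrightarrow> s \<noteq> {} \<Longrightarrow> schreier L (omega_pow (L \<eta> (Min s))) s \<Longrightarrow>
     schreier L (omega_pow \<eta>) s"
| cantor:
    "is_limit \<xi> \<Longrightarrow> 0 < a 0 \<Longrightarrow> omega_pow (a 0) < \<xi> \<Longrightarrow> \<xi> < omega_pow (osuc (a 0)) \<Longrightarrow>
     \<xi> = omega_sum m a p \<Longrightarrow>
     (\<And>i. i \<le> m \<Longrightarrow> p i \<ge> 1) \<Longrightarrow>
     (\<And>i. i < m \<Longrightarrow> a (Suc i) < a i) \<Longrightarrow> 0 < a m \<Longrightarrow>
     (\<And>i j. i \<le> m \<Longrightarrow> j < p i \<Longrightarrow> schreier L (omega_pow (a i)) (s i j)) \<Longrightarrow>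
     (\<And>i j. i \<le> m \<Longrightarrow> Suc j < p i \<Longrightarrow> set_less (s i j) (s i (Suc j))) \<Longrightarrow>
     (\<And>i. i < m \<Longrightarrow> set_less (\<Union>j<p (Suc i). s (Suc i) j) (\<Union>j<p i. s i j)) \<Longrightarrow>
     schreier L \<xi> (\<Union>i\<le>m. \<Union>j<p i. s i j)"


section \<open>Variable words and reductions\<close>

text \<open>
  The alphabet is the type \<open>'a\<close>; the letters of \<open>\<Sigma> \<union> {\<upsilon>}\<close> are the elements of \<open>'a option\<close>,
  where \<open>None\<close> is the variable \<open>\<upsilon>\<close>. Words are non-empty lists.
  Sequences are indexed from 0 here, so \<open>w n\<close> is the \<open>(n+1)\<close>-st term of \<open>w\<close>.
\<close>

type_synonym 'a word = "'a option list"

definition varwords :: "'a word set" where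
  "varwords = {w. None \<in> set w}"

definition subst :: "'a word \<Rightarrow> 'a option \<Rightarrow> 'a word" where
  "subst w \<alpha> = map (\<lambda>x. if x = None then \<alpha> else x) w"

definition propto :: "'a word \<Rightarrow> 'a word \<Rightarrow> bool" where
  "propto w1 w2 \<longleftrightarrow> (\<exists>z\<in>varwords. w2 = w1 @ z)"

definition star :: "'a word list set \<Rightarrow> 'a word list set" where
  "star H = insert [] {s. \<exists>t\<in>H. \<exists>r. t = s @ r}"

definition is_tree :: "'a word list set \<Rightarrow> bool" where
  "is_tree H \<longleftrightarrow> star H = H"

text \<open>
  The term \<open>w\<^sub>k(\<alpha>\<^sub>k) * \<dots> * w\<^sub>k\<^sub>'(\<alpha>\<^sub>k\<^sub>')\<close> of a reduction belonging to the word
  \<open>t = \<alpha>\<^sub>k \<dots> \<alpha>\<^sub>k\<^sub>'\<close> that starts at position \<open>k\<close>.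
\<close>

definition reduced_term :: "(nat \<Rightarrow> 'a word) \<Rightarrow> nat \<Rightarrow> 'a word \<Rightarrow> 'a word" where
  "reduced_term w k t = concat (map (\<lambda>j. subst (w (k + j)) (t ! j)) [0..<length t])"

definition reduction :: "(nat \<Rightarrow> 'a word) \<Rightarrow> (nat \<Rightarrow> 'a word) \<Rightarrow> nat \<Rightarrow> 'a word" where
  "reduction w t = (\<lambda>i. reduced_term w (\<Sum>j<i. length (t j)) (t i))"

definition fin_reduction :: "(nat \<Rightarrow> 'a word) \<Rightarrow> 'a word list \<Rightarrow> 'a word list" where
  "fin_reduction w t =
     map (\<lambda>i. reduced_term w (\<Sum>j<i. length (t ! j)) (t ! i)) [0..<length t]"

definition VRWfin :: "(nat \<Rightarrow> 'a word) \<Rightarrow> 'a word list set" where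
  "VRWfin w = fin_reduction w ` lists varwords"

definition VRW :: "(nat \<Rightarrow> 'a word) \<Rightarrow> 'a word set" where
  "VRW w = {u. [u] \<in> VRWfin w}"

definition var_reduction :: "(nat \<Rightarrow> 'a word) \<Rightarrow> (nat \<Rightarrow> 'a word) \<Rightarrow> bool"  (infix "\<prec>" 50) where
  "u \<prec> w \<longleftrightarrow> (\<exists>t. range t \<subseteq> varwords \<and> u = reduction w t)"

text \<open>
  Reductions of a finite sequence use all of its terms; the index words \<open>t\<close> are arbitrary
  (non-empty) words and it is the resulting terms that must be variable words.
\<close>

definition VRWlist :: "'a word list \<Rightarrow> 'a word list set" where
  "VRWlist ws = {u. \<exists>t. [] \<notin> set t \<and> length (concat t) = length ws \<and>
                       u = fin_reduction (\<lambda>n. ws ! n) t \<and> u \<in> lists varwords}"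

text \<open>The largest hereditary subfamily of \<open>F \<union> {\<emptyset>}\<close>.\<close>

definition hered :: "'a word list set \<Rightarrow> 'a word list set" where
  "hered F = insert [] {t \<in> F. \<forall>t1 r. t = t1 @ r \<and> t1 \<noteq> [] \<longrightarrow> VRWlist t1 \<subseteq> F}"

text \<open>Positions of letters are counted from 1.\<close>

definition dset :: "'a word list \<Rightarrow> nat set" where
  "dset ws = {1 + (\<Sum>j<i. length (ws ! j)) | i. 1 \<le> i \<and> i < length ws}"

definition Wfam :: "(omega1 \<Rightarrow> nat \<Rightarrow> omega1) \<Rightarrow> omega1 \<Rightarrow> 'a word list set" where
  "Wfam L \<xi> =
     (if \<xi> = 0 then {[w] | w. w \<in> varwords}
      else {ws \<in> lists varwords. ws \<noteq> [] \<and> schreier L \<xi> (dset ws)})"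


section \<open>Pointwise closed families\<close>

definition blocks :: "'a word list \<Rightarrow> (nat \<times> 'a option) set set" where
  "blocks ws =
     (\<lambda>i. {(1 + (\<Sum>m<i. length (ws ! m)) + j, ws ! i ! j) | j. j < length (ws ! i)})
       ` {..<length ws}"

definition fin_subsets :: "(nat \<times> 'a option) set set" where
  "fin_subsets = {A. finite A \<and> A \<subseteq> {1..} \<times> UNIV}"

definition char_fun :: "'a word list \<Rightarrow> (nat \<times> 'a option) set \<Rightarrow> nat" where
  "char_fun ws = restrict (indicator (blocks ws)) fin_subsets"

definition pointwise_closed :: "'a word list set \<Rightarrow> bool" where
  "pointwise_closed H \<longleftrightarrow>
     closedin (product_topology (\<lambda>_. discrete_topology {0, 1}) fin_subsets) (char_fun ` H)"


section \<open>The strong Cantor--Bendixson index\<close>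

text \<open>
  For \<open>t = []\<close> the condition \<open>propto (concat t) x\<close> holds for every \<open>x \<in> VRW u\<close>, and
  \<open>drop (length (concat t)) x = x\<close>.
\<close>

definition sCB_set :: "(nat \<Rightarrow> 'a word) \<Rightarrow> 'a word list set \<Rightarrow> 'a word list \<Rightarrow> 'a word set" where
  "sCB_set u H t =
     {x \<in> VRW u. propto (concat t) x \<and> t @ [drop (length (concat t)) x] \<notin> H}"

definition sCB_step :: "(nat \<Rightarrow> 'a word) \<Rightarrow> 'a word list set \<Rightarrow> 'a word list set" where
  "sCB_step u H =
     {t \<in> H \<inter> VRWfin u.
        \<not> (\<exists>f :: nat \<Rightarrow> 'a word. (\<forall>n. f n \<in> sCB_set u H t) \<and> (\<forall>n. propto (f n) (f (Suc n))))}"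

text \<open>Note that the derivative of order \<open>0\<close> is already one application of the derivation.\<close>

definition sCB :: "(nat \<Rightarrow> 'a word) \<Rightarrow> 'a word list set \<Rightarrow> omega1 \<Rightarrow> 'a word list set" where
  "sCB u H \<xi> = orec (sCB_step u H) (sCB_step u) Inter \<xi>"

definition sO :: "(nat \<Rightarrow> 'a word) \<Rightarrow> 'a word list set \<Rightarrow> omega1" where
  "sO u H = (LEAST \<xi>. sCB u H \<xi> = {})"

end

theory Submission
  imports Defs
begin

text \<open>
  A Schreier family behaves like a front of rank \<open>\<xi>\<close>: deleting the minimum \<open>n\<close> of its members
  leaves a family of the same kind of smaller rank, and these ranks converge to \<open>\<xi>\<close> if \<open>\<xi>\<close> is a
  limit. Hence induction on \<open>\<xi>\<close>, with Carlson's theorem as the pigeonhole principle and a fusion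
  argument, gives a reduction \<open>u\<close> such that \<open>W\<^sup>\<xi>\<close> restricted to \<open>u\<close> lies in \<open>F\<close> or misses \<open>F\<close>.
  Carlson's theorem itself comes from idempotent ultrafilters on words: a minimal idempotent \<open>e\<close> of
  the constant words and an idempotent \<open>p\<close> of variable words below it, which every substitution
  maps to \<open>e\<close>.

  By compactness \<open>H\<close> fails to be pointwise closed exactly if it has an infinite branch, and since
  \<open>H\<close> is hereditary a branch is the required reduction. Otherwise \<open>H\<close> is well-founded, which bounds
  all strong indices at once. The same induction on \<open>\<xi>\<close> shows that a sequence with no extension in
  \<open>H\<close> along the front of rank \<open>\<xi>\<close> is removed by the derivative of order \<open>\<xi> + 1\<close>, while the empty
  sequence survives the derivative of order \<open>\<xi>\<close> if \<open>H\<close> contains all initial segments of the front;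
  comparing \<open>\<xi>\<close> with the supremum of the indices decides which half of the dichotomy holds.
\<close>

section \<open>Ordinal arithmetic below \<open>\<omega>\<^sub>1\<close>\<close>

text \<open>The rank left after deleting a minimum depends on that minimum, so fronts carry an
  offset \<open>k\<close>, the length of the word already placed, and the inductions on \<xi> run
  over all offsets at once. Two obstacles explain the detour through \<open>hered\<close>. A
  nonempty derivative contains some \<open>t\<close>, not necessarily the empty sequence, so the
  dichotomy only speaks about continuations of \<open>t\<close>. To return to the empty sequence,
  \<open>t\<close> is absorbed into the first term of a new reduction; a letter substituted there
  acts on all of \<open>t\<close>, and \<open>VRWlist t1 \<subseteq> F\<close> covers exactly this.
  Conversely, a front inside \<open>F\<close> need not have its initial segments in
  \<open>hered F\<close>, since a coarsening of such a segment might reach beyond the front and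
  leave \<open>F\<close>; a second dichotomy, on sets of positions, excludes that. Finiteness of the
  alphabet keeps the set of partial words finite at every stage of a fusion and makes the windows of
  positions finite in the compactness argument.\<close>

lemma le_zero_omega1 [simp]: "x \<le> (0 :: omega1) \<longleftrightarrow> x = 0"
  by (metis antisym zero_le_omega1)

lemma not_less_zero_omega1 [simp]: "\<not> x < (0 :: omega1)"
  using zero_le_omega1 not_less by blast

lemma zero_less_omega1: "0 < (x :: omega1) \<longleftrightarrow> x \<noteq> 0"
  by (metis zero_le_omega1 order_le_less less_irrefl)

lemma zero_less_osuc [simp]: "0 < osuc x"
  by (simp add: zero_less_omega1 osuc_neq_zero)

lemma osuc_less_iff [simp]: "osuc x < osuc y \<longleftrightarrow> x < y"
  by (metis less_osuc_iff osuc_le_iff)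

lemma osuc_le_osuc_iff [simp]: "osuc x \<le> osuc y \<longleftrightarrow> x \<le> y"
  by (simp add: osuc_le_iff less_osuc_iff)

lemma not_is_limit_osuc [simp]: "\<not> is_limit (osuc x)"
  by (auto simp: is_limit_def is_succ_def)

lemma not_is_limit_zero [simp]: "\<not> is_limit 0"
  by (auto simp: is_limit_def)

lemma omega1_cases [case_names zero succ limit]:
  obtains "x = 0" | y where "x = osuc y" | "is_limit x"
  by (auto simp: is_limit_def is_succ_def)

lemma osuc_less_limit:
  assumes "is_limit l" "y < l"
  shows "osuc y < l"
  using assms by (metis not_is_limit_osuc order_le_less osuc_le_iff)

lemma omega1_induct [case_names zero succ limit]:
  assumes "P 0" "\<And>x. P x \<Longrightarrow> P (osuc x)" "\<And>x. is_limit x \<Longrightarrow> (\<And>y. y < x \<Longrightarrow> P y) \<Longrightarrow> P x"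
  shows "P (x :: omega1)"
proof (induction x rule: less_induct)
  case (less x)
  then show ?case
    by (cases x rule: omega1_cases) (use assms less_osuc in auto)
qed

lemma less_Sup_omega1:
  assumes "countable A" "A \<noteq> {}"
  shows "x < Sup A \<longleftrightarrow> (\<exists>a\<in>A. (x :: omega1) < a)"
  using assms bdd_above_countable_omega1 by (metis less_cSup_iff)

text \<open>The values of \<open>s\<close> matter only on the range \<open>{z..}\<close> of the function: this is how
  \<open>\<omega>\<^sup>x\<close>, which starts at \<open>1\<close>, becomes an instance.\<close>

locale normal_rec =
  fixes z :: omega1 and s :: "omega1 \<Rightarrow> omega1"
  assumes step: "z \<le> x \<Longrightarrow> x < s x"
begin

definition f :: "omega1 \<Rightarrow> omega1" where "f x = orec z s Sup x"

lemma f_limit: "is_limit x \<Longrightarrow> f x = Sup (f ` {..<x})"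
  by (simp add: f_def[abs_def] orec_limit)

lemma less_f_limit_iff:
  assumes "is_limit x"
  shows "y < f x \<longleftrightarrow> (\<exists>x'<x. y < f x')"
proof -
  have "0 \<in> {..<x}"
    using assms by (simp add: is_limit_def zero_less_omega1)
  then have "f ` {..<x} \<noteq> {}" by blast
  then show ?thesis
    unfolding f_limit[OF assms]
    by (subst less_Sup_omega1) (auto intro: countable_lessThan_omega1)
qed

lemma f_mono_aux: "z \<le> f x \<and> (\<forall>y<x. f y < f x)"
proof (induction x rule: omega1_induct)
  case zero
  then show ?case by (simp add: f_def orec_zero)
next
  case (succ x)
  have *: "f (osuc x) = s (f x)" by (simp add: f_def orec_succ)
  have "f x < f (osuc x)" using step succ unfolding * by simp
  then show ?case
    using succ by (auto simp: less_osuc_iff order_le_less[of _ x] intro: less_imp_le less_trans)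
next
  case (limit x)
  have lt: "f y < f x" if "y < x" for y
  proof -
    have "osuc y < x" using limit that osuc_less_limit by blast
    then show ?thesis
      using limit.IH[of "osuc y"] limit.hyps less_osuc less_f_limit_iff by blast
  qed
  moreover have "0 < x" using limit.hyps by (auto simp: is_limit_def zero_less_omega1)
  ultimately show ?case using limit.IH[of 0] by (metis less_imp_le order.trans)
qed

lemma f_less_iff [simp]: "f x < f y \<longleftrightarrow> x < y"
  using f_mono_aux by (metis less_irrefl less_trans neqE)

lemma f_le_iff [simp]: "f x \<le> f y \<longleftrightarrow> x \<le> y"
  by (metis f_less_iff not_less)

lemma le_f: "x \<le> f x"
proof (induction x rule: less_induct)
  case (less x)
  then show ?case by (metis f_less_iff not_less less_irrefl order_less_le_trans)
qed

lemma is_limit_f: "is_limit x \<Longrightarrow> is_limit (f x)"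
proof -
  assume l: "is_limit x"
  have "f x \<noteq> 0"
    using l le_f[of x] by auto
  moreover have "f x \<noteq> osuc y" for y
    using less_f_limit_iff[OF l, of y] by (metis f_less_iff less_osuc osuc_le_iff not_less)
  ultimately show "is_limit (f x)" by (auto simp: is_limit_def is_succ_def)
qed

end

section \<open>Ordinal addition\<close>

interpretation add: normal_rec x osuc for x
  by unfold_locales (simp add: less_osuc)

lemma add_f: "add.f x y = x + y"
  by (simp add: add.f_def plus_omega1_def)

lemma add_zero_omega1 [simp]: "x + 0 = (x :: omega1)"
  by (simp add: plus_omega1_def orec_zero)

lemma add_osuc [simp]: "x + osuc y = osuc (x + y)"
  by (simp add: plus_omega1_def orec_succ)

lemmas less_add_limit_iff = add.less_f_limit_iff[unfolded add_f]
  and add_less_cancel_omega1 [simp] = add.f_less_iff[unfolded add_f]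
  and add_le_cancel_omega1 [simp] = add.f_le_iff[unfolded add_f]
  and le_add_right_omega1 = add.le_f[unfolded add_f]
  and is_limit_add = add.is_limit_f[unfolded add_f]

lemma add_left_cancel_omega1 [simp]: "x + y = x + z \<longleftrightarrow> y = (z :: omega1)"
  by (metis add_le_cancel_omega1 antisym order_refl)

lemma le_add_left_omega1: "x \<le> x + (y :: omega1)"
  by (metis add_le_cancel_omega1 add_zero_omega1 zero_le_omega1)

lemma eq_omega1I: "(\<And>v. v < x \<longleftrightarrow> v < y) \<Longrightarrow> x = (y :: omega1)"
  by (metis less_irrefl neqE)

lemma zero_add_omega1 [simp]: "0 + x = (x :: omega1)"
proof (induction x rule: omega1_induct)
  case (limit x)
  show ?case
  proof (rule eq_omega1I)
    fix v
    show "v < 0 + x \<longleftrightarrow> v < x"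
      using limit by (auto simp: less_add_limit_iff) (metis less_osuc osuc_less_limit)
  qed
qed simp_all

lemma add_assoc_omega1: "(x + y) + z = x + (y + z :: omega1)"
proof (induction z rule: omega1_induct)
  case (limit z)
  have l: "is_limit (y + z)" using limit by (simp add: is_limit_add)
  show ?case
  proof (rule eq_omega1I)
    fix v
    have "v < x + (y + z) \<longleftrightarrow> (\<exists>z'<z. v < x + (y + z'))"
      using l limit.hyps less_add_limit_iff add_less_cancel_omega1 less_trans by meson
    then show "v < x + y + z \<longleftrightarrow> v < x + (y + z)"
      using limit by (auto simp: less_add_limit_iff)
  qed
qed simp_all

lemma add_right_mono_omega1: "x \<le> x' \<Longrightarrow> x + y \<le> x' + (y :: omega1)"
proof (induction y rule: omega1_induct)
  case (limit y)
  show ?case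
    unfolding not_less[symmetric]
  proof
    assume "x' + y < x + y"
    then obtain y' where "y' < y" "x' + y < x + y'" using limit.hyps less_add_limit_iff by blast
    then show False using limit.IH[OF _ limit.prems] add_less_cancel_omega1 
      by (metis not_less less_imp_le order.trans)
  qed
qed simp_all

text \<open>The least z with \<open>y \<le> x + z\<close> gives equality: if it is a limit,
  \<open>x + z\<close> is the supremum of the values at smaller arguments, which all lie below
  y.\<close>

lemma le_imp_ex_add_omega1:
  assumes "x \<le> (y :: omega1)"
  obtains z where "y = x + z"
proof -
  define z where "z = (LEAST z. y \<le> x + z)"
  have z: "y \<le> x + z" unfolding z_def by (rule LeastI[of _ y]) (rule le_add_right_omega1)
  have least: "x + z' < y" if "z' < z" for z'
    using that not_less_Least unfolding z_def by (metis not_less)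
  have "x + z \<le> y"
  proof (cases z rule: omega1_cases)
    case zero
    then show ?thesis using assms by simp
  next
    case (succ z')
    then show ?thesis using least less_osuc by (simp add: osuc_le_iff)
  next
    case limit
    then show ?thesis using least by (metis less_add_limit_iff not_less less_asym)
  qed
  then show thesis using z that by (metis antisym)
qed

section \<open>Finite ordinals, omega and multiplication by omega\<close>

lemma ofin_simps [simp]: "ofin 0 = 0" "ofin (Suc n) = osuc (ofin n)"
  by (simp_all add: ofin_def)

lemma less_omega_iff: "x < omega \<longleftrightarrow> (\<exists>n. x < ofin n)"
  unfolding omega_def by (subst less_Sup_omega1) auto

lemma less_ofin_imp: "x < ofin n \<Longrightarrow> \<exists>m<n. x = ofin m"
  by (induction n) (auto simp: less_osuc_iff order_le_less less_Suc_eq)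

lemma is_limit_omega: "is_limit omega"
proof -
  have "0 < omega" unfolding less_omega_iff by (rule exI[of _ "Suc 0"]) simp
  then have "omega \<noteq> 0" by (simp add: zero_less_omega1)
  moreover have "omega \<noteq> osuc y" for y
  proof
    assume y: "omega = osuc y"
    have "y < omega" unfolding y by (rule less_osuc)
    then obtain n where "y < ofin n" unfolding less_omega_iff ..
    then have "osuc y < ofin (Suc n)" by simp
    then have "osuc y < omega" unfolding less_omega_iff ..
    then show False using y by simp
  qed
  ultimately show ?thesis by (auto simp: is_limit_def is_succ_def)
qed

lemma times_zero_omega1 [simp]: "x * 0 = (0 :: omega1)"
  by (simp add: times_omega1_def orec_zero)

lemma times_osuc [simp]: "x * osuc y = x * y + x"
  by (simp add: times_omega1_def orec_succ)

lemma less_times_omega_iff: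
  assumes "0 < x"
  shows "v < x * omega \<longleftrightarrow> (\<exists>n. v < x * ofin n)"
proof -
  interpret t: normal_rec 0 "\<lambda>z. z + x"
    using assms by unfold_locales (metis add_less_cancel_omega1 add_zero_omega1)
  have f: "t.f y = x * y" for y by (simp add: t.f_def times_omega1_def)
  have "ofin n < omega" for n
    unfolding less_omega_iff by (rule exI[of _ "Suc n"]) (simp add: less_osuc)
  moreover have "\<exists>n. y = ofin n" if "y < omega" for y
    using that less_omega_iff less_ofin_imp by blast
  ultimately show ?thesis
    unfolding t.less_f_limit_iff[OF is_limit_omega, unfolded f] by blast
qed

lemma times_omega_gt: "0 < x \<Longrightarrow> x < x * omega"
  by (subst less_times_omega_iff) (auto intro!: exI[of _ 2] simp: numeral_2_eq_2 
      add_less_cancel_omega1[of x 0 x, simplified])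

lemma omega1_one_neq_zero [simp]: "(1 :: omega1) \<noteq> 0"
  by (simp add: one_omega1_def osuc_neq_zero)

lemma one_le_omega1: "1 \<le> x \<longleftrightarrow> 0 < (x :: omega1)"
  by (simp add: one_omega1_def osuc_le_iff)

section \<open>Powers of omega\<close>

interpretation opow: normal_rec 1 "\<lambda>z. z * omega"
  by unfold_locales (simp add: one_le_omega1 times_omega_gt)

lemma opow_f: "opow.f x = omega_pow x"
  by (simp add: opow.f_def omega_pow_def)

lemma omega_pow_zero [simp]: "omega_pow 0 = 1"
  by (simp add: omega_pow_def orec_zero)

lemma omega_pow_osuc: "omega_pow (osuc c) = omega_pow c * omega"
  by (simp add: omega_pow_def orec_succ)

lemmas less_omega_pow_limit_iff = opow.less_f_limit_iff[unfolded opow_f]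
  and omega_pow_less_iff [simp] = opow.f_less_iff[unfolded opow_f]
  and omega_pow_le_iff [simp] = opow.f_le_iff[unfolded opow_f]
  and le_omega_pow = opow.le_f[unfolded opow_f]

lemma omega_pow_eq_iff [simp]: "omega_pow x = omega_pow y \<longleftrightarrow> x = y"
  by (metis antisym omega_pow_le_iff order_refl)

lemma omega_pow_pos [simp]: "0 < omega_pow c"
  using opow.f_mono_aux[of c] by (simp add: opow_f one_le_omega1)

lemma omega_pow_neq_zero [simp]: "omega_pow c \<noteq> 0"
  using omega_pow_pos[of c] by (metis less_irrefl)

lemma less_omega_pow_osuc_iff: "v < omega_pow (osuc c) \<longleftrightarrow> (\<exists>n. v < omega_pow c * ofin n)"
  by (simp add: omega_pow_osuc less_times_omega_iff)

lemma times_ofin_add: "x * ofin m + x * ofin n = (x * ofin (m + n) :: omega1)"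
  by (induction n) (simp_all flip: add_assoc_omega1)

lemma times_ofin_mono: "m \<le> n \<Longrightarrow> x * ofin m \<le> x * ofin n"
  by (metis le_Suc_ex le_add_left_omega1 times_ofin_add)

text \<open>At a successor exponent both summands lie below finite multiples of the preceding power,
  at a limit exponent below one common smaller power.\<close>

lemma omega_pow_indecomposable:
  "x < omega_pow c \<Longrightarrow> y < omega_pow c \<Longrightarrow> x + y < omega_pow c"
proof (induction c arbitrary: x y rule: omega1_induct)
  case zero
  then show ?case by (simp add: one_omega1_def less_osuc_iff)
next
  case (succ c)
  then obtain m n where "x < omega_pow c * ofin m" "y < omega_pow c * ofin n"
    by (auto simp: less_omega_pow_osuc_iff)
  then have "x + y < omega_pow c * ofin (m + n)"
    by (metis times_ofin_add add_right_mono_omega1 add_less_cancel_omega1 less_imp_le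
        order_le_less_trans)
  then show ?case by (auto simp: less_omega_pow_osuc_iff)
next
  case (limit c)
  then obtain b1 b2 where "b1 < c" "b2 < c" "x < omega_pow b1" "y < omega_pow b2"
    by (auto simp: less_omega_pow_limit_iff)
  then have "max b1 b2 < c" "x < omega_pow (max b1 b2)" "y < omega_pow (max b1 b2)"
    by (auto simp: max_def not_le intro: less_trans order_less_le_trans)
  then show ?case using limit by (metis less_omega_pow_limit_iff)
qed

text \<open>A predecessor y would make the power equal to \<open>y + 1\<close>, a sum of two smaller
  ordinals.\<close>

lemma is_limit_omega_pow: "0 < c \<Longrightarrow> is_limit (omega_pow c)"
proof -
  assume c: "0 < c"
  have "omega_pow c \<noteq> osuc y" for y
  proof
    assume y: "omega_pow c = osuc y"
    have "1 < omega_pow c" using c omega_pow_less_iff[of 0 c] by simp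
    moreover have "y < omega_pow c" using y less_osuc by simp
    ultimately have "y + 1 < omega_pow c" by (rule omega_pow_indecomposable[rotated])
    then show False using y by (simp add: one_omega1_def)
  qed
  then show ?thesis by (auto simp: is_limit_def is_succ_def)
qed

lemma less_add_omega_pow:
  assumes "x < y + omega_pow c" "b < c"
  shows "x + omega_pow b < y + omega_pow c"
proof (cases "x \<le> y")
  case True
  then have "x + omega_pow b \<le> y + omega_pow b" by (rule add_right_mono_omega1)
  also have "\<dots> < y + omega_pow c" using assms by simp
  finally show ?thesis .
next
  case False
  then obtain z where "x = y + z" using le_imp_ex_add_omega1 by (metis linear)
  then show ?thesis
    using assms omega_pow_indecomposable by (simp add: add_assoc_omega1)
qed

subsection \<open>Cantor normal forms\<close>

text \<open>Exponents are listed in increasing order, the reverse of the usual notation, because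
  the part of a Schreier set with the smallest exponent comes first.\<close>

fun cnf_val :: "omega1 list \<Rightarrow> omega1" where
  "cnf_val [] = 0"
| "cnf_val (c # cs) = cnf_val cs + omega_pow c"

lemma cnf_val_append: "cnf_val (xs @ ys) = cnf_val ys + cnf_val xs"
  by (induction xs) (simp_all add: add_assoc_omega1)

lemma cnf_val_replicate: "cnf_val (replicate n c) = omega_pow c * ofin n"
  by (induction n) simp_all

lemma omega_pow_le_cnf_val: "c \<in> set cs \<Longrightarrow> omega_pow c \<le> cnf_val cs"
  by (induction cs)
    (auto intro: le_add_right_omega1 le_add_left_omega1 order.trans)

text \<open>Adding powers with exponents below c on the right never lifts the sum to
  \<open>cnf_val cs + omega_pow c\<close>. This is what makes the rank drop when a minimum is
  deleted.\<close>

lemma cnf_val_less: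
  "(\<And>b. b \<in> set ds \<Longrightarrow> b < c) \<Longrightarrow> cnf_val (ds @ cs) < cnf_val (c # cs)"
  by (induction ds) (auto simp: less_add_omega_pow add_less_cancel_omega1[of _ 0, simplified])

lemma cnf_val_less_omega_pow:
  "(\<And>b. b \<in> set cs \<Longrightarrow> b < c) \<Longrightarrow> cnf_val cs < omega_pow c"
  using cnf_val_less[of cs c "[]"] by simp

lemma is_limit_cnf_val: "0 < c \<Longrightarrow> is_limit (cnf_val (c # cs))"
  by (simp add: is_limit_add is_limit_omega_pow)

lemma cnf_val_eq_zero_iff [simp]: "cnf_val cs = 0 \<longleftrightarrow> cs = []"
proof (cases cs)
  case (Cons c cs')
  then have "0 < cnf_val cs"
    using order_less_le_trans[OF omega_pow_pos le_add_right_omega1] by simp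
  then show ?thesis using Cons by auto
qed simp

text \<open>The largest exponent stands last and is pinned down by the two consecutive powers of
  omega between which the value lies; addition then cancels on the left.\<close>

lemma cnf_val_inj:
  "sorted cs \<Longrightarrow> sorted ds \<Longrightarrow> cnf_val cs = cnf_val ds \<Longrightarrow> cs = ds"
proof (induction cs arbitrary: ds rule: rev_induct)
  case Nil
  then show ?case by (metis cnf_val_eq_zero_iff)
next
  case (snoc c cs)
  then obtain d ds' where ds: "ds = ds' @ [d]" by (metis cnf_val_eq_zero_iff rev_exhaust snoc_eq_iff_butlast)
  have below: "cnf_val (xs @ [x]) < omega_pow (osuc x) \<and> omega_pow x \<le> cnf_val (xs @ [x])"
    if "sorted (xs @ [x])" for xs x
    using that cnf_val_less_omega_pow[of "xs @ [x]" "osuc x"] omega_pow_le_cnf_val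
    by (auto simp: sorted_append less_osuc_iff)
  have "c = d"
    using below[OF snoc.prems(1)] below[of ds' d] snoc.prems ds
    by (metis omega_pow_less_iff less_osuc_iff order_le_less_trans antisym)
  then show ?case
    using snoc ds by (auto simp: cnf_val_append sorted_append)
qed

lemma ex_cnf: "\<exists>cs. sorted cs \<and> cnf_val cs = x"
proof (induction x rule: less_induct)
  case (less x)
  show ?case
  proof (cases "x = 0")
    case True
    then show ?thesis by (intro exI[of _ "[]"]) simp
  next
    case False
    \<comment> \<open>The least power above x has a successor exponent, whose predecessor c is the
      largest exponent of the normal form.\<close>
    define d where "d = (LEAST d. x < omega_pow d)"
    have "x < omega_pow (osuc x)"
      using le_omega_pow less_osuc order_less_le_trans by blast
    then have d: "x < omega_pow d" unfolding d_def by (rule LeastI)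
    have least: "omega_pow d' \<le> x" if "d' < d" for d'
      using that not_less_Least unfolding d_def by (metis not_less)
    obtain c where c: "d = osuc c"
    proof (cases d rule: omega1_cases)
      case zero
      then show thesis using False d by (simp add: one_omega1_def less_osuc_iff)
    next
      case limit
      then show thesis using least d by (metis less_omega_pow_limit_iff not_less)
    qed
    then have cx: "omega_pow c \<le> x" using least less_osuc by blast
    then obtain y where y: "x = omega_pow c + y" by (rule le_imp_ex_add_omega1)
    \<comment> \<open>Otherwise x would absorb \<open>omega_pow c\<close> from the left any number
      of times and so reach \<open>omega_pow (osuc c)\<close>.\<close>
    have "y \<noteq> x"
    proof
      assume "y = x"
      then have eq: "x = omega_pow c + x" using y by simp
      have "omega_pow c * ofin n + x = x" for n
        by (induction n) (simp_all add: add_assoc_omega1 flip: eq)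
      then have "omega_pow c * ofin n \<le> x" for n by (metis le_add_left_omega1)
      then show False using d c by (metis less_omega_pow_osuc_iff not_less)
    qed
    then have "y < x" using y le_add_right_omega1 by (metis order_le_less)
    then obtain cs where cs: "sorted cs" "cnf_val cs = y" using less by blast
    have "b \<le> c" if "b \<in> set cs" for b
    proof -
      have "omega_pow b < omega_pow (osuc c)"
        using omega_pow_le_cnf_val[OF that] cs \<open>y < x\<close> d c by (metis le_less_trans less_trans)
      then show ?thesis by (simp add: less_osuc_iff)
    qed
    then show ?thesis
      using cs y by (intro exI[of _ "cs @ [c]"]) (auto simp: sorted_append cnf_val_append)
  qed
qed

section \<open>The structure of the Schreier families\<close>

text \<open>Coefficients become repetitions and exponent 0 is allowed, so that the successor rule
  and the rule for Cantor normal forms become the same kind of statement.\<close>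

fun schreier_list :: "(omega1 \<Rightarrow> nat \<Rightarrow> omega1) \<Rightarrow> omega1 list \<Rightarrow> nat set \<Rightarrow> bool" where
  "schreier_list L [] s \<longleftrightarrow> s = {}"
| "schreier_list L (c # cs) s \<longleftrightarrow>
     (\<exists>s1 s2. s = s1 \<union> s2 \<and> set_less s1 s2 \<and> schreier L (omega_pow c) s1 \<and> schreier_list L cs s2)"

lemma set_less_simps [simp]:
  "set_less {} t" "set_less s {}"
  "set_less (s \<union> s') t \<longleftrightarrow> set_less s t \<and> set_less s' t"
  "set_less s (t \<union> t') \<longleftrightarrow> set_less s t \<and> set_less s t'"
  "set_less (\<Union>i\<in>I. f i) t \<longleftrightarrow> (\<forall>i\<in>I. set_less (f i) t)"
  "set_less s (\<Union>i\<in>I. f i) \<longleftrightarrow> (\<forall>i\<in>I. set_less s (f i))"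
  by (auto simp: set_less_def)

lemma set_less_trans: "set_less s t \<Longrightarrow> set_less t u \<Longrightarrow> t \<noteq> {} \<Longrightarrow> set_less s u"
  unfolding set_less_def by (meson ex_in_conv less_trans)

text \<open>\<open>set_less\<close> is transitive only across a nonempty middle set, hence the
  second assumption.\<close>

lemma set_less_chain:
  assumes "\<And>j. Suc j < p \<Longrightarrow> set_less (S j) (S (Suc j))" "\<And>j. j < p \<Longrightarrow> S j \<noteq> {}"
  shows "i < j \<Longrightarrow> j < p \<Longrightarrow> set_less (S i) (S j)"
proof (induction j)
  case (Suc j)
  then show ?case
    using assms by (cases "i = j") (auto intro!: set_less_trans[of "S i" "S j"])
qed simp

lemma set_less_chain_down:
  assumes "\<And>j. j < m \<Longrightarrow> set_less (S (Suc j)) (S j)" "\<And>j. j \<le> m \<Longrightarrow> S j \<noteq> {}"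
  shows "i < j \<Longrightarrow> j \<le> m \<Longrightarrow> set_less (S j) (S i)"
proof (induction j)
  case (Suc j)
  then show ?case
    using assms by (cases "i = j") (auto intro!: set_less_trans[of "S (Suc j)" "S j" "S i"])
qed simp

lemma schreier_finite_pos_nonempty:
  "schreier L \<xi> s \<Longrightarrow> finite s \<and> (\<forall>x\<in>s. 1 \<le> x) \<and> (\<xi> \<noteq> 0 \<longrightarrow> s \<noteq> {})"
proof (induction rule: schreier.induct)
  case (cantor \<xi> a m p s)
  have "s 0 0 \<noteq> {}" "0 < p 0"
    using cantor.IH(1)[of 0 0] cantor.hyps(6)[of 0] by auto
  then have "(\<Union>i\<le>m. \<Union>j<p i. s i j) \<noteq> {}" by blast
  then show ?case using cantor.IH(1) by blast
next
  case (pow_succ n s \<beta>)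
  have "1 \<in> {1..n}" using pow_succ.hyps(1) by simp
  then have "s 1 \<subseteq> (\<Union>i\<in>{1..n}. s i)" by (rule UN_upper)
  then have "(\<Union>i\<in>{1..n}. s i) \<noteq> {}" using pow_succ.hyps(2) by blast
  then show ?case using pow_succ.IH by blast
next
  case (pow_limit \<eta> s)
  then show ?case by blast
next
  case (succ n \<zeta> s)
  then show ?case by blast
qed simp_all

lemma schreier_pow_nonempty: "schreier L (omega_pow c) s \<Longrightarrow> s \<noteq> {}"
  using schreier_finite_pos_nonempty by (metis omega_pow_neq_zero)

lemma schreier_zero_iff: "schreier L 0 s \<longleftrightarrow> s = {}"
proof
  assume "schreier L 0 s"
  then show "s = {}"
    by cases (use omega1_one_neq_zero osuc_neq_zero omega_pow_neq_zero in \<open>auto dest: sym\<close>)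
qed (simp add: schreier.zero)

lemma schreier_one_iff: "schreier L 1 s \<longleftrightarrow> (\<exists>n\<ge>1. s = {n})"
proof
  assume "schreier L 1 s"
  then show "\<exists>n\<ge>1. s = {n}"
  proof cases
    case (succ n \<zeta> s')
    then have "\<zeta> = 0" by (simp add: one_omega1_def osuc_inject)
    then show ?thesis using succ schreier_zero_iff by auto
  next
    case (pow_succ n s \<beta>)
    then show ?thesis using omega_pow_eq_iff[of 0 "osuc \<beta>"] osuc_neq_zero[of \<beta>] by simp
  next
    case (pow_limit \<eta>)
    then show ?thesis using omega_pow_eq_iff[of 0 \<eta>] by auto
  next
    case cantor
    then show ?thesis by (simp add: one_omega1_def)
  qed auto
qed (auto intro: schreier.one)

lemma schreier_list_append:
  "schreier_list L (xs @ ys) s \<longleftrightarrow>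
     (\<exists>s1 s2. s = s1 \<union> s2 \<and> set_less s1 s2 \<and> schreier_list L xs s1 \<and> schreier_list L ys s2)"
proof (induction xs arbitrary: s)
  case (Cons c xs)
  show ?case
  proof
    assume "schreier_list L ((c # xs) @ ys) s"
    then obtain s1 s2 s3 where "s = s1 \<union> (s2 \<union> s3)" "set_less s1 (s2 \<union> s3)" "set_less s2 s3"
      "schreier L (omega_pow c) s1" "schreier_list L xs s2" "schreier_list L ys s3"
      using Cons by auto
    then show "\<exists>s1 s2. s = s1 \<union> s2 \<and> set_less s1 s2 \<and> schreier_list L (c # xs) s1 \<and> schreier_list L ys s2"
      by (intro exI[of _ "s1 \<union> s2"] exI[of _ s3]) auto
  next
    assume "\<exists>s1 s2. s = s1 \<union> s2 \<and> set_less s1 s2 \<and> schreier_list L (c # xs) s1 \<and> schreier_list L ys s2"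
    then obtain s1 s2 s3 where *: "s = (s1 \<union> s2) \<union> s3" "set_less (s1 \<union> s2) s3" "set_less s1 s2"
      "schreier L (omega_pow c) s1" "schreier_list L xs s2" "schreier_list L ys s3"
      by auto
    then have "schreier_list L (xs @ ys) (s2 \<union> s3)" using Cons by auto
    moreover have "s = s1 \<union> (s2 \<union> s3)" "set_less s1 (s2 \<union> s3)" using * by auto
    ultimately show "schreier_list L ((c # xs) @ ys) s"
      using *(4) unfolding append_Cons schreier_list.simps by blast
  qed
qed simp

lemma schreier_list_replicate:
  "schreier_list L (replicate p c) s \<longleftrightarrow>
     (\<exists>S. (\<forall>j<p. schreier L (omega_pow c) (S j)) \<and>
          (\<forall>j. Suc j < p \<longrightarrow> set_less (S j) (S (Suc j))) \<and> s = (\<Union>j<p. S j))"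
proof (induction p arbitrary: s)
  case (Suc p)
  show ?case
  proof
    assume "schreier_list L (replicate (Suc p) c) s"
    then obtain s1 S where *: "s = s1 \<union> (\<Union>j<p. S j)" "set_less s1 (\<Union>j<p. S j)"
      "schreier L (omega_pow c) s1" "\<forall>j<p. schreier L (omega_pow c) (S j)"
      "\<forall>j. Suc j < p \<longrightarrow> set_less (S j) (S (Suc j))"
      using Suc by auto
    define T where "T = case_nat s1 S"
    have "\<forall>j<Suc p. schreier L (omega_pow c) (T j)"
      and "\<forall>j. Suc j < Suc p \<longrightarrow> set_less (T j) (T (Suc j))"
      using * by (auto simp: T_def split: nat.split)
    moreover have "s = (\<Union>j<Suc p. T j)"
      using * unfolding lessThan_Suc_eq_insert_0 by (simp add: T_def)
    ultimately show "\<exists>S. (\<forall>j<Suc p. schreier L (omega_pow c) (S j)) \<and>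
          (\<forall>j. Suc j < Suc p \<longrightarrow> set_less (S j) (S (Suc j))) \<and> s = (\<Union>j<Suc p. S j)"
      by blast
  next
    assume "\<exists>S. (\<forall>j<Suc p. schreier L (omega_pow c) (S j)) \<and>
          (\<forall>j. Suc j < Suc p \<longrightarrow> set_less (S j) (S (Suc j))) \<and> s = (\<Union>j<Suc p. S j)"
    then obtain S where *: "\<forall>j<Suc p. schreier L (omega_pow c) (S j)"
      "\<forall>j. Suc j < Suc p \<longrightarrow> set_less (S j) (S (Suc j))" "s = (\<Union>j<Suc p. S j)" by blast
    have "schreier_list L (replicate p c) (\<Union>j<p. S (Suc j))"
      unfolding Suc using * by (intro exI[of _ "\<lambda>j. S (Suc j)"]) auto
    moreover have "S j \<noteq> {}" if "j < Suc p" for j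
      using *(1) that schreier_pow_nonempty by blast
    then have "set_less (S 0) (S (Suc j))" if "j < p" for j
      using set_less_chain[of "Suc p" S 0 "Suc j"] *(2) that by auto
    moreover have "s = S 0 \<union> (\<Union>j<p. S (Suc j))"
      using * unfolding lessThan_Suc_eq_insert_0 by simp
    moreover have "schreier L (omega_pow c) (S 0)" using *(1) by blast
    ultimately show "schreier_list L (replicate (Suc p) c) s"
      unfolding replicate_Suc schreier_list.simps
      by (intro exI[of _ "S 0"] exI[of _ "\<Union>j<p. S (Suc j)"]) auto
  qed
qed simp

text \<open>The bridge from the data of rule \<open>cantor\<close> to sorted lists; the order is
  reversed because the exponents of the rule decrease.\<close>

definition cnf_list :: "nat \<Rightarrow> (nat \<Rightarrow> omega1) \<Rightarrow> (nat \<Rightarrow> nat) \<Rightarrow> omega1 list" where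
  "cnf_list m a p = concat (map (\<lambda>i. replicate (p i) (a i)) (rev [0..<Suc m]))"

lemma cnf_list_0: "cnf_list 0 a p = replicate (p 0) (a 0)"
  by (simp add: cnf_list_def)

lemma cnf_list_Suc:
  "cnf_list (Suc m) a p = replicate (p (Suc m)) (a (Suc m)) @ cnf_list m a p"
  by (simp add: cnf_list_def)

lemma cnf_list_cong:
  "(\<And>i. i \<le> m \<Longrightarrow> a i = a' i \<and> p i = p' i) \<Longrightarrow> cnf_list m a p = cnf_list m a' p'"
  unfolding cnf_list_def by (intro arg_cong[where f = concat] map_cong) auto

lemma omega_sum_eq_cnf_val: "omega_sum m a p = cnf_val (cnf_list m a p)"
proof -
  have "foldr (\<lambda>i x. omega_pow (a i) * ofin (p i) + x) xs 0
      = cnf_val (concat (map (\<lambda>i. replicate (p i) (a i)) (rev xs)))" for xs :: "nat list"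
    by (induction xs) (simp_all add: cnf_val_append cnf_val_replicate)
  then show ?thesis unfolding omega_sum_def cnf_list_def .
qed

lemma set_cnf_list: "set (cnf_list m a p) \<subseteq> a ` {..m}"
  by (auto simp: cnf_list_def)

lemma sorted_cnf_list:
  "(\<And>i. i < m \<Longrightarrow> a (Suc i) < a i) \<Longrightarrow> sorted (cnf_list m a p) \<and> (\<forall>i\<le>m. a m \<le> a i)"
proof (induction m)
  case (Suc m)
  then have IH: "sorted (cnf_list m a p)" "\<And>i. i \<le> m \<Longrightarrow> a m \<le> a i" by auto
  have "a (Suc m) \<le> a i" if "i \<le> Suc m" for i
    using that Suc.prems[of m] IH(2)[of i] by (cases "i = Suc m") auto
  then show ?case
    using IH set_cnf_list[of m a p] by (force simp: cnf_list_Suc sorted_append)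
qed (simp add: cnf_list_0)

text \<open>Run-length encoding: a new head equal to the smallest exponent so far lengthens the last
  run, any other head opens a new one.\<close>

lemma sorted_imp_cnf_list:
  "sorted cs \<Longrightarrow> cs \<noteq> [] \<Longrightarrow>
    \<exists>m a p. cs = cnf_list m a p \<and> (\<forall>i\<le>m. 1 \<le> p i) \<and> (\<forall>i<m. a (Suc i) < a i) \<and>
            a m = hd cs \<and> a 0 = last cs"
proof (induction cs)
  case (Cons c cs)
  show ?case
  proof (cases "cs = []")
    case True
    then show ?thesis
      by (intro exI[of _ 0] exI[of _ "\<lambda>_. c"] exI[of _ "\<lambda>_. 1"]) (simp add: cnf_list_0)
  next
    case False
    then obtain m a p where IH: "cs = cnf_list m a p" "\<forall>i\<le>m. 1 \<le> p i" "\<forall>i<m. a (Suc i) < a i"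
      "a m = hd cs" "a 0 = last cs"
      using Cons by auto
    have "c \<le> a m" using Cons.prems False IH by (cases cs) auto
    show ?thesis
    proof (cases "c = a m")
      case True
      define p' where "p' = p(m := Suc (p m))"
      have "cnf_list m a p' = c # cnf_list m a p"
      proof (cases m)
        case (Suc k)
        then show ?thesis
          using True cnf_list_cong[of k a a p p'] by (simp add: cnf_list_Suc p'_def)
      qed (simp add: cnf_list_0 True p'_def)
      moreover have "\<forall>i\<le>m. 1 \<le> p' i" using IH(2) by (simp add: p'_def)
      ultimately show ?thesis
        using IH True False by (intro exI[of _ m] exI[of _ a] exI[of _ p']) simp
    next
      case c: False
      define a' p' where "a' = a(Suc m := c)" and "p' = p(Suc m := 1)"
      have "cnf_list (Suc m) a' p' = c # cnf_list m a p"
        using cnf_list_cong[of m a a' p p'] by (simp add: cnf_list_Suc a'_def p'_def)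
      moreover have "\<forall>i\<le>Suc m. 1 \<le> p' i" using IH(2) by (simp add: p'_def)
      moreover have "\<forall>i<Suc m. a' (Suc i) < a' i"
        using IH(3) c \<open>c \<le> a m\<close> by (auto simp: a'_def less_Suc_eq)
      moreover have "a' (Suc m) = c" "a' 0 = a 0" by (simp_all add: a'_def)
      ultimately show ?thesis
        using IH False by (intro exI[of _ "Suc m"] exI[of _ a'] exI[of _ p']) simp
    qed
  qed
qed simp

lemma schreier_list_cnf_listI:
  assumes "\<And>i j. i \<le> m \<Longrightarrow> j < p i \<Longrightarrow> schreier L (omega_pow (a i)) (S i j)"
    and "\<And>i j. i \<le> m \<Longrightarrow> Suc j < p i \<Longrightarrow> set_less (S i j) (S i (Suc j))"
    and "\<And>i. i < m \<Longrightarrow> set_less (\<Union>j<p (Suc i). S (Suc i) j) (\<Union>j<p i. S i j)"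
    and "\<And>i. i \<le> m \<Longrightarrow> 1 \<le> p i"
  shows "schreier_list L (cnf_list m a p) (\<Union>i\<le>m. \<Union>j<p i. S i j)"
  using assms
proof (induction m)
  case 0
  then show ?case by (auto simp: cnf_list_0 schreier_list_replicate intro!: exI[of _ "S 0"])
next
  case (Suc m)
  define T where "T i = (\<Union>j<p i. S i j)" for i
  \<comment> \<open>Coefficients are positive, so no part is empty and the order of neighbouring
    parts carries over to all parts.\<close>
  have ne: "T i \<noteq> {}" if "i \<le> Suc m" for i
    using Suc.prems(1)[of i 0] Suc.prems(4)[of i] that schreier_pow_nonempty
    unfolding T_def by fastforce
  have "set_less (T (Suc m)) (T i)" if "i \<le> m" for i
    by (rule set_less_chain_down[of "Suc m" T]) (use Suc.prems(3) ne that in \<open>auto simp: T_def\<close>)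
  then have "set_less (T (Suc m)) (\<Union>i\<le>m. T i)" by simp
  moreover have "schreier_list L (cnf_list m a p) (\<Union>i\<le>m. T i)"
    unfolding T_def by (rule Suc.IH) (use Suc.prems in auto)
  moreover have "schreier_list L (replicate (p (Suc m)) (a (Suc m))) (T (Suc m))"
    unfolding T_def schreier_list_replicate
    using Suc.prems(1,2) by (intro exI[of _ "S (Suc m)"]) auto
  moreover have "(\<Union>i\<le>Suc m. T i) = T (Suc m) \<union> (\<Union>i\<le>m. T i)" by (simp add: atMost_Suc)
  ultimately have "schreier_list L (cnf_list (Suc m) a p) (\<Union>i\<le>Suc m. T i)"
    unfolding cnf_list_Suc schreier_list_append by blast
  then show ?case unfolding T_def .
qed

lemma schreier_list_cnf_listD:
  "schreier_list L (cnf_list m a p) s \<Longrightarrow>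
    \<exists>S. (\<forall>i\<le>m. \<forall>j<p i. schreier L (omega_pow (a i)) (S i j)) \<and>
        (\<forall>i\<le>m. \<forall>j. Suc j < p i \<longrightarrow> set_less (S i j) (S i (Suc j))) \<and>
        (\<forall>i<m. set_less (\<Union>j<p (Suc i). S (Suc i) j) (\<Union>j<p i. S i j)) \<and>
        s = (\<Union>i\<le>m. \<Union>j<p i. S i j)"
proof (induction m arbitrary: s)
  case 0
  then obtain S where "\<forall>j<p 0. schreier L (omega_pow (a 0)) (S j)"
    "\<forall>j. Suc j < p 0 \<longrightarrow> set_less (S j) (S (Suc j))" "s = (\<Union>j<p 0. S j)"
    by (auto simp: cnf_list_0 schreier_list_replicate)
  then show ?case by (intro exI[of _ "\<lambda>_. S"]) auto
next
  case (Suc m)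
  then obtain s1 s2 where *: "s = s1 \<union> s2" "set_less s1 s2"
    "schreier_list L (replicate (p (Suc m)) (a (Suc m))) s1" "schreier_list L (cnf_list m a p) s2"
    by (auto simp: cnf_list_Suc schreier_list_append)
  obtain T where T: "\<forall>j<p (Suc m). schreier L (omega_pow (a (Suc m))) (T j)"
    "\<forall>j. Suc j < p (Suc m) \<longrightarrow> set_less (T j) (T (Suc j))" "s1 = (\<Union>j<p (Suc m). T j)"
    using *(3) by (auto simp: schreier_list_replicate)
  obtain S where S: "\<forall>i\<le>m. \<forall>j<p i. schreier L (omega_pow (a i)) (S i j)"
    "\<forall>i\<le>m. \<forall>j. Suc j < p i \<longrightarrow> set_less (S i j) (S i (Suc j))"
    "\<forall>i<m. set_less (\<Union>j<p (Suc i). S (Suc i) j) (\<Union>j<p i. S i j)"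
    "s2 = (\<Union>i\<le>m. \<Union>j<p i. S i j)"
    using Suc.IH[OF *(4)] by blast
  have "set_less s1 (\<Union>j<p m. S m j)" using *(2) unfolding S(4) by simp
  moreover have "s = (\<Union>i\<le>Suc m. \<Union>j<p i. (S(Suc m := T)) i j)"
    using *(1) T(3) S(4) by (auto simp: atMost_Suc)
  ultimately show ?case
    using S T by (intro exI[of _ "S(Suc m := T)"]) (auto simp: le_Suc_eq less_Suc_eq)
qed

lemma schreier_listD:
  "sorted cs \<Longrightarrow> schreier_list L cs s \<Longrightarrow> schreier L (cnf_val cs) s"
proof (induction cs arbitrary: s)
  case Nil
  then show ?case by (simp add: schreier.zero)
next
  case (Cons c cs)
  then obtain s1 s2 where s: "s = s1 \<union> s2" "set_less s1 s2" "schreier L (omega_pow c) s1"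
    "schreier_list L cs s2" by auto
  \<comment> \<open>A leading exponent 0 calls for rule \<open>succ\<close>, a single power is
    membership already, and the rest is an instance of \<open>cantor\<close>, whose strict lower
    bound comes from the second entry.\<close>
  consider "c = 0" | "0 < c" "cs = []" | "0 < c" "cs \<noteq> []" by (auto simp: zero_less_omega1)
  then show ?case
  proof cases
    case 1
    then obtain n where "n \<ge> 1" "s1 = {n}" using s(3) schreier_one_iff by auto
    moreover have "schreier L (cnf_val cs) s2" using Cons s by simp
    ultimately have "schreier L (osuc (cnf_val cs)) (insert n s2)" using s by (simp add: schreier.succ)
    then show ?thesis using 1 s \<open>s1 = {n}\<close> by (simp add: one_omega1_def)
  next
    case 2
    then show ?thesis using s by simp
  next
    case 3
    obtain m a p where ap: "c # cs = cnf_list m a p" "\<forall>i\<le>m. 1 \<le> p i" "\<forall>i<m. a (Suc i) < a i"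
      "a m = c" "a 0 = last cs"
      using sorted_imp_cnf_list[OF Cons.prems(1)] 3 by auto
    obtain S where S: "\<forall>i\<le>m. \<forall>j<p i. schreier L (omega_pow (a i)) (S i j)"
      "\<forall>i\<le>m. \<forall>j. Suc j < p i \<longrightarrow> set_less (S i j) (S i (Suc j))"
      "\<forall>i<m. set_less (\<Union>j<p (Suc i). S (Suc i) j) (\<Union>j<p i. S i j)"
      "s = (\<Union>i\<le>m. \<Union>j<p i. S i j)"
      using schreier_list_cnf_listD[of L m a p s] Cons.prems(2) unfolding ap(1) by blast
    have "a m \<le> a 0" using sorted_cnf_list[of m a p] ap(3) by blast
    have cs: "cs = butlast cs @ [a 0]" using 3 ap by simp
    have "omega_pow (a 0) < cnf_val (c # cs)"
    proof -
      have "cnf_val (c # cs) = omega_pow (a 0) + cnf_val (c # butlast cs)"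
        by (subst cs) (simp add: cnf_val_append add_assoc_omega1)
      moreover have "0 < cnf_val (c # butlast cs)"
        by (metis cnf_val_eq_zero_iff list.distinct(1) zero_less_omega1)
      ultimately show ?thesis by (metis add_less_cancel_omega1 add_zero_omega1)
    qed
    moreover have "cnf_val (c # cs) < omega_pow (osuc (a 0))"
    proof (rule cnf_val_less_omega_pow)
      fix b assume "b \<in> set (c # cs)"
      moreover have "sorted (butlast cs @ [a 0])" using Cons.prems cs by simp
      ultimately show "b < osuc (a 0)"
        using ap \<open>a m \<le> a 0\<close> cs unfolding less_osuc_iff
        by (metis sorted_append Un_iff empty_iff insert_iff list.set set_ConsD set_append order_refl)
    qed
    ultimately show ?thesis
      unfolding S(4)
    proof (intro schreier.cantor[where a = a and p = p and m = m])
      show "is_limit (cnf_val (c # cs))" by (rule is_limit_cnf_val[OF 3(1)])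
      show "cnf_val (c # cs) = omega_sum m a p" unfolding ap(1) omega_sum_eq_cnf_val ..
      show "0 < a m" "0 < a 0" using 3(1) ap(4) \<open>a m \<le> a 0\<close> by auto
    qed (use ap(2,3) S(1-3) in blast)+
  qed
qed

lemma schreier_imp_schreier_list:
  "schreier L \<xi> s \<Longrightarrow> \<exists>cs. sorted cs \<and> cnf_val cs = \<xi> \<and> schreier_list L cs s"
proof (induction rule: schreier.induct)
  case zero
  show ?case by (intro exI[of _ "[]"]) simp
next
  case (one n)
  then show ?case by (intro exI[of _ "[0]"]) (simp add: schreier.one)
next
  case (succ n \<zeta> s)
  then obtain cs where "sorted cs" "cnf_val cs = \<zeta>" "schreier_list L cs s" by blast
  moreover have "schreier L 1 {n}" using succ by (intro schreier.one)
  ultimately have "schreier_list L (0 # cs) (insert n s)" "sorted (0 # cs)"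
    using succ.hyps(3) zero_le_omega1 insert_is_Un[of n s]
    unfolding schreier_list.simps omega_pow_zero sorted_simps by blast+
  moreover have "cnf_val (0 # cs) = osuc \<zeta>"
    using \<open>cnf_val cs = \<zeta>\<close> by (simp add: one_omega1_def)
  ultimately show ?case by blast
next
  case (pow_succ n s \<beta>)
  then have "schreier L (omega_pow (osuc \<beta>)) (\<Union>i\<in>{1..n}. s i)"
    by (intro schreier.pow_succ)
  then show ?case by (intro exI[of _ "[osuc \<beta>]"]) simp
next
  case (pow_limit \<eta> s)
  from pow_limit.hyps have "schreier L (omega_pow \<eta>) s" by (rule schreier.pow_limit)
  then show ?case by (intro exI[of _ "[\<eta>]"]) simp
next
  case (cantor \<xi> a m p s)
  have "schreier_list L (cnf_list m a p) (\<Union>i\<le>m. \<Union>j<p i. s i j)"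
    by (rule schreier_list_cnf_listI) (use cantor in auto)
  then show ?case
    using cantor sorted_cnf_list[of m a p] by (auto simp: omega_sum_eq_cnf_val)
qed

text \<open>Every derivation of membership yields some sorted list with the right value; uniqueness
  of normal forms identifies it with \<open>cs\<close>.\<close>

lemma schreier_cnf_val_iff:
  "sorted cs \<Longrightarrow> schreier L (cnf_val cs) s \<longleftrightarrow> schreier_list L cs s"
  using schreier_listD schreier_imp_schreier_list cnf_val_inj by metis

section \<open>Deleting the minimum of a Schreier set\<close>

lemma Min_insert_set_less: "finite s \<Longrightarrow> set_less {n} s \<Longrightarrow> Min (insert n s) = n"
  by (rule Min_eqI) (auto simp: set_less_def)

lemma schreier_pow_succ_insert_iff:
  assumes n: "1 \<le> n" "set_less {n} s"
  shows "schreier L (omega_pow (osuc \<beta>)) (insert n s) \<longleftrightarrow>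
         schreier_list L (replicate n \<beta>) (insert n s)"
proof
  assume *: "schreier L (omega_pow (osuc \<beta>)) (insert n s)"
  then show "schreier_list L (replicate n \<beta>) (insert n s)"
  proof cases
    case (pow_succ k S \<beta>')
    then have \<beta>: "\<beta>' = \<beta>" by (simp add: osuc_inject)
    have chain: "\<forall>j<k. schreier L (omega_pow \<beta>) (S (Suc j))"
      "\<forall>j. Suc j < k \<longrightarrow> set_less (S (Suc j)) (S (Suc (Suc j)))"
      using pow_succ \<beta> by auto
    have un: "insert n s = (\<Union>j<k. S (Suc j))"
      unfolding pow_succ(2) image_Suc_lessThan[symmetric] by simp
    \<comment> \<open>The number k of blocks is the minimum of the first block. The blocks are
      nonempty and increasing, so this is the minimum n of the whole set.\<close>
    have "n = k"
    proof -
      have fin: "finite (S 1)" "S 1 \<noteq> {}"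
        using chain(1) pow_succ(3) schreier_finite_pos_nonempty[of L "omega_pow \<beta>" "S (Suc 0)"]
        by auto
      have k: "k = Min (S 1)" by fact
      then have "k \<in> S 1" using Min_in[OF fin] by simp
      have le: "k \<le> x" if x: "x \<in> insert n s" for x
      proof -
        obtain j where j: "j < k" "x \<in> S (Suc j)" using x un by auto
        show ?thesis
        proof (cases j)
          case 0
          then have "x \<in> S 1" using j by simp
          then have "Min (S 1) \<le> x" using fin by (intro Min_le)
          then show ?thesis using k by metis
        next
          case (Suc i)
          have "S (Suc j) \<noteq> {}" if "j < k" for j
            using chain(1) that schreier_pow_nonempty by blast
          then have "set_less (S (Suc 0)) (S (Suc j))"
            using set_less_chain[of k "\<lambda>j. S (Suc j)" 0 j] chain(2) j Suc by blast
          then show ?thesis using j \<open>k \<in> S 1\<close> by (auto simp: set_less_def intro: less_imp_le)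
        qed
      qed
      have "S 1 \<subseteq> insert n s" unfolding un using pow_succ(3) by (auto intro!: bexI[of _ 0])
      then have "k \<in> insert n s" using \<open>k \<in> S 1\<close> by (rule subsetD)
      then have "n \<le> k" using n(2) by (auto simp: set_less_def)
      then show "n = k" using le[of n] by simp
    qed
    then show ?thesis
      unfolding schreier_list_replicate using chain un
      by (intro exI[of _ "\<lambda>j. S (Suc j)"] conjI) simp_all
  next
    case zero
    then show ?thesis by simp
  next
    case one
    then show ?thesis using omega_pow_eq_iff[of 0 "osuc \<beta>"] osuc_neq_zero[of \<beta>] by simp
  next
    case (succ n' \<zeta> s')
    then show ?thesis using is_limit_omega_pow[of "osuc \<beta>"] by simp
  next
    case (pow_limit \<eta>)
    then show ?thesis by auto
  next
    \<comment> \<open>This rule cannot apply: no power of omega lies strictly between two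
      consecutive ones.\<close>
    case (cantor a m p S)
    from cantor(4,5) have "a 0 < osuc \<beta>" "\<beta> < a 0"
      by simp_all
    then show ?thesis by (simp add: less_osuc_iff)
  qed
next
  assume *: "schreier_list L (replicate n \<beta>) (insert n s)"
  then obtain S where S: "\<forall>j<n. schreier L (omega_pow \<beta>) (S j)"
    "\<forall>j. Suc j < n \<longrightarrow> set_less (S j) (S (Suc j))" "insert n s = (\<Union>j<n. S j)"
    unfolding schreier_list_replicate by blast
  \<comment> \<open>Rule \<open>pow_succ\<close> numbers its blocks from 1.\<close>
  define T where "T i = S (i - 1)" for i
  have fin: "finite (S 0)" "S 0 \<noteq> {}"
    using S(1) n schreier_finite_pos_nonempty[of L "omega_pow \<beta>" "S 0"] by auto
  have "n \<in> S 0"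
  proof -
    obtain j where j: "j < n" "n \<in> S j" using S(3) by blast
    have "j = 0"
    proof (rule ccontr)
      assume "j \<noteq> 0"
      have "S i \<noteq> {}" if "i < n" for i
        using S(1) that schreier_pow_nonempty by blast
      then have "set_less (S 0) (S j)"
        using set_less_chain[of n S 0 j] S(2) j(1) \<open>j \<noteq> 0\<close> by blast
      moreover obtain x where x: "x \<in> S 0" using fin by blast
      ultimately have "x < n" using j by (auto simp: set_less_def)
      moreover have "x \<in> insert n s" using x S(3) n by force
      ultimately show False using n by (auto simp: set_less_def)
    qed
    then show ?thesis using j by simp
  qed
  moreover have "S 0 \<subseteq> insert n s" using S(3) n by force
  ultimately have "Min (S 0) = n"
    using n fin by (intro Min_eqI) (auto simp: set_less_def intro: less_imp_le)
  moreover have un: "insert n s = (\<Union>i\<in>{1..n}. T i)"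
    unfolding S(3) T_def image_Suc_lessThan[symmetric] by simp
  moreover have "set_less (T i) (T (Suc i))" if "i \<in> {1..<n}" for i
    using S(2)[rule_format, of "i - 1"] that by (simp add: T_def)
  moreover have "schreier L (omega_pow \<beta>) (T i)" if "i \<in> {1..n}" for i
    using S(1)[rule_format, of "i - 1"] that by (auto simp: T_def)
  moreover have "T 1 = S 0" by (simp add: T_def)
  ultimately show "schreier L (omega_pow (osuc \<beta>)) (insert n s)"
    unfolding un using fin(2) by (intro schreier.pow_succ[OF n(1)]) simp_all
qed

lemma schreier_pow_limit_insert_iff:
  assumes c: "is_limit c" and n: "set_less {n} s"
  shows "schreier L (omega_pow c) (insert n s) \<longleftrightarrow> schreier L (omega_pow (L c n)) (insert n s)"
proof
  assume *: "schreier L (omega_pow c) (insert n s)"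
  then have "finite s" by (auto dest: schreier_finite_pos_nonempty)
  with n have Min: "Min (insert n s) = n" by (intro Min_insert_set_less)
  from * show "schreier L (omega_pow (L c n)) (insert n s)"
  proof (cases rule: schreier.cases)
    case one
    then show ?thesis using omega_pow_eq_iff[of 0 c] c by auto
  next
    case (succ n' \<zeta> s')
    have "0 < c" using c by (auto simp: zero_less_omega1)
    then show ?thesis using succ is_limit_omega_pow[of c] by simp
  next
    case (pow_succ n s \<beta>)
    then show ?thesis using c by auto
  next
    case (pow_limit \<eta>)
    then show ?thesis using Min by simp
  next
    case (cantor a m p S)
    from cantor(4,5) have "a 0 < c" "c < osuc (a 0)"
      by simp_all
    then show ?thesis by (simp add: less_osuc_iff)
  qed simp
next
  assume *: "schreier L (omega_pow (L c n)) (insert n s)"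
  then have "finite s" by (auto dest: schreier_finite_pos_nonempty)
  with n have Min: "Min (insert n s) = n" by (intro Min_insert_set_less)
  show "schreier L (omega_pow c) (insert n s)"
    by (rule schreier.pow_limit) (use * Min c in auto)
qed

text \<open>The first block is nonempty, so it contains the minimum n, and deleting n changes this
  block alone.\<close>

lemma schreier_list_Cons_insert_iff:
  assumes "\<And>s. set_less {n} s \<Longrightarrow> schreier L (omega_pow c) (insert n s) \<longleftrightarrow> schreier_list L ds s"
    and n: "set_less {n} s"
  shows "schreier_list L (c # cs) (insert n s) \<longleftrightarrow> schreier_list L (ds @ cs) s"
proof
  assume "schreier_list L (c # cs) (insert n s)"
  then obtain s1 s2 where s: "insert n s = s1 \<union> s2" "set_less s1 s2" "schreier L (omega_pow c) s1"
    "schreier_list L cs s2" by auto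
  obtain x where x: "x \<in> s1" using s(3) schreier_pow_nonempty by blast
  have "n \<notin> s2"
  proof
    assume "n \<in> s2"
    then have "x < n" using s(2) x by (auto simp: set_less_def)
    moreover have "x \<in> insert n s" using s(1) x by blast
    ultimately show False using n by (auto simp: set_less_def)
  qed
  then have "n \<in> s1" "n \<notin> s" using s(1) n by (auto simp: set_less_def)
  define s1' where "s1' = s1 - {n}"
  have s1: "s1 = insert n s1'" and ss: "s = s1' \<union> s2"
    using \<open>n \<in> s1\<close> \<open>n \<notin> s\<close> s(1) \<open>n \<notin> s2\<close> unfolding s1'_def by auto
  have "set_less {n} s1'" using n ss by simp
  then have "schreier_list L ds s1'" using assms(1) s(3) unfolding s1 by blast
  moreover have "set_less s1' s2" using s(2) unfolding s1 by (auto simp: set_less_def)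
  ultimately show "schreier_list L (ds @ cs) s"
    unfolding schreier_list_append using ss s(4) by blast
next
  assume "schreier_list L (ds @ cs) s"
  then obtain s1 s2 where s: "s = s1 \<union> s2" "set_less s1 s2" "schreier_list L ds s1"
    "schreier_list L cs s2" by (auto simp: schreier_list_append)
  have "schreier L (omega_pow c) (insert n s1)" using assms s(1,3) by simp
  moreover have "set_less (insert n s1) s2" "insert n s = insert n s1 \<union> s2"
    using s n by (auto simp: set_less_def)
  ultimately show "schreier_list L (c # cs) (insert n s)"
    unfolding schreier_list.simps using s(4) by blast
qed

text \<open>Removing the minimum \<open>n\<close> from \<open>\<A>\<close> at \<open>\<omega>\<^sup>c\<close>: the list \<open>ds\<close> unwinds \<open>c\<close> down to exponent
  \<open>0\<close>, and the trailing blocks make the new index large when \<open>n\<close> is large.\<close>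

lemma schreier_pow_tail:
  assumes L: "fundamental_system L" and n: "1 \<le> n"
  shows "\<exists>ds. sorted ds \<and> (\<forall>b\<in>set ds. b < c) \<and>
    (\<forall>s. set_less {n} s \<longrightarrow> schreier L (omega_pow c) (insert n s) = schreier_list L ds s) \<and>
    (c = 0 \<longrightarrow> ds = []) \<and>
    (\<forall>b. c = osuc b \<longrightarrow> (\<exists>es. ds = es @ replicate (n - 1) b)) \<and>
    (is_limit c \<longrightarrow> (\<exists>es b. L c n = osuc b \<and> ds = es @ replicate (n - 1) b))"
proof (induction c rule: less_induct)
  case (less c)
  show ?case
  proof (cases c rule: omega1_cases)
    case zero
    have "schreier L (omega_pow c) (insert n s) = schreier_list L [] s" if "set_less {n} s" for s
      using that n zero by (auto simp: schreier_one_iff set_less_def)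
    then show ?thesis
      using zero osuc_neq_zero by (intro exI[of _ "[]"]) (auto simp: osuc_neq_zero[symmetric])
  next
    case (succ b)
    then have "b < c" by (simp add: less_osuc)
    then obtain es where es: "sorted es" "\<forall>d\<in>set es. d < b"
      "\<And>s. set_less {n} s \<Longrightarrow> schreier L (omega_pow b) (insert n s) = schreier_list L es s"
      using less by blast
    \<comment> \<open>Of the n copies of b the first is unwound recursively and n - 1
      remain.\<close>
    have "schreier L (omega_pow c) (insert n s) = schreier_list L (es @ replicate (n - 1) b) s"
      if s: "set_less {n} s" for s
    proof -
      have "replicate n b = b # replicate (n - 1) b" using n by (cases n) auto
      then show ?thesis
        using schreier_pow_succ_insert_iff[OF n s, of L b] succ schreier_list_Cons_insert_iff[OF es(3) s]
        by simp
    qed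
    moreover have "sorted (es @ replicate (n - 1) b)"
      using es by (auto simp: sorted_append intro: less_imp_le)
    moreover have "\<forall>d\<in>set (es @ replicate (n - 1) b). d < c"
      using es \<open>b < c\<close> by auto
    ultimately show ?thesis
      using succ osuc_neq_zero by (intro exI[of _ "es @ replicate (n - 1) b"]) (auto simp: osuc_inject)
  next
    case limit
    \<comment> \<open>Fundamental sequences have successor values, so the tail for
      \<open>L c n\<close> ends in copies of its predecessor b.\<close>
    then have "is_succ (L c n)" "L c n < c" using L n by (auto simp: fundamental_system_def)
    then obtain b where b: "L c n = osuc b" by (auto simp: is_succ_def)
    obtain ds es where ds: "sorted ds" "\<forall>d\<in>set ds. d < L c n"
      "\<And>s. set_less {n} s \<Longrightarrow> schreier L (omega_pow (L c n)) (insert n s) = schreier_list L ds s"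
      "ds = es @ replicate (n - 1) b"
      using less[OF \<open>L c n < c\<close>] b by blast
    then show ?thesis
      using limit b \<open>L c n < c\<close> schreier_pow_limit_insert_iff[OF limit, of n _ L]
      by (intro exI[of _ ds]) (auto intro: less_trans)
  qed
qed

subsection \<open>Uniform systems of fronts\<close>

text \<open>The only properties of the Schreier families that matter: deleting the minimum \<open>n\<close> from
  the sets of rank \<open>\<xi>\<close> leads to rank \<open>g \<xi> n < \<xi>\<close>, and these ranks tend to \<open>\<xi>\<close> at limits.\<close>

locale front_system =
  fixes A :: "omega1 \<Rightarrow> nat set \<Rightarrow> bool" and g :: "omega1 \<Rightarrow> nat \<Rightarrow> omega1"
  assumes A_zero: "A 0 s \<longleftrightarrow> s = {}"
    and A_empty: "\<xi> \<noteq> 0 \<Longrightarrow> \<not> A \<xi> {}"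
    and g_less: "\<xi> \<noteq> 0 \<Longrightarrow> 1 \<le> n \<Longrightarrow> g \<xi> n < \<xi>"
    and A_insert: "\<xi> \<noteq> 0 \<Longrightarrow> 1 \<le> n \<Longrightarrow> set_less {n} s \<Longrightarrow> A \<xi> (insert n s) \<longleftrightarrow> A (g \<xi> n) s"
    and g_osuc: "1 \<le> n \<Longrightarrow> g (osuc \<zeta>) n = \<zeta>"
    and g_limit: "is_limit \<xi> \<Longrightarrow> \<beta> < \<xi> \<Longrightarrow> \<exists>N. \<forall>n\<ge>N. \<beta> \<le> g \<xi> n"

lemma front_system_schreier:
  assumes L: "fundamental_system L"
  shows "\<exists>g. front_system (schreier L) g"
proof -
  define cnf where "cnf \<xi> = (SOME cs. sorted cs \<and> cnf_val cs = \<xi>)" for \<xi>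
  have cnf: "sorted (cnf \<xi>)" "cnf_val (cnf \<xi>) = \<xi>" for \<xi>
    using someI_ex[OF ex_cnf[of \<xi>]] by (auto simp: cnf_def)
  define D where "D c n = (SOME ds. sorted ds \<and> (\<forall>b\<in>set ds. b < c) \<and>
    (\<forall>s. set_less {n} s \<longrightarrow> schreier L (omega_pow c) (insert n s) = schreier_list L ds s) \<and>
    (c = 0 \<longrightarrow> ds = []) \<and>
    (\<forall>b. c = osuc b \<longrightarrow> (\<exists>es. ds = es @ replicate (n - 1) b)) \<and>
    (is_limit c \<longrightarrow> (\<exists>es b. L c n = osuc b \<and> ds = es @ replicate (n - 1) b)))" for c n
  have D: "sorted (D c n) \<and> (\<forall>b\<in>set (D c n). b < c) \<and>
    (\<forall>s. set_less {n} s \<longrightarrow> schreier L (omega_pow c) (insert n s) = schreier_list L (D c n) s) \<and>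
    (c = 0 \<longrightarrow> D c n = []) \<and>
    (\<forall>b. c = osuc b \<longrightarrow> (\<exists>es. D c n = es @ replicate (n - 1) b)) \<and>
    (is_limit c \<longrightarrow> (\<exists>es b. L c n = osuc b \<and> D c n = es @ replicate (n - 1) b))" if "1 \<le> n" for n c
    using someI_ex[OF schreier_pow_tail[OF L that, of c]] unfolding D_def .
  \<comment> \<open>Only the smallest exponent is unwound; the remaining list is kept.\<close>
  define g where "g \<xi> n = cnf_val (D (hd (cnf \<xi>)) n @ tl (cnf \<xi>))" for \<xi> n
  have split: "cnf \<xi> = hd (cnf \<xi>) # tl (cnf \<xi>)" if "\<xi> \<noteq> 0" for \<xi>
    using that cnf(2)[of \<xi>] by (cases "cnf \<xi>") auto
  show ?thesis
  proof (rule exI[of _ g], unfold_locales)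
    show "schreier L 0 s \<longleftrightarrow> s = {}" for s by (rule schreier_zero_iff)
    show "\<not> schreier L \<xi> {}" if "\<xi> \<noteq> 0" for \<xi>
      using that schreier_finite_pos_nonempty by blast
  next
    fix \<xi> :: omega1 and n :: nat assume *: "\<xi> \<noteq> 0" "1 \<le> n"
    have "cnf_val (D (hd (cnf \<xi>)) n @ tl (cnf \<xi>)) < cnf_val (hd (cnf \<xi>) # tl (cnf \<xi>))"
      by (rule cnf_val_less) (use D * in blast)
    then show "g \<xi> n < \<xi>" unfolding split[OF *(1), symmetric] cnf(2) g_def .
  next
    fix \<xi> :: omega1 and n :: nat and s assume *: "\<xi> \<noteq> 0" "1 \<le> n" "set_less {n} s"
    define c cs where "c = hd (cnf \<xi>)" and "cs = tl (cnf \<xi>)"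
    have ccs: "cnf \<xi> = c # cs" using split[OF *(1)] by (simp add: c_def cs_def)
    have so: "sorted (c # cs)" using cnf(1)[of \<xi>] ccs by simp
    have "sorted (D c n @ cs)"
      unfolding sorted_append using so conjunct1[OF D[OF *(2), of c]] conjunct1[OF conjunct2[OF D[OF *(2), of c]]]
      by (metis less_imp_le order.trans sorted_simps(2))
    then have "schreier L (g \<xi> n) s \<longleftrightarrow> schreier_list L (D c n @ cs) s"
      unfolding g_def c_def[symmetric] cs_def[symmetric] by (rule schreier_cnf_val_iff)
    also have "\<dots> \<longleftrightarrow> schreier_list L (c # cs) (insert n s)"
      using schreier_list_Cons_insert_iff[of n L c "D c n" s cs] D[OF *(2)] *(3) by blast
    also have "\<dots> \<longleftrightarrow> schreier L \<xi> (insert n s)"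
      using schreier_cnf_val_iff[OF so] cnf(2)[of \<xi>] ccs by metis
    finally show "schreier L \<xi> (insert n s) \<longleftrightarrow> schreier L (g \<xi> n) s" by blast
  next
    fix \<zeta> :: omega1 and n :: nat assume n: "1 \<le> n"
    define c cs where "c = hd (cnf (osuc \<zeta>))" and "cs = tl (cnf (osuc \<zeta>))"
    have ccs: "cnf (osuc \<zeta>) = c # cs" using split osuc_neq_zero by (simp add: c_def cs_def)
    have v: "cnf_val (c # cs) = osuc \<zeta>" using cnf(2)[of "osuc \<zeta>"] ccs by simp
    have "c = 0" using is_limit_cnf_val[of c cs] v zero_less_omega1 by auto
    then have "osuc (cnf_val cs) = osuc \<zeta>" using v by (simp add: one_omega1_def)
    then show "g (osuc \<zeta>) n = \<zeta>"
      using D[OF n, of c] \<open>c = 0\<close> by (simp add: g_def osuc_inject flip: c_def cs_def)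
  next
    fix \<xi> \<beta> :: omega1 assume *: "is_limit \<xi>" "\<beta> < \<xi>"
    then have "\<xi> \<noteq> 0" by auto
    define c cs where "c = hd (cnf \<xi>)" and "cs = tl (cnf \<xi>)"
    have ccs: "cnf \<xi> = c # cs" using split[OF \<open>\<xi> \<noteq> 0\<close>] by (simp add: c_def cs_def)
    have v: "\<xi> = cnf_val cs + omega_pow c" using cnf(2)[of \<xi>] ccs by simp
    have "c \<noteq> 0"
      using * v by (auto simp: one_omega1_def)
    \<comment> \<open>For a lower bound it suffices to count the trailing copies of b in the unwound
      exponent.\<close>
    have lower: "cnf_val cs + omega_pow b * ofin k \<le> g \<xi> n"
      if "D c n = es @ replicate k b" for es k b n
      using that by (simp add: g_def cnf_val_append cnf_val_replicate le_add_left_omega1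
          flip: c_def cs_def add_assoc_omega1)
    show "\<exists>N. \<forall>n\<ge>N. \<beta> \<le> g \<xi> n"
    proof (cases c rule: omega1_cases)
      case zero
      then show ?thesis using \<open>c \<noteq> 0\<close> by simp
    next
      case (succ b)
      then have "is_limit (omega_pow c)" by (simp add: is_limit_omega_pow)
      then obtain x where x: "x < omega_pow c" "\<beta> < cnf_val cs + x"
        using * v less_add_limit_iff by metis
      then obtain k where k: "x < omega_pow b * ofin k"
        using succ by (auto simp: less_omega_pow_osuc_iff)
      have "\<beta> \<le> g \<xi> n" if n: "n \<ge> Suc k" for n
      proof -
        obtain es where "D c n = es @ replicate (n - 1) b" using D[of n c] n succ by auto
        then have "cnf_val cs + omega_pow b * ofin (n - 1) \<le> g \<xi> n" by (rule lower)
        moreover have "x \<le> omega_pow b * ofin (n - 1)"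
          using k times_ofin_mono[of k "n - 1" "omega_pow b"] n
          by (cases n) (auto dest: order_less_le_trans less_imp_le)
        ultimately show ?thesis
          using x(2) by (metis add_le_cancel_omega1 less_imp_le order.trans)
      qed
      then show ?thesis by blast
    next
      case limit
      have "is_limit (omega_pow c)" using \<open>c \<noteq> 0\<close> by (simp add: is_limit_omega_pow zero_less_omega1)
      then obtain x where x: "x < omega_pow c" "\<beta> < cnf_val cs + x"
        using * v less_add_limit_iff by metis
      then obtain d where d: "d < c" "x < omega_pow d"
        using limit by (auto simp: less_omega_pow_limit_iff)
      have Lc: "strict_mono_on {1..} (L c)" "Sup (L c ` {1..}) = c"
        using L limit by (auto simp: fundamental_system_def)
      have "d < Sup (L c ` {1..})" using Lc(2) d by simp
      then obtain N where N: "1 \<le> N" "d < L c N"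
        by (subst (asm) less_Sup_omega1) auto
      \<comment> \<open>Here one copy of an exponent b with \<open>d \<le> b\<close> is enough, and
        \<open>n - 1 \<ge> 1\<close> guarantees it.\<close>
      have "\<beta> \<le> g \<xi> n" if n: "n \<ge> N + 1" for n
      proof -
        obtain es b where b: "L c n = osuc b" "D c n = es @ replicate (n - 1) b"
          using D[of n c] n limit by auto
        have "L c N < L c n" using Lc(1) N(1) n by (auto simp: strict_mono_on_def)
        then have "d \<le> b" using N(2) b(1) by (metis less_osuc_iff less_trans)
        have "cnf_val cs + omega_pow b * ofin (n - 1) \<le> g \<xi> n" using b(2) by (rule lower)
        moreover have "omega_pow b * ofin 1 \<le> omega_pow b * ofin (n - 1)"
          using n N(1) by (intro times_ofin_mono) simp
        moreover have "x \<le> omega_pow b * ofin 1"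
          using order_less_le_trans[OF d(2), of "omega_pow b"] \<open>d \<le> b\<close> by (simp add: less_imp_le)
        ultimately show ?thesis
          using x(2) by (metis add_le_cancel_omega1 less_imp_le order.trans)
      qed
      then show ?thesis by blast
    qed
  qed
qed

section \<open>Ultrafilters on words\<close>

text \<open>The closed subspace \<open>ultra\<close> of the power \<open>{0,1}\<close> to the power set of the words plays the
  role of the Stone-Cech compactification, and \<open>conv\<close> is the extension of concatenation
  to it, continuous in its left argument.\<close>

lemma compact_UNIV_set_fun: "compact (UNIV :: ('s \<Rightarrow> bool) set)"
proof -
  have "compact_space (product_topology (\<lambda>i::'s. euclidean :: bool topology) UNIV)"
    unfolding compact_space_product_topology
    by (simp add: compact_space_def compactin_euclidean_iff finite_imp_compact)
  then show ?thesis
    by (simp add: euclidean_product_topology compact_space_def compactin_euclidean_iff)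
qed

lemma compact_imp_closed_fun:
  assumes "compact (S :: ('s \<Rightarrow> bool) set)"
  shows "closed S"
proof -
  have "Hausdorff_space (euclidean :: bool topology)"
    unfolding Hausdorff_space_def using hausdorff[where 'a = bool] by (simp add: disjnt_def)
  then have "Hausdorff_space (product_topology (\<lambda>i::'s. euclidean :: bool topology) UNIV)"
    by (simp add: Hausdorff_space_product_topology)
  then have "closedin (euclidean :: ('s \<Rightarrow> bool) topology) S"
    using assms compactin_imp_closedin
    by (metis compactin_euclidean_iff euclidean_product_topology)
  then show ?thesis by simp
qed

lemma compact_iff_closed_fun: "compact (S :: ('s \<Rightarrow> bool) set) \<longleftrightarrow> closed S"
  using compact_imp_closed_fun compact_Int_closed[OF compact_UNIV_set_fun] by auto

lemma closed_eval: "closed {U :: 's \<Rightarrow> bool. U A}" "closed {U :: 's \<Rightarrow> bool. \<not> U A}"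
proof -
  have "continuous_on UNIV (\<lambda>U :: 's \<Rightarrow> bool. U A)" by simp
  then have "closed ((\<lambda>U :: 's \<Rightarrow> bool. U A) -` {b})" for b
    by (intro closed_vimage closed_singleton)
  from this[of True] this[of False]
  show "closed {U :: 's \<Rightarrow> bool. U A}" "closed {U :: 's \<Rightarrow> bool. \<not> U A}"
    by (simp_all add: vimage_def)
qed

text \<open>Zorn's lemma; compactness keeps the intersection of a chain nonempty. Q will be closure
  under \<open>conv\<close> or closure under multiplication from the left by C.\<close>

lemma minimal_closed_set:
  fixes K :: "('s \<Rightarrow> bool) set"
  assumes K: "closed K" "K \<noteq> {}" "Q K"
    and Q: "\<And>\<Z>. \<Z> \<noteq> {} \<Longrightarrow> (\<And>Z. Z \<in> \<Z> \<Longrightarrow> Q Z) \<Longrightarrow> Q (\<Inter>\<Z>)"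
  obtains M where "M \<subseteq> K" "closed M" "M \<noteq> {}" "Q M"
    "\<And>Z. Z \<subseteq> M \<Longrightarrow> closed Z \<Longrightarrow> Z \<noteq> {} \<Longrightarrow> Q Z \<Longrightarrow> Z = M"
proof -
  define F where "F = {Z. Z \<subseteq> K \<and> closed Z \<and> Z \<noteq> {} \<and> Q Z}"
  have "\<exists>m\<in>F. \<forall>a\<in>F. m \<supseteq> a \<longrightarrow> a = m"
  proof (rule predicate_Zorn)
    show "partial_order_on F (relation_of (\<supseteq>) F)"
      by (rule partial_order_on_relation_ofI) auto
    fix C assume "C \<in> Chains (relation_of (\<supseteq>) F)"
    then have C: "C \<subseteq> F" "\<And>X Y. X \<in> C \<Longrightarrow> Y \<in> C \<Longrightarrow> X \<subseteq> Y \<or> Y \<subseteq> X"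
      by (auto simp: Chains_def relation_of_def)
    show "\<exists>u\<in>F. \<forall>a\<in>C. u \<subseteq> a"
    proof (cases "C = {}")
      case True
      then show ?thesis using K by (auto simp: F_def)
    next
      case False
      have fin: "finite B \<Longrightarrow> B \<noteq> {} \<Longrightarrow> B \<subseteq> C \<Longrightarrow> \<Inter>B \<in> B" for B
      proof (induction rule: finite_ne_induct)
        case (insert x B)
        then have "\<Inter>B \<subseteq> x \<or> x \<subseteq> \<Inter>B" using C(2) by blast
        then show ?case using insert by (metis Inter_insert insertCI insert_subset inf.absorb1 inf.absorb2)
      qed simp
      have "UNIV \<inter> \<Inter>C \<noteq> {}"
      proof (rule compact_imp_fip[OF compact_UNIV_set_fun])
        show "closed T" if "T \<in> C" for T using that C(1) by (auto simp: F_def)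
        show "UNIV \<inter> \<Inter>B \<noteq> {}" if "finite B" "B \<subseteq> C" for B
          using fin[OF that(1) _ that(2)] that(2) C(1) by (cases "B = {}") (auto simp: F_def)
      qed
      moreover have "Q (\<Inter>C)" by (rule Q[OF False]) (use C(1) in \<open>auto simp: F_def\<close>)
      moreover have "closed (\<Inter>C)" "\<Inter>C \<subseteq> K" using C(1) False by (auto simp: F_def)
      ultimately have "\<Inter>C \<in> F" by (simp add: F_def)
      then show ?thesis by blast
    qed
  qed
  then obtain M where "M \<in> F" "\<And>Z. Z \<in> F \<Longrightarrow> Z \<subseteq> M \<Longrightarrow> Z = M" by blast
  then show thesis by (intro that[of M]) (auto simp: F_def)
qed

definition conv :: "('b list set \<Rightarrow> bool) \<Rightarrow> ('b list set \<Rightarrow> bool) \<Rightarrow> 'b list set \<Rightarrow> bool" where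
  "conv U V = (\<lambda>A. U {x. V {y. x @ y \<in> A}})"

lemma conv_assoc: "conv (conv U V) W = conv U (conv V W)"
  by (simp add: conv_def)

lemma continuous_conv_left: "continuous_on S (\<lambda>U. conv U V)"
  unfolding conv_def
  by (intro continuous_on_coordinatewise_then_product
      continuous_on_subset[OF continuous_on_product_coordinates]) simp

lemma closed_conv_image: "closed S \<Longrightarrow> closed ((\<lambda>U. conv U V) ` S)"
  using compact_continuous_image[OF continuous_conv_left] by (metis compact_iff_closed_fun)

lemma closed_conv_fiber: "closed {U. conv U V = V}"
proof -
  have "closed {U. conv U V A = V A}" for A
    using closed_eval[of "{x. V {y. x @ y \<in> A}}"] by (cases "V A") (simp_all add: conv_def)
  moreover have "{U. conv U V = V} = (\<Inter>A. {U. conv U V A = V A})" by (auto simp: fun_eq_iff)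
  ultimately show ?thesis by (auto intro: closed_INT)
qed

text \<open>The Ellis argument: for x in a minimal closed subsemigroup M, the set M x is again a
  closed subsemigroup, hence all of M. So the z in M with \<open>conv z x = x\<close> form a
  nonempty closed subsemigroup, which is M and therefore contains x.\<close>

lemma ex_idempotent:
  assumes "closed S" "S \<noteq> {}" "\<And>U V. U \<in> S \<Longrightarrow> V \<in> S \<Longrightarrow> conv U V \<in> S"
  obtains e where "e \<in> S" "conv e e = e"
proof -
  obtain M where M: "M \<subseteq> S" "closed M" "M \<noteq> {}" "\<forall>U\<in>M. \<forall>V\<in>M. conv U V \<in> M"
    "\<And>Z. Z \<subseteq> M \<Longrightarrow> closed Z \<Longrightarrow> Z \<noteq> {} \<Longrightarrow> \<forall>U\<in>Z. \<forall>V\<in>Z. conv U V \<in> Z \<Longrightarrow> Z = M"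
  proof (rule minimal_closed_set[of S "\<lambda>Z. \<forall>U\<in>Z. \<forall>V\<in>Z. conv U V \<in> Z"])
    show "\<forall>U\<in>S. \<forall>V\<in>S. conv U V \<in> S" using assms(3) by simp
  qed (use assms(1,2) in auto)
  then obtain x where x: "x \<in> M" by blast
  have "(\<lambda>z. conv z x) ` M = M"
  proof (rule M(5))
    show "\<forall>U\<in>(\<lambda>z. conv z x) ` M. \<forall>V\<in>(\<lambda>z. conv z x) ` M. conv U V \<in> (\<lambda>z. conv z x) ` M"
    proof (intro ballI)
      fix U V assume "U \<in> (\<lambda>z. conv z x) ` M" "V \<in> (\<lambda>z. conv z x) ` M"
      then obtain u v where uv: "U = conv u x" "V = conv v x" "u \<in> M" "v \<in> M" by blast
      then have "conv U V = conv (conv u (conv x v)) x" "conv u (conv x v) \<in> M"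
        using M(4) x by (simp_all add: conv_assoc)
      then show "conv U V \<in> (\<lambda>z. conv z x) ` M" by blast
    qed
  qed (use M x in \<open>auto intro: closed_conv_image\<close>)
  then obtain y where y: "y \<in> M" "conv y x = x" using x by (metis imageE)
  have "M \<inter> {z. conv z x = x} = M"
  proof (rule M(5))
    show "closed (M \<inter> {z. conv z x = x})" using M(2) closed_conv_fiber by (rule closed_Int)
    show "\<forall>U\<in>M \<inter> {z. conv z x = x}. \<forall>V\<in>M \<inter> {z. conv z x = x}. conv U V \<in> M \<inter> {z. conv z x = x}"
      using M(4) by (simp add: conv_assoc)
  qed (use y in auto)
  then have "conv x x = x" using x by blast
  then show thesis using that x M(1) by blast
qed

definition ultra :: "('s set \<Rightarrow> bool) set" where
  "ultra = {U. \<not> U {} \<and> (\<forall>A B. U (A \<inter> B) \<longleftrightarrow> U A \<and> U B) \<and> (\<forall>A. U (- A) \<longleftrightarrow> \<not> U A)}"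

text \<open>Every defining condition involves only finitely many coordinates.\<close>

lemma closed_ultra: "closed (ultra :: ('s set \<Rightarrow> bool) set)"
proof -
  have eq: "ultra = {U. \<not> U ({} :: 's set)} \<inter>
    (\<Inter>A. \<Inter>B. ({U. \<not> U (A \<inter> B)} \<union> {U. U A}) \<inter> ({U. \<not> U (A \<inter> B)} \<union> {U. U B}) \<inter>
      ({U. U (A \<inter> B)} \<union> {U. \<not> U A} \<union> {U. \<not> U B})) \<inter>
    (\<Inter>A. ({U. U (- A)} \<union> {U. U A}) \<inter> ({U. \<not> U (- A)} \<union> {U. \<not> U A}))"
    unfolding ultra_def by blast
  show ?thesis
    unfolding eq by (intro closed_Int closed_INT ballI closed_Un closed_eval)
qed

lemma ultra_Int: "U \<in> ultra \<Longrightarrow> U (A \<inter> B) \<longleftrightarrow> U A \<and> U B"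
  by (simp add: ultra_def)

lemma ultra_compl: "U \<in> ultra \<Longrightarrow> U (- A) \<longleftrightarrow> \<not> U A"
  by (simp add: ultra_def)

lemma ultra_UNIV: "U \<in> ultra \<Longrightarrow> U UNIV"
  using ultra_compl[of U "{}"] by (simp add: ultra_def)

lemma ultra_mono: "U \<in> ultra \<Longrightarrow> U A \<Longrightarrow> A \<subseteq> B \<Longrightarrow> U B"
  by (metis ultra_Int inf.absorb1)

lemma ultra_nonempty: "U \<in> ultra \<Longrightarrow> U A \<Longrightarrow> A \<noteq> {}"
  by (auto simp: ultra_def)

lemma ultra_INT:
  assumes "U \<in> ultra" "finite I" "\<And>i. i \<in> I \<Longrightarrow> U (X i)"
  shows "U (\<Inter>i\<in>I. X i)"
  using assms(2,3) by (induction rule: finite_induct) (auto simp: ultra_UNIV ultra_Int assms(1))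

lemma conv_ultra:
  assumes "U \<in> ultra" "V \<in> ultra"
  shows "conv U V \<in> ultra"
proof -
  have "{x. V {y. x @ y \<in> A \<inter> B}} = {x. V {y. x @ y \<in> A}} \<inter> {x. V {y. x @ y \<in> B}}" for A B
  proof -
    have "{y. x @ y \<in> A \<inter> B} = {y. x @ y \<in> A} \<inter> {y. x @ y \<in> B}" for x by blast
    then show ?thesis using ultra_Int[OF assms(2)] by auto
  qed
  moreover have "{x. V {y. x @ y \<in> - A}} = - {x. V {y. x @ y \<in> A}}" for A
  proof -
    have "{y. x @ y \<in> - A} = - {y. x @ y \<in> A}" for x by blast
    then show ?thesis using ultra_compl[OF assms(2)] by auto
  qed
  ultimately show ?thesis
    using assms by (simp add: ultra_def conv_def)
qed

lemma principal_ultra: "(\<lambda>A. x \<in> A) \<in> ultra"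
  by (simp add: ultra_def)

definition umap :: "('s \<Rightarrow> 't) \<Rightarrow> ('s set \<Rightarrow> bool) \<Rightarrow> 't set \<Rightarrow> bool" where
  "umap f U = (\<lambda>A. U (f -` A))"

lemma umap_ultra: "U \<in> ultra \<Longrightarrow> umap f U \<in> ultra"
  by (simp add: ultra_def umap_def vimage_Compl)

lemma umap_conv:
  assumes "\<And>x y. f (x @ y) = f x @ f y"
  shows "umap f (conv U V) = conv (umap f U) (umap f V)"
  by (simp add: umap_def conv_def assms vimage_def)

lemma umap_id_on:
  assumes "U \<in> ultra" "U C" "\<And>x. x \<in> C \<Longrightarrow> f x = x"
  shows "umap f U = U"
proof
  fix A
  have "C \<inter> f -` A = C \<inter> A" using assms(3) by auto
  then show "umap f U A = U A"
    using ultra_Int[OF assms(1)] assms(2) unfolding umap_def by metis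
qed

section \<open>Carlson's theorem\<close>

lemma subst_append [simp]: "subst (x @ y) \<alpha> = subst x \<alpha> @ subst y \<alpha>"
  by (simp add: subst_def)

lemma subst_Nil [simp]: "subst [] \<alpha> = []"
  by (simp add: subst_def)

lemma subst_eq_Nil_iff [simp]: "subst x \<alpha> = [] \<longleftrightarrow> x = []"
  by (simp add: subst_def)

lemma length_subst [simp]: "length (subst x \<alpha>) = length x"
  by (simp add: subst_def)

lemma subst_None [simp]: "subst x None = x"
  by (induction x) (simp_all add: subst_def)

lemma subst_const: "x \<notin> varwords \<Longrightarrow> subst x \<alpha> = x"
  unfolding subst_def varwords_def by (rule map_idI) auto

lemma subst_Some_const: "subst x (Some a) \<notin> varwords"
  by (auto simp: subst_def varwords_def)

lemma append_varwords_iff [simp]: "x @ y \<in> varwords \<longleftrightarrow> x \<in> varwords \<or> y \<in> varwords"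
  by (simp add: varwords_def)

text \<open>The minimal idempotent \<open>e\<close> of the constant words lies above an idempotent \<open>p\<close> of the
  variable words; by minimality every substitution maps \<open>p\<close> to \<open>e\<close>.\<close>

lemma ex_variable_idempotent:
  obtains e p :: "'a word set \<Rightarrow> bool"
  where "e \<in> ultra" "p \<in> ultra" "e (- varwords)" "p varwords"
    "conv e e = e" "conv p p = p" "conv e p = p" "conv p e = p"
    "\<And>a. umap (\<lambda>x. subst x (Some a)) p = e"
proof -
  define C V where "C = {U \<in> ultra. U (- varwords :: 'a word set)}"
    and "V = {U \<in> ultra. U (varwords :: 'a word set)}"
  have clC: "closed C" and clV: "closed V"
    unfolding C_def V_def Collect_conj_eq using closed_ultra closed_eval by (auto intro!: closed_Int)
  have "(\<lambda>A. [] \<in> A) \<in> C" by (simp add: C_def principal_ultra varwords_def)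
  then have neC: "C \<noteq> {}" by blast
  have "(\<lambda>A. [None] \<in> A) \<in> V" by (simp add: V_def principal_ultra varwords_def)
  then have neV: "V \<noteq> {}" by blast
  have CC: "conv U W \<in> C" if "U \<in> C" "W \<in> C" for U W
  proof -
    have "{y. x @ y \<in> - varwords} = - varwords" if "x \<in> - varwords" for x :: "'a word"
      using that by auto
    then have "- varwords \<subseteq> {x. W {y. x @ y \<in> - varwords}}" using \<open>W \<in> C\<close> by (auto simp: C_def)
    moreover have "U (- varwords)" "U \<in> ultra" "W \<in> ultra" using that by (simp_all add: C_def)
    ultimately show ?thesis
      unfolding C_def conv_def[of U W] mem_Collect_eq
      using ultra_mono[of U] conv_ultra[of U W, unfolded conv_def] by blast
  qed
  have VU: "conv U W \<in> V" if "U \<in> V" "W \<in> ultra" for U W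
  proof -
    have "varwords \<subseteq> {x. W {y. x @ y \<in> (varwords :: 'a word set)}}" using ultra_UNIV[OF that(2)] by auto
    moreover have "U varwords" "U \<in> ultra" using that by (simp_all add: V_def)
    ultimately show ?thesis
      unfolding V_def conv_def[of U W] mem_Collect_eq
      using ultra_mono[of U] conv_ultra[of U W, unfolded conv_def] that(2) by blast
  qed
  have UV: "conv U W \<in> V" if "U \<in> ultra" "W \<in> V" for U W
  proof -
    have "W {y. x @ y \<in> varwords}" for x
      by (rule ultra_mono[of W varwords]) (use that in \<open>auto simp: V_def\<close>)
    then have "conv U W varwords"
      using ultra_UNIV[OF that(1)] by (simp add: conv_def del: append_varwords_iff)
    then show ?thesis using that by (simp add: V_def conv_ultra)
  qed
  \<comment> \<open>A minimal closed left ideal of C, which makes its idempotent e minimal.\<close>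
  obtain L where L: "L \<subseteq> C" "closed L" "L \<noteq> {}" "\<forall>c\<in>C. \<forall>z\<in>L. conv c z \<in> L"
    "\<And>Z. Z \<subseteq> L \<Longrightarrow> closed Z \<Longrightarrow> Z \<noteq> {} \<Longrightarrow> \<forall>c\<in>C. \<forall>z\<in>Z. conv c z \<in> Z \<Longrightarrow> Z = L"
  proof (rule minimal_closed_set[of C "\<lambda>Z. \<forall>c\<in>C. \<forall>z\<in>Z. conv c z \<in> Z"])
    show "\<forall>c\<in>C. \<forall>z\<in>C. conv c z \<in> C" using CC by simp
  qed (use clC neC in auto)
  obtain e where e: "e \<in> L" "conv e e = e"
    using ex_idempotent[OF L(2,3)] L(1,4) by blast
  then have eC: "e \<in> C" "e \<in> ultra" using L(1) by (auto simp: C_def)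
  \<comment> \<open>V e is a closed subsemigroup because V absorbs products from both sides. Its
    idempotent satisfies q e = q, and p = e q is then fixed by e on both sides.\<close>
  obtain q where q: "q \<in> (\<lambda>v. conv v e) ` V" "conv q q = q"
  proof (rule ex_idempotent[of "(\<lambda>v. conv v e) ` V"])
    show "conv U W \<in> (\<lambda>v. conv v e) ` V"
      if UW: "U \<in> (\<lambda>v. conv v e) ` V" "W \<in> (\<lambda>v. conv v e) ` V" for U W
    proof -
      obtain u v where uv: "U = conv u e" "W = conv v e" "u \<in> V" "v \<in> V" using UW by blast
      have "conv u (conv e v) \<in> V"
        using uv eC by (intro UV) (auto simp: V_def intro: VU)
      then show ?thesis by (auto simp: uv conv_assoc image_iff intro!: bexI[of _ "conv u (conv e v)"])
    qed
  qed (use clV neV in \<open>auto intro: closed_conv_image\<close>)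
  then obtain v where v: "v \<in> V" "q = conv v e" by blast
  have qe: "conv q e = q" by (simp add: v conv_assoc e)
  have "q \<in> V" using v VU eC by blast
  define p where "p = conv e q"
  have pV: "p \<in> V" unfolding p_def using UV eC \<open>q \<in> V\<close> by blast
  have ep: "conv e p = p" by (simp add: p_def e flip: conv_assoc)
  have pe: "conv p e = p" by (simp add: p_def conv_assoc qe)
  have pp: "conv p p = p" by (metis p_def conv_assoc qe q(2))
  have "umap (\<lambda>x. subst x (Some a)) p = e" for a
  proof -
    define f where "f = umap (\<lambda>x. subst x (Some a)) p"
    have um: "umap (\<lambda>x. subst x (Some a)) e = e"
      by (rule umap_id_on[where C = "- varwords"]) (use eC in \<open>auto simp: C_def subst_const\<close>)
    have f: "conv f f = f" "conv e f = f" "conv f e = f"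
      using umap_conv[of "\<lambda>x. subst x (Some a)"] pp ep pe um unfolding f_def by (metis subst_append)+
    have "f \<in> C"
    proof -
      have "p \<in> ultra" using pV by (simp add: V_def)
      moreover from this have "f (- varwords)"
        using ultra_UNIV[of p] by (simp add: f_def umap_def vimage_def subst_Some_const)
      ultimately show ?thesis by (simp add: C_def f_def umap_ultra)
    qed
    then have "f \<in> L" using f(3) e L(4) by metis
    \<comment> \<open>C f is a closed left ideal inside L, so by minimality it contains e. From
      \<open>e = conv c f\<close> and the idempotency of f follows \<open>conv e f = e\<close>,
      while \<open>conv e f = f\<close> is known.\<close>
    have "(\<lambda>c. conv c f) ` C = L"
    proof (rule L(5))
      show "\<forall>c\<in>C. \<forall>z\<in>(\<lambda>c. conv c f) ` C. conv c z \<in> (\<lambda>c. conv c f) ` C"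
        using CC by (auto simp flip: conv_assoc)
    qed (use L(4) \<open>f \<in> L\<close> neC clC in \<open>auto intro: closed_conv_image\<close>)
    then obtain c where c: "e = conv c f" using e by blast
    then have "conv e f = e" by (simp add: conv_assoc f(1))
    then show ?thesis using f(2) f_def by simp
  qed
  then show thesis
    using that[of e p] eC pV e ep pe pp by (auto simp: C_def V_def)
qed

text \<open>\<open>G\<close> collects the prefixes from which a homogeneous sequence can always be continued.\<close>

lemma ex_extendible_set:
  fixes A :: "'a::finite word set"
  shows "\<exists>G. (G \<inter> varwords \<subseteq> A \<or> G \<inter> varwords \<subseteq> - A) \<and>
    (\<forall>R. finite R \<longrightarrow> R \<subseteq> insert [] G \<longrightarrow> (\<exists>u\<in>varwords. \<forall>x\<in>R. \<forall>\<alpha>. x @ subst u \<alpha> \<in> G))"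
proof -
  obtain e p :: "'a word set \<Rightarrow> bool" where ep: "e \<in> ultra" "p \<in> ultra" "e (- varwords)" "p varwords"
    "conv e e = e" "conv p p = p" "conv e p = p" "conv p e = p"
    "\<And>a. umap (\<lambda>x. subst x (Some a)) p = e"
    by (rule ex_variable_idempotent) blast
  obtain B where B: "B = A \<or> B = - A" "p B" using ultra_compl[OF ep(2)] by metis
  define q :: "'a word \<Rightarrow> 'a word set \<Rightarrow> 'a word set" where "q x X = {y. x @ y \<in> X}" for x X
  have pp: "p {y. p (q y X)}" and pe: "p {y. e (q y X)}" and epp: "e {y. p (q y X)}" if "p X" for X
    using that ep(6-8) by (simp_all add: q_def conv_def fun_eq_iff)
  have ee: "e {y. e (q y X)}" if "e X" for X
    using that ep(5) by (simp add: q_def conv_def fun_eq_iff)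
  \<comment> \<open>After a variable word a constant continuation is still coloured, so e-many
    continuations must stay in B; after a constant word it is not, and only p-many are asked
    for.\<close>
  define G where "G = {x. p (q x B) \<and> (x \<in> varwords \<longrightarrow> x \<in> B \<and> e (q x B))}"
  have "p (q [] G)"
    by (rule ultra_mono[OF ep(2), of "{y. p (q y B)} \<inter> (B \<inter> {y. e (q y B)})"])
      (use pp pe B(2) ep(2) in \<open>auto simp: ultra_Int G_def q_def\<close>)
  moreover have "e (q [] G)"
    by (rule ultra_mono[OF ep(1), of "{y. p (q y B)} \<inter> - varwords"])
      (use epp B(2) ep(1,3) in \<open>auto simp: ultra_Int G_def q_def\<close>)
  moreover have "p (q x G) \<and> e (q x G)" if x: "x \<in> G" for x
  proof
    have xB: "p (q x B)" using x by (simp add: G_def)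
    have qq: "q y (q x B) = q (x @ y) B" for y by (simp add: q_def)
    have mem: "y \<in> q x X \<longleftrightarrow> x @ y \<in> X" for y X by (simp add: q_def)
    have sub: "{y. p (q y (q x B))} \<inter> (q x B \<inter> {y. e (q y (q x B))}) \<subseteq> q x G"
      by (auto simp: G_def mem qq)
    have "p ({y. p (q y (q x B))} \<inter> (q x B \<inter> {y. e (q y (q x B))}))"
      using pp pe xB ep(2) by (simp add: ultra_Int)
    then show "p (q x G)" using sub by (rule ultra_mono[OF ep(2)])
    show "e (q x G)"
    proof (cases "x \<in> varwords")
      case True
      then have "e (q x B)" using x by (simp add: G_def)
      then have "e ({y. p (q y (q x B))} \<inter> (q x B \<inter> {y. e (q y (q x B))}))"
        using epp ee xB ep(1) by (simp add: ultra_Int)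
      then show ?thesis using sub by (rule ultra_mono[OF ep(1)])
    next
      case False
      have "e ({y. p (q y (q x B))} \<inter> - varwords)"
        using epp xB ep(1,3) by (simp add: ultra_Int)
      moreover have "{y. p (q y (q x B))} \<inter> - varwords \<subseteq> q x G"
        using False by (auto simp: G_def mem qq)
      ultimately show ?thesis by (rule ultra_mono[OF ep(1)])
    qed
  qed
  ultimately have G: "p (q x G) \<and> e (q x G)" if "x \<in> insert [] G" for x
    using that by blast
  show ?thesis
  proof (intro exI[of _ G] conjI allI impI)
    show "G \<inter> varwords \<subseteq> A \<or> G \<inter> varwords \<subseteq> - A" using B(1) by (auto simp: G_def)
    fix R assume R: "finite R" "R \<subseteq> insert [] G"
    \<comment> \<open>If u is distributed according to p, then each \<open>subst u (Some a)\<close>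
      is distributed according to e.\<close>
    have *: "p {u. x @ subst u \<alpha> \<in> G}" if "x \<in> R" for x \<alpha>
    proof (cases \<alpha>)
      case None
      then show ?thesis using G that R by (auto simp: q_def)
    next
      case (Some a)
      have "e (q x G)" using G that R by auto
      then have "umap (\<lambda>x. subst x (Some a)) p (q x G)" unfolding ep(9) .
      then show ?thesis unfolding Some by (simp add: umap_def q_def vimage_def)
    qed
    have "p (\<Inter>x\<in>R. \<Inter>\<alpha>\<in>UNIV. {u. x @ subst u \<alpha> \<in> G})"
      by (rule ultra_INT[OF ep(2) R(1)], rule ultra_INT[OF ep(2) finite], rule *)
    then have "p (varwords \<inter> (\<Inter>x\<in>R. \<Inter>\<alpha>. {u. x @ subst u \<alpha> \<in> G}))"
      using ep(2,4) by (simp add: ultra_Int)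
    then have "varwords \<inter> (\<Inter>x\<in>R. \<Inter>\<alpha>. {u. x @ subst u \<alpha> \<in> G}) \<noteq> {}"
      by (rule ultra_nonempty[OF ep(2)])
    then show "\<exists>u\<in>varwords. \<forall>x\<in>R. \<forall>\<alpha>. x @ subst u \<alpha> \<in> G" by blast
  qed
qed

section \<open>Reductions\<close>

no_notation lesspoll (infixl \<open>\<prec>\<close> 50)

text \<open>Shifting the sequence absorbs the start position of \<open>reduced_term\<close>, so
  recursions on index words can always start at 0.\<close>

definition seq_drop :: "nat \<Rightarrow> (nat \<Rightarrow> 'b) \<Rightarrow> nat \<Rightarrow> 'b" where
  "seq_drop k w n = w (k + n)"

lemma seq_drop_0 [simp]: "seq_drop 0 w = w"
  by (simp add: seq_drop_def fun_eq_iff)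

lemma seq_drop_seq_drop [simp]: "seq_drop j (seq_drop k w) = seq_drop (k + j) w"
  by (simp add: seq_drop_def fun_eq_iff add_ac)

lemma range_seq_drop: "range w \<subseteq> S \<Longrightarrow> range (seq_drop k w) \<subseteq> S"
  by (auto simp: seq_drop_def)

abbreviation red :: "(nat \<Rightarrow> 'a word) \<Rightarrow> 'a word \<Rightarrow> 'a word" where
  "red w t \<equiv> reduced_term w 0 t"

lemma reduced_term_seq_drop: "reduced_term w k t = red (seq_drop k w) t"
  by (simp add: reduced_term_def seq_drop_def)

lemma red_Nil [simp]: "red w [] = []"
  by (simp add: reduced_term_def)

lemma red_Cons: "red w (a # t) = subst (w 0) a @ red (seq_drop 1 w) t"
  by (simp add: reduced_term_def seq_drop_def map_upt_Suc del: upt_Suc)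

lemma red_append: "red w (s @ t) = red w s @ red (seq_drop (length s) w) t"
  by (induction s arbitrary: w) (simp_all add: red_Cons)

lemma red_None [simp]: "red w [None] = w 0"
  by (simp add: red_Cons)

lemma subst_varwords_iff: "x \<in> varwords \<Longrightarrow> subst x \<alpha> \<in> varwords \<longleftrightarrow> \<alpha> = None"
  by (cases \<alpha>) (simp_all add: subst_Some_const)

lemma red_varwords_iff: "range w \<subseteq> varwords \<Longrightarrow> red w t \<in> varwords \<longleftrightarrow> t \<in> varwords"
proof (induction t arbitrary: w)
  case (Cons a t)
  have "w 0 \<in> varwords" using Cons.prems by blast
  then show ?case
    using Cons.IH[OF range_seq_drop[OF Cons.prems, of 1]]
    by (auto simp: red_Cons subst_varwords_iff) (auto simp: varwords_def)
qed (simp add: varwords_def)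

lemma subst_red: "subst (red w t) \<alpha> = red w (subst t \<alpha>)"
proof (induction t arbitrary: w)
  case (Cons a t)
  have "subst (subst x a) \<alpha> = subst x (if a = None then \<alpha> else a)" for x :: "'a word"
    by (auto simp: subst_def)
  moreover have "subst (a # t) \<alpha> = (if a = None then \<alpha> else a) # subst t \<alpha>"
    by (simp add: subst_def)
  ultimately show ?case using Cons by (simp add: red_Cons)
qed simp

lemma varwords_nonempty: "x \<in> varwords \<Longrightarrow> x \<noteq> []"
  by (auto simp: varwords_def)

lemma length_red: "length (red w t) = (\<Sum>j<length t. length (w j))"
  by (induction t arbitrary: w) (simp_all add: red_Cons sum.lessThan_Suc_shift seq_drop_def del: sum.lessThan_Suc)

lemma subst_inj_varword:
  assumes "x \<in> varwords" "subst x a = subst x b"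
  shows "a = b"
proof -
  obtain i where "i < length x" "x ! i = None" using assms(1) by (auto simp: varwords_def in_set_conv_nth)
  then have "subst x a ! i = a" "subst x b ! i = b" by (simp_all add: subst_def)
  then show ?thesis using assms(2) by metis
qed

text \<open>Decoding letter by letter: a substituted copy of \<open>w 0\<close> has the length of
  \<open>w 0\<close>, and since \<open>w 0\<close> contains the variable, the copy reveals the
  letter.\<close>

lemma red_eq_appendD:
  assumes "range w \<subseteq> varwords" "red w s = red w t @ y"
  shows "\<exists>s'. s = t @ s' \<and> y = red (seq_drop (length t) w) s'"
  using assms
proof (induction t arbitrary: w s)
  case (Cons a t)
  have w0: "w 0 \<in> varwords" using Cons.prems(1) by blast
  obtain b s' where s: "s = b # s'"
    using Cons.prems(2) varwords_nonempty[OF w0] by (cases s) (auto simp: red_Cons)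
  have "subst (w 0) b = subst (w 0) a" "red (seq_drop 1 w) s' = red (seq_drop 1 w) t @ y"
    using Cons.prems(2) by (auto simp: s red_Cons)
  then show ?case
    using Cons.IH[OF range_seq_drop[OF Cons.prems(1)], of 1 s'] subst_inj_varword[OF w0]
    by (auto simp: s)
qed simp

lemma red_inj: "range w \<subseteq> varwords \<Longrightarrow> red w s = red w t \<Longrightarrow> s = t"
proof (rule ccontr)
  assume w: "range w \<subseteq> varwords" and eq: "red w s = red w t" and "s \<noteq> t"
  then obtain s' where "s = t @ s'" using red_eq_appendD[of w s t "[]"] by auto
  moreover obtain t' where "t = s @ t'" using red_eq_appendD[of w t s "[]"] w eq by auto
  ultimately show False using \<open>s \<noteq> t\<close> by simp
qed

section \<open>Finite reductions\<close>

lemma fin_reduction_Nil [simp]: "fin_reduction w [] = []"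
  by (simp add: fin_reduction_def)

lemma fin_reduction_Cons [simp]:
  "fin_reduction w (x # t) = red w x # fin_reduction (seq_drop (length x) w) t"
proof -
  have "fin_reduction w (x # t) = map (\<lambda>i. red (seq_drop (\<Sum>j<i. length ((x # t) ! j)) w) ((x # t) ! i))
      (0 # map Suc [0..<length t])"
    unfolding fin_reduction_def reduced_term_seq_drop[of w]
    by (simp add: map_Suc_upt upt_conv_Cons del: upt_Suc)
  also have "\<dots> = red w x # fin_reduction (seq_drop (length x) w) t"
    unfolding fin_reduction_def reduced_term_seq_drop[of "seq_drop (length x) w"]
    by (simp add: sum.lessThan_Suc_shift comp_def del: sum.lessThan_Suc)
  finally show ?thesis .
qed

lemma concat_fin_reduction: "concat (fin_reduction w t) = red w (concat t)"
  by (induction t arbitrary: w) (simp_all add: red_append)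

lemma Nil_VRWfin [simp]: "[] \<in> VRWfin w"
  unfolding VRWfin_def by (rule image_eqI[of _ _ "[]"]) simp_all

lemma Cons_VRWfin_iff:
  "x # s \<in> VRWfin w \<longleftrightarrow> (\<exists>t\<in>varwords. x = red w t \<and> s \<in> VRWfin (seq_drop (length t) w))"
proof
  assume "x # s \<in> VRWfin w"
  then obtain ts where "ts \<in> lists varwords" "x # s = fin_reduction w ts"
    unfolding VRWfin_def by (elim imageE)
  then show "\<exists>t\<in>varwords. x = red w t \<and> s \<in> VRWfin (seq_drop (length t) w)"
    by (cases ts) (auto simp: VRWfin_def)
next
  assume "\<exists>t\<in>varwords. x = red w t \<and> s \<in> VRWfin (seq_drop (length t) w)"
  then obtain t ts where "t \<in> varwords" "ts \<in> lists varwords" "fin_reduction w (t # ts) = x # s"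
    unfolding VRWfin_def by auto
  then show "x # s \<in> VRWfin w" unfolding VRWfin_def by (metis image_eqI lists.Cons)
qed

lemma mem_VRW_iff: "x \<in> VRW w \<longleftrightarrow> (\<exists>t\<in>varwords. x = red w t)"
  by (simp add: VRW_def Cons_VRWfin_iff)

lemma VRWfin_append_iff:
  "s @ r \<in> VRWfin w \<longleftrightarrow>
    (\<exists>t\<in>lists varwords. s = fin_reduction w t \<and> r \<in> VRWfin (seq_drop (length (concat t)) w))"
proof (induction s arbitrary: w)
  case Nil
  have "t = []" if "[] = fin_reduction w t" for t using that by (cases t) auto
  then show ?case by (intro iffI bexI[of _ "[]"]) fastforce+
next
  case (Cons x s)
  show ?case
  proof
    assume "(x # s) @ r \<in> VRWfin w"
    then obtain t ts where "t \<in> varwords" "x = red w t" "ts \<in> lists varwords"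
      "s = fin_reduction (seq_drop (length t) w) ts"
      "r \<in> VRWfin (seq_drop (length (concat (t # ts))) w)"
      using Cons by (auto simp: Cons_VRWfin_iff)
    then show "\<exists>t\<in>lists varwords. x # s = fin_reduction w t \<and>
        r \<in> VRWfin (seq_drop (length (concat t)) w)"
      by (intro bexI[of _ "t # ts"]) auto
  next
    assume "\<exists>t\<in>lists varwords. x # s = fin_reduction w t \<and>
        r \<in> VRWfin (seq_drop (length (concat t)) w)"
    then obtain ts where ts: "ts \<in> lists varwords" "x # s = fin_reduction w ts"
        "r \<in> VRWfin (seq_drop (length (concat ts)) w)" by blast
    then obtain t ts' where "ts = t # ts'" by (cases ts) auto
    then show "(x # s) @ r \<in> VRWfin w" using ts Cons by (auto simp: Cons_VRWfin_iff)
  qed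
qed

lemma VRWfin_appendD: "s @ r \<in> VRWfin w \<Longrightarrow> s \<in> VRWfin w"
  unfolding VRWfin_append_iff by (auto simp: VRWfin_def)

lemma VRWfin_subset_lists:
  assumes "range w \<subseteq> varwords"
  shows "VRWfin w \<subseteq> lists varwords"
proof
  fix s assume "s \<in> VRWfin w"
  then show "s \<in> lists varwords"
    using assms
  proof (induction s arbitrary: w)
    case (Cons x s)
    then obtain t where "t \<in> varwords" "x = red w t" "s \<in> VRWfin (seq_drop (length t) w)"
      by (auto simp: Cons_VRWfin_iff)
    then show ?case
      using Cons.IH[OF _ range_seq_drop[OF Cons.prems(2)]] Cons.prems(2)
      by (simp add: red_varwords_iff)
  qed simp
qed

lemma map_seq_drop_upt: "map (seq_drop m u) [0..<n] = map u [m..<m + n]"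
  by (rule nth_equalityI) (simp_all add: seq_drop_def)

lemma Cons_head_VRWfin: "s \<in> VRWfin (seq_drop 1 w) \<Longrightarrow> w 0 # s \<in> VRWfin w"
  unfolding Cons_VRWfin_iff by (rule bexI[of _ "[None]"]) (simp_all add: varwords_def)

lemma map_upt_VRWfin: "map u [k..<k + n] \<in> VRWfin (seq_drop k u)"
proof (induction n arbitrary: k)
  case (Suc n)
  have "map u [k..<k + Suc n] = seq_drop k u 0 # map u [Suc k..<Suc k + n]"
    by (simp add: upt_conv_Cons seq_drop_def del: upt_Suc)
  then show ?case
    using Cons_head_VRWfin[of _ "seq_drop k u"] Suc[of "Suc k"] by (simp del: upt_Suc)
qed simp

subsection \<open>Variable reductions of sequences\<close>

lemma reduction_eq: "reduction w \<tau> i = red (seq_drop (\<Sum>j<i. length (\<tau> j)) w) (\<tau> i)"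
  by (simp add: reduction_def reduced_term_seq_drop[of w])

lemma seq_drop_reduction:
  "seq_drop k (reduction w \<tau>) = reduction (seq_drop (\<Sum>j<k. length (\<tau> j)) w) (seq_drop k \<tau>)"
proof
  fix i
  have "(\<Sum>j<k + i. length (\<tau> j)) = (\<Sum>j<k. length (\<tau> j)) + (\<Sum>j<i. length (\<tau> (k + j)))"
    by (induction i) simp_all
  then show "seq_drop k (reduction w \<tau>) i =
      reduction (seq_drop (\<Sum>j<k. length (\<tau> j)) w) (seq_drop k \<tau>) i"
    by (simp add: seq_drop_def[of k] reduction_eq)
qed

lemma red_reduction: "red (reduction w \<tau>) s = red w (red \<tau> s)"
proof (induction s arbitrary: w \<tau>)
  case (Cons a s)
  have "reduction w \<tau> 0 = red w (\<tau> 0)" by (simp add: reduction_eq)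
  moreover have "seq_drop 1 (reduction w \<tau>) = reduction (seq_drop (length (\<tau> 0)) w) (seq_drop 1 \<tau>)"
    by (simp add: seq_drop_reduction)
  ultimately show ?case
    by (simp add: red_Cons[of "reduction w \<tau>"] red_Cons[of \<tau>] red_append Cons subst_red)
qed simp

lemma range_reduction:
  assumes "range w \<subseteq> varwords" "range \<tau> \<subseteq> varwords"
  shows "range (reduction w \<tau>) \<subseteq> varwords"
  using assms by (auto simp: reduction_eq red_varwords_iff range_seq_drop)

lemma prec_range: "u \<prec> w \<Longrightarrow> range w \<subseteq> varwords \<Longrightarrow> range u \<subseteq> varwords"
  unfolding var_reduction_def using range_reduction by blast

text \<open>The number m of terms of w used by the first k terms of u is the same for all index
  words of length k. This allows the head of a reduction to be re-indexed separately from its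
  tail.\<close>

lemma prec_drop:
  assumes "u \<prec> w"
  shows "\<exists>m. seq_drop k u \<prec> seq_drop m w \<and>
    (\<forall>t. length t = k \<longrightarrow> (\<exists>t'. length t' = m \<and> red u t = red w t' \<and> (t \<in> varwords \<longrightarrow> t' \<in> varwords)))"
proof -
  obtain \<tau> where \<tau>: "range \<tau> \<subseteq> varwords" "u = reduction w \<tau>"
    using assms by (auto simp: var_reduction_def)
  define m where "m = (\<Sum>j<k. length (\<tau> j))"
  have "seq_drop k u \<prec> seq_drop m w"
    unfolding var_reduction_def \<tau>(2) m_def seq_drop_reduction
    using range_seq_drop[OF \<tau>(1)] by blast
  moreover have "\<exists>t'. length t' = m \<and> red u t = red w t' \<and> (t \<in> varwords \<longrightarrow> t' \<in> varwords)"
    if "length t = k" for t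
    using that \<tau> by (intro exI[of _ "red \<tau> t"]) (simp add: red_reduction length_red m_def red_varwords_iff)
  ultimately show ?thesis by blast
qed

lemma VRWfin_mono: "u \<prec> w \<Longrightarrow> VRWfin u \<subseteq> VRWfin w"
proof
  fix s assume "u \<prec> w" "s \<in> VRWfin u"
  then show "s \<in> VRWfin w"
  proof (induction s arbitrary: u w)
    case (Cons x s)
    then obtain t where t: "t \<in> varwords" "x = red u t" "s \<in> VRWfin (seq_drop (length t) u)"
      by (auto simp: Cons_VRWfin_iff)
    obtain m t' where m: "seq_drop (length t) u \<prec> seq_drop m w"
      and t': "length t' = m" "red u t = red w t'" "t' \<in> varwords"
      using prec_drop[OF Cons.prems(1), of "length t"] t(1) by blast
    have "s \<in> VRWfin (seq_drop m w)" using Cons.IH[OF m t(3)] .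
    then show ?case using t' t(2) by (auto simp: Cons_VRWfin_iff)
  qed simp
qed

lemma VRW_mono: "u \<prec> w \<Longrightarrow> VRW u \<subseteq> VRW w"
  using VRWfin_mono by (auto simp: VRW_def)

text \<open>Since the terms of \<open>w\<close> contain the variable, the indices of a reduction can be read off
  its terms, so the finite index sequences fit together.\<close>

lemma precI:
  assumes w: "range w \<subseteq> varwords" and u: "\<And>n. map u [0..<n] \<in> VRWfin w"
  shows "u \<prec> w"
proof -
  define good where "good i k \<longleftrightarrow> (\<forall>n. map u [i..<i + n] \<in> VRWfin (seq_drop k w))" for i k
  define P where "P i = (\<lambda>(k, t). (i = 0 \<longrightarrow> k = 0) \<and> t \<in> varwords \<and> u i = red (seq_drop k w) t \<and>
    good (Suc i) (k + length t))" for i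
  \<comment> \<open>Every n supplies an index word for \<open>u i\<close>; by decoding they all
    coincide, so one t serves every n.\<close>
  have step: "\<exists>t. t \<in> varwords \<and> u i = red (seq_drop k w) t \<and> good (Suc i) (k + length t)"
    if g: "good i k" for i k
  proof -
    have *: "\<exists>t\<in>varwords. u i = red (seq_drop k w) t \<and>
        map u [Suc i..<Suc i + n] \<in> VRWfin (seq_drop (k + length t) w)" for n
    proof -
      have "map u [i..<i + Suc n] = u i # map u [Suc i..<Suc i + n]"
        by (simp add: upt_conv_Cons del: upt_Suc)
      moreover have "map u [i..<i + Suc n] \<in> VRWfin (seq_drop k w)" using g unfolding good_def by blast
      ultimately show ?thesis by (simp add: Cons_VRWfin_iff)
    qed
    obtain t where t: "t \<in> varwords" "u i = red (seq_drop k w) t" using *[of 0] by blast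
    have "map u [Suc i..<Suc i + n] \<in> VRWfin (seq_drop (k + length t) w)" for n
      using *[of n] t red_inj[OF range_seq_drop[OF w]] by metis
    then show ?thesis using t unfolding good_def by blast
  qed
  have g0: "good 0 0" using u by (simp add: good_def)
  have "\<exists>f. \<forall>n. P n (f n) \<and> fst (f (Suc n)) = fst (f n) + length (snd (f n))"
  proof (rule dependent_nat_choice)
    show "\<exists>x. P 0 x" using step[OF g0] by (auto simp: P_def)
    show "\<exists>y. P (Suc n) y \<and> fst y = fst x + length (snd x)" if "P n x" for x n
      using that step[of "Suc n" "fst x + length (snd x)"] by (auto simp: P_def split: prod.splits)
  qed
  then obtain f where f: "\<And>n. P n (f n)" "\<And>n. fst (f (Suc n)) = fst (f n) + length (snd (f n))" by blast
  have f': "fst (f 0) = 0" "snd (f n) \<in> varwords" "u n = red (seq_drop (fst (f n)) w) (snd (f n))" for n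
    using f(1)[of n] f(1)[of 0] by (auto simp: P_def split: prod.splits)
  have "fst (f i) = (\<Sum>j<i. length (snd (f j)))" for i
    by (induction i) (simp_all add: f'(1) f(2))
  then have "u = reduction w (\<lambda>i. snd (f i))"
    using f'(3) by (simp add: fun_eq_iff reduction_eq)
  moreover have "range (\<lambda>i. snd (f i)) \<subseteq> varwords" using f'(2) by blast
  ultimately show ?thesis unfolding var_reduction_def by blast
qed

lemma prec_iff:
  "range w \<subseteq> varwords \<Longrightarrow> u \<prec> w \<longleftrightarrow> (\<forall>n. map u [0..<n] \<in> VRWfin w)"
proof (intro iffI allI)
  fix n assume "u \<prec> w"
  then show "map u [0..<n] \<in> VRWfin w"
    using VRWfin_mono map_upt_VRWfin[of u 0 n] by auto
qed (simp add: precI)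

lemma prec_trans: "range w \<subseteq> varwords \<Longrightarrow> u \<prec> v \<Longrightarrow> v \<prec> w \<Longrightarrow> u \<prec> w"
  using VRWfin_mono prec_iff prec_range by (metis subsetD)

lemma prec_refl: "range w \<subseteq> varwords \<Longrightarrow> w \<prec> w"
  using map_upt_VRWfin[of w 0] by (auto simp: prec_iff)

text \<open>Each stage reduces the tail of the stage before, so all heads from stage m on are
  assembled from \<open>v m\<close>.\<close>

lemma seq_drop_prec_fusion:
  assumes v: "\<And>n. range (v n) \<subseteq> varwords" "\<And>n. v (Suc n) \<prec> seq_drop 1 (v n)"
  shows "seq_drop m (\<lambda>n. v n 0) \<prec> v m"
proof -
  have "map (\<lambda>n. v n 0) [m..<m + n] \<in> VRWfin (v m)" for n m
  proof (induction n arbitrary: m)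
    case (Suc n)
    have "map (\<lambda>n. v n 0) [m..<m + Suc n] = v m 0 # map (\<lambda>n. v n 0) [Suc m..<Suc m + n]"
      by (simp add: upt_conv_Cons del: upt_Suc)
    moreover have "map (\<lambda>n. v n 0) [Suc m..<Suc m + n] \<in> VRWfin (seq_drop 1 (v m))"
      using Suc VRWfin_mono[OF v(2)] by blast
    ultimately show ?case by (metis Cons_head_VRWfin)
  qed simp
  then have "map (seq_drop m (\<lambda>n. v n 0)) [0..<n] \<in> VRWfin (v m)" for n
    by (simp add: map_seq_drop_upt)
  then show ?thesis by (intro precI v)
qed

subsection \<open>The pigeonhole principle and fusion\<close>

text \<open>The colouring is moved to the index words by \<open>red w\<close>, and the terms of v
  are chosen one by one so that all partial reductions stay in G.\<close>

lemma carlson: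
  fixes w :: "nat \<Rightarrow> 'a::finite word"
  assumes w: "range w \<subseteq> varwords"
  shows "\<exists>u. u \<prec> w \<and> ((\<forall>x\<in>VRW u. Q x) \<or> (\<forall>x\<in>VRW u. \<not> Q x))"
proof -
  obtain G where G: "G \<inter> varwords \<subseteq> {t. Q (red w t)} \<or> G \<inter> varwords \<subseteq> - {t. Q (red w t)}"
    "\<forall>R. finite R \<longrightarrow> R \<subseteq> insert [] G \<longrightarrow> (\<exists>u\<in>varwords. \<forall>x\<in>R. \<forall>\<alpha>. x @ subst u \<alpha> \<in> G)"
    using ex_extendible_set[of "{t. Q (red w t)}"] by (elim exE conjE)
  \<comment> \<open>\<open>fst p\<close> holds the values of all partial reductions so far, finitely
    many because the alphabet is finite.\<close>
  define next_words where "next_words p = {x @ subst (snd p) \<alpha> | x \<alpha>. x \<in> fst p}" for p :: "'a word set \<times> 'a word"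
  define P where "P n p \<longleftrightarrow> finite (fst p) \<and> fst p \<subseteq> insert [] G \<and> (n = 0 \<longrightarrow> fst p = {[]}) \<and>
    snd p \<in> varwords \<and> (\<forall>x\<in>fst p. \<forall>\<alpha>. x @ subst (snd p) \<alpha> \<in> G)" for n :: nat and p
  have "\<exists>f. \<forall>n. P n (f n) \<and> fst (f (Suc n)) = next_words (f n)"
  proof (rule dependent_nat_choice)
    show "\<exists>x. P 0 x" using G(2)[rule_format, of "{[]}"] by (auto simp: P_def)
    show "\<exists>y. P (Suc n) y \<and> fst y = next_words x" if x: "P n x" for x n
    proof -
      have "next_words x = (\<Union>y\<in>fst x. range (\<lambda>\<alpha>. y @ subst (snd x) \<alpha>))"
        by (auto simp: next_words_def)
      then have "finite (next_words x)" "next_words x \<subseteq> insert [] G"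
        using x by (auto simp: P_def)
      then show ?thesis using G(2)[rule_format, of "next_words x"] by (auto simp: P_def)
    qed
  qed
  then obtain f where f: "\<And>n. P n (f n)" "\<And>n. fst (f (Suc n)) = next_words (f n)" by blast
  define v where "v n = snd (f n)" for n
  have v: "range v \<subseteq> varwords" using f(1) by (auto simp: v_def P_def)
  have mem: "red v t \<in> fst (f (length t))" for t
  proof (induction t rule: rev_induct)
    case Nil
    then show ?case using f(1)[of 0] by (simp add: P_def)
  next
    case (snoc a t)
    then show ?case
      by (auto simp: f(2) red_append red_Cons seq_drop_def v_def next_words_def)
  qed
  have "red v t \<in> G" if tv: "t \<in> varwords" for t
  proof -
    obtain t' a where t: "t = t' @ [a]" using varwords_nonempty[OF tv] by (metis rev_exhaust)
    show ?thesis
      using mem[of t'] f(1)[of "length t'"]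
      by (simp add: t red_append red_Cons seq_drop_def v_def P_def)
  qed
  then have "(\<forall>x\<in>VRW (reduction w v). Q x) \<or> (\<forall>x\<in>VRW (reduction w v). \<not> Q x)"
    using G(1) v by (auto simp: mem_VRW_iff red_reduction red_varwords_iff subset_iff)
  then show ?thesis using v unfolding var_reduction_def by blast
qed

text \<open>In \<open>Q x v\<close> the word x is a head and v a sequence for what follows. A stage
  has only finitely many heads and Q passes to reductions, so one reduction serves all heads of the
  stage.\<close>

lemma fusion:
  fixes w :: "nat \<Rightarrow> 'a::finite word"
  assumes w: "range w \<subseteq> varwords"
    and ext: "\<And>x v. range v \<subseteq> varwords \<Longrightarrow> \<exists>v'. v' \<prec> v \<and> Q x v'"
    and mono: "\<And>x v v'. range v \<subseteq> varwords \<Longrightarrow> Q x v \<Longrightarrow> v' \<prec> v \<Longrightarrow> Q x v'"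
  shows "\<exists>u. u \<prec> w \<and> (\<forall>t. t \<noteq> [] \<longrightarrow> Q (red u t) (seq_drop (length t) u))"
proof -
  have fin: "\<exists>v'. v' \<prec> v \<and> (\<forall>x\<in>X. Q x v')" if "finite X" "range v \<subseteq> varwords" for X v
    using that
  proof (induction X)
    case empty
    then show ?case using prec_refl by auto
  next
    case (insert x X)
    then obtain v' where v': "v' \<prec> v" "\<forall>x\<in>X. Q x v'" by blast
    then have r: "range v' \<subseteq> varwords" using insert prec_range by blast
    then obtain v'' where "v'' \<prec> v'" "Q x v''" using ext by blast
    then show ?case using v' r insert mono prec_trans by (metis insert_iff)
  qed
  define next_words where "next_words p = {x @ subst (snd p 0) \<alpha> | x \<alpha>. x \<in> fst p}"
    for p :: "'a word set \<times> (nat \<Rightarrow> 'a word)"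
  \<comment> \<open>Stage 0 is w itself and asks nothing of the empty head, which gives
    \<open>u \<prec> w\<close>; the conclusion is accordingly about nonempty t.\<close>
  define P where "P n p \<longleftrightarrow> finite (fst p) \<and> range (snd p) \<subseteq> varwords \<and>
    (n = 0 \<longrightarrow> p = ({[]}, w)) \<and> (n \<noteq> 0 \<longrightarrow> (\<forall>x\<in>fst p. Q x (snd p)))" for n :: nat and p
  have "\<exists>f. \<forall>n. P n (f n) \<and> (fst (f (Suc n)) = next_words (f n) \<and> snd (f (Suc n)) \<prec> seq_drop 1 (snd (f n)))"
  proof (rule dependent_nat_choice)
    show "\<exists>x. P 0 x" using w by (intro exI[of _ "({[]}, w)"]) (simp add: P_def)
    show "\<exists>y. P (Suc n) y \<and> (fst y = next_words x \<and> snd y \<prec> seq_drop 1 (snd x))" if x: "P n x" for x n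
    proof -
      have "next_words x = (\<Union>y\<in>fst x. range (\<lambda>\<alpha>. y @ subst (snd x 0) \<alpha>))"
        by (auto simp: next_words_def)
      then have r: "finite (next_words x)" "range (seq_drop 1 (snd x)) \<subseteq> varwords"
        using x range_seq_drop[of "snd x" varwords 1] by (simp_all add: P_def)
      then obtain v' where v': "v' \<prec> seq_drop 1 (snd x)" "\<forall>y\<in>next_words x. Q y v'"
        using fin by blast
      moreover have "range v' \<subseteq> varwords" using prec_range[OF v'(1) r(2)] .
      ultimately show ?thesis using r by (intro exI[of _ "(next_words x, v')"]) (simp add: P_def)
    qed
  qed
  then obtain f where f: "\<And>n. P n (f n)" "\<And>n. fst (f (Suc n)) = next_words (f n)"
    "\<And>n. snd (f (Suc n)) \<prec> seq_drop 1 (snd (f n))" by blast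
  define u where "u n = snd (f n) 0" for n
  have rv: "range (snd (f n)) \<subseteq> varwords" for n using f(1)[of n] by (simp add: P_def)
  have u: "seq_drop m u \<prec> snd (f m)" for m
    using seq_drop_prec_fusion[of "\<lambda>n. snd (f n)" m] rv f(3) unfolding u_def by blast
  have mem: "red u t \<in> fst (f (length t))" for t
  proof (induction t rule: rev_induct)
    case Nil
    then show ?case using f(1)[of 0] by (simp add: P_def)
  next
    case (snoc a t)
    then show ?case
      by (auto simp: f(2) red_append red_Cons seq_drop_def u_def next_words_def)
  qed
  have "Q (red u t) (seq_drop (length t) u)" if "t \<noteq> []" for t
  proof -
    have "Q (red u t) (snd (f (length t)))"
      using mem[of t] f(1)[of "length t"] that by (simp add: P_def)
    then show ?thesis using mono rv u by blast
  qed
  moreover have "u \<prec> w" using u[of 0] f(1)[of 0] by (simp add: P_def)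
  ultimately show ?thesis by blast
qed

section \<open>Fronts of variable words\<close>

text \<open>The positions in \<open>dpos k ws\<close> are those of \<open>ws\<close> placed after a word of length \<open>k\<close>.\<close>

fun dpos :: "nat \<Rightarrow> 'a word list \<Rightarrow> nat set" where
  "dpos k [] = {}"
| "dpos k [x] = {}"
| "dpos k (x # y # ws) = insert (k + length x + 1) (dpos (k + length x) (y # ws))"

lemma dpos_eq:
  "dpos k ws = {1 + k + (\<Sum>j<i. length (ws ! j)) | i. 1 \<le> i \<and> i < length ws}"
proof (induction k ws rule: dpos.induct)
  case (3 k x y ws)
  define h where "h i = (\<Sum>j<i. length ((x # y # ws) ! j))" for i
  have h: "h (Suc i) = length x + (\<Sum>j<i. length ((y # ws) ! j))" for i
    unfolding h_def by (simp only: sum.lessThan_Suc_shift) simp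
  have *: "{1 + k + h i | i. 1 \<le> i \<and> i < length (x # y # ws)} =
      insert (1 + k + h 1) {1 + k + h (Suc i) | i. 1 \<le> i \<and> i < length (y # ws)}"
  proof (intro equalityI subsetI)
    fix z assume "z \<in> {1 + k + h i | i. 1 \<le> i \<and> i < length (x # y # ws)}"
    then obtain i where i: "z = 1 + k + h i" "1 \<le> i" "i < length (x # y # ws)" by blast
    show "z \<in> insert (1 + k + h 1) {1 + k + h (Suc i) | i. 1 \<le> i \<and> i < length (y # ws)}"
    proof (cases "i = 1")
      case False
      then obtain i' where "i = Suc i'" "1 \<le> i'" using i by (cases i) auto
      then show ?thesis using i by auto
    qed (use i in simp)
  qed force
  show ?case
    unfolding h_def[symmetric] * dpos.simps 3 h using h[of 0] by (simp add: ac_simps)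
qed auto

lemma dset_eq_dpos: "dset ws = dpos 0 ws"
  by (simp add: dset_def dpos_eq)

lemma dpos_greater: "ws \<in> lists varwords \<Longrightarrow> set_less {k + 1} (dpos k ws)"
proof (induction k ws rule: dpos.induct)
  case (3 k x y ws)
  then have "x \<noteq> []" "set_less {k + length x + 1} (dpos (k + length x) (y # ws))"
    by (auto simp: varwords_nonempty)
  then show ?case by (cases x) (auto simp: set_less_def)
qed simp_all

context front_system
begin

text \<open>Ranks depend on absolute positions, so sequences are seen as continuations of a word of
  length k. Rank 0 gives exactly the one-term sequences.\<close>

definition front :: "omega1 \<Rightarrow> nat \<Rightarrow> 'a word list set" where
  "front \<xi> k = {ws \<in> lists varwords. ws \<noteq> [] \<and> A \<xi> (dpos k ws)}"

lemma Nil_front [simp]: "[] \<notin> front \<xi> k"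
  by (simp add: front_def)

lemma Cons_front_iff:
  "x # ws \<in> front \<xi> k \<longleftrightarrow>
    x \<in> varwords \<and> (if \<xi> = 0 then ws = [] else ws \<in> front (g \<xi> (k + length x + 1)) (k + length x))"
proof (cases ws)
  case Nil
  then show ?thesis using A_zero A_empty by (auto simp: front_def)
next
  case (Cons y ws')
  have "set_less {k + length x + 1} (dpos (k + length x) ws)" if "ws \<in> lists varwords"
    by (rule dpos_greater[OF that])
  then show ?thesis
    using A_zero A_insert[of \<xi> "k + length x + 1" "dpos (k + length x) ws"]
    by (auto simp: front_def Cons)
qed

text \<open>Every term lowers the rank, so following t term by term either reaches the front
  strictly inside t or leaves a rank along which t can be completed.\<close>

lemma ex_front_comparable:
  fixes u :: "nat \<Rightarrow> 'a word"
  assumes "range u \<subseteq> varwords" "t \<in> VRWfin u"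
  shows "(\<exists>t1 r. t = t1 @ r \<and> r \<noteq> [] \<and> t1 \<in> front \<xi> k) \<or> (\<exists>r. t @ r \<in> front \<xi> k \<inter> VRWfin u)"
  using assms
proof (induction \<xi> arbitrary: k u t rule: less_induct)
  case (less \<xi>)
  have u0: "u 0 \<in> varwords" "[u 0] \<in> VRWfin u"
    using less.prems map_upt_VRWfin[of u 0 1] by auto
  \<comment> \<open>For empty t the head is borrowed from u, so that both cases run through the same
    recursion.\<close>
  define x s where "x = (if t = [] then u 0 else hd t)" and "s = tl t"
  have xs: "x # s \<in> VRWfin u" using less.prems u0 by (cases t) (auto simp: x_def s_def)
  then have x: "x \<in> varwords" using VRWfin_subset_lists[OF less.prems(1)] by auto
  obtain y where y: "y \<in> varwords" "x = red u y" "s \<in> VRWfin (seq_drop (length y) u)"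
    using xs by (auto simp: Cons_VRWfin_iff)
  show ?case
  proof (cases "\<xi> = 0")
    case True
    then have "[x] \<in> front \<xi> k" using x by (simp add: Cons_front_iff)
    moreover have "[x] \<in> VRWfin u" using VRWfin_appendD[of "[x]" s] xs by simp
    ultimately show ?thesis
    proof (cases t)
      case Nil
      then show ?thesis using \<open>[x] \<in> front \<xi> k\<close> \<open>[x] \<in> VRWfin u\<close> by auto
    next
      case (Cons y ys)
      then have "t = [x] @ s" by (simp add: x_def s_def)
      then show ?thesis
        using \<open>[x] \<in> front \<xi> k\<close> \<open>[x] \<in> VRWfin u\<close> by (metis append_Nil2 IntI)
    qed
  next
    case False
    then have "g \<xi> (k + length x + 1) < \<xi>" using g_less by simp
    from less.IH[OF this range_seq_drop[OF less.prems(1)] y(3), of "k + length x"]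
    show ?thesis
    proof (elim disjE exE conjE)
      fix t1 r assume *: "s = t1 @ r" "r \<noteq> []" "t1 \<in> front (g \<xi> (k + length x + 1)) (k + length x)"
      then have "x # t1 \<in> front \<xi> k" "t = (x # t1) @ r"
        using False x by (cases t; auto simp: Cons_front_iff x_def s_def)+
      then show ?thesis using *(2) by blast
    next
      fix r assume *: "s @ r \<in> front (g \<xi> (k + length x + 1)) (k + length x) \<inter> VRWfin (seq_drop (length y) u)"
      then have "x # s @ r \<in> front \<xi> k \<inter> VRWfin u"
        using False x y by (auto simp: Cons_front_iff Cons_VRWfin_iff)
      moreover have "\<exists>r'. x # s @ r = t @ r'" by (cases t) (auto simp: x_def s_def)
      ultimately show ?thesis by metis
    qed
  qed
qed

theorem front_dichotomy:
  fixes w :: "nat \<Rightarrow> 'a::finite word"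
  assumes "range w \<subseteq> varwords"
  shows "\<exists>u. u \<prec> w \<and> (front \<xi> k \<inter> VRWfin u \<subseteq> F \<or> front \<xi> k \<inter> VRWfin u \<inter> F = {})"
  using assms
proof (induction \<xi> arbitrary: k F w rule: less_induct)
  case (less \<xi>)
  show ?case
  proof (cases "\<xi> = 0")
    case True
    obtain u where u: "u \<prec> w" "(\<forall>x\<in>VRW u. [x] \<in> F) \<or> (\<forall>x\<in>VRW u. [x] \<notin> F)"
      using carlson[OF less.prems] by blast
    have "\<exists>x\<in>VRW u. s = [x]" if "s \<in> front \<xi> k" "s \<in> VRWfin u" for s
      using that True by (cases s) (auto simp: Cons_front_iff VRW_def)
    then show ?thesis using u by (intro exI[of _ u]) blast
  next
    case False
    \<comment> \<open>The induction hypothesis decides the continuations of one head; fusion does so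
      for all heads at once.\<close>
    define hom where "hom x v B \<longleftrightarrow>
      (\<forall>s\<in>front (g \<xi> (k + length x + 1)) (k + length x) \<inter> VRWfin v. x # s \<in> B)"
      for x and v :: "nat \<Rightarrow> 'a word" and B
    have "\<exists>u. u \<prec> w \<and> (\<forall>t. t \<noteq> [] \<longrightarrow>
      hom (red u t) (seq_drop (length t) u) F \<or> hom (red u t) (seq_drop (length t) u) (- F))"
    proof (rule fusion[OF less.prems])
      fix x :: "'a word" and v :: "nat \<Rightarrow> 'a word"
      assume v: "range v \<subseteq> varwords"
      have "g \<xi> (k + length x + 1) < \<xi>" using False g_less by simp
      from less.IH[OF this v, of "k + length x" "{s. x # s \<in> F}"]
      show "\<exists>v'. v' \<prec> v \<and> (hom x v' F \<or> hom x v' (- F))" unfolding hom_def by blast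
    next
      fix x :: "'a word" and v v' :: "nat \<Rightarrow> 'a word"
      assume "hom x v F \<or> hom x v (- F)" "v' \<prec> v"
      then show "hom x v' F \<or> hom x v' (- F)" unfolding hom_def using VRWfin_mono by blast
    qed
    then obtain u where u: "u \<prec> w" "\<And>t. t \<noteq> [] \<Longrightarrow>
      hom (red u t) (seq_drop (length t) u) F \<or> hom (red u t) (seq_drop (length t) u) (- F)" by blast
    define All where "All x B \<longleftrightarrow> (\<forall>s. x # s \<in> front \<xi> k \<inter> VRWfin u \<longrightarrow> x # s \<in> B)" for x B
    have ru: "range u \<subseteq> varwords" using prec_range[OF u(1) less.prems] .
    have All: "All x F \<or> All x (- F)" if "x \<in> VRW u" for x
    proof -
      obtain t where t: "t \<in> varwords" "x = red u t" using \<open>x \<in> VRW u\<close> by (auto simp: mem_VRW_iff)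
      \<comment> \<open>The head determines its index word t, so the rest is a reduction of
        precisely the tail for which this head was decided.\<close>
      have "s \<in> VRWfin (seq_drop (length t) u)" if "x # s \<in> VRWfin u" for s
        using that t(2) red_inj[OF ru] unfolding Cons_VRWfin_iff by metis
      then show ?thesis
        using u(2)[OF varwords_nonempty[OF t(1)]] False unfolding All_def hom_def t(2)[symmetric]
        by (auto simp: Cons_front_iff)
    qed
    \<comment> \<open>The pigeonhole principle, applied to the heads, makes the decision independent
      of the head.\<close>
    obtain u' where u': "u' \<prec> u" "(\<forall>x\<in>VRW u'. All x F) \<or> (\<forall>x\<in>VRW u'. \<not> All x F)"
      using carlson[OF ru] by blast
    have "(\<forall>x\<in>VRW u'. All x F) \<or> (\<forall>x\<in>VRW u'. All x (- F))"
      using u'(2) All VRW_mono[OF u'(1)] by blast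
    moreover have "\<exists>x y. x \<in> VRW u' \<and> s = x # y" if "s \<in> front \<xi> k" "s \<in> VRWfin u'" for s
    proof (cases s)
      case (Cons x y)
      then have "[x] \<in> VRWfin u'" using that VRWfin_appendD[of "[x]" y] by simp
      then show ?thesis using Cons by (auto simp: VRW_def)
    qed (use that in simp)
    ultimately have "front \<xi> k \<inter> VRWfin u' \<subseteq> F \<or> front \<xi> k \<inter> VRWfin u' \<inter> F = {}"
      using VRWfin_mono[OF u'(1)] unfolding All_def by blast
    then show ?thesis using prec_trans[OF less.prems u'(1) u(1)] by blast
  qed
qed

end

section \<open>Pointwise closed trees\<close>

lemma ex_branch:
  assumes "P []" "\<And>s. P s \<Longrightarrow> \<exists>x. P (s @ [x])"
  shows "\<exists>b. \<forall>n. P (map b [0..<n])"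
proof -
  have "\<exists>f. \<forall>n. (P (f n) \<and> length (f n) = n) \<and> (\<exists>x. f (Suc n) = f n @ [x])"
    by (rule dependent_nat_choice) (use assms in fastforce)+
  then obtain f where f: "\<And>n. P (f n)" "\<And>n. length (f n) = n" "\<And>n. \<exists>x. f (Suc n) = f n @ [x]"
    by blast
  define b where "b n = last (f (Suc n))" for n
  have "f (Suc n) = f n @ [b n]" for n using f(3)[of n] by (auto simp: b_def)
  then have "f n = map b [0..<n]" for n by (induction n) (use f(2)[of 0] in simp_all)
  then show ?thesis using f(1) by metis
qed

definition block :: "nat \<Rightarrow> 'a word \<Rightarrow> (nat \<times> 'a option) set" where
  "block p x = {(1 + p + j, x ! j) | j. j < length x}"

lemma sum_length_nth:
  "i \<le> length ws \<Longrightarrow> (\<Sum>j<i. length (ws ! j)) = length (concat (take i ws))"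
  by (induction i) (simp_all add: take_Suc_conv_app_nth)

lemma blocks_eq: "blocks ws = {block (length (concat (take i ws))) (ws ! i) | i. i < length ws}"
proof -
  have "blocks ws = (\<lambda>i. block (length (concat (take i ws))) (ws ! i)) ` {..<length ws}"
    unfolding blocks_def block_def by (rule image_cong) (simp_all add: sum_length_nth)
  then show ?thesis by auto
qed

lemma blocks_append: "blocks s \<subseteq> blocks (s @ r)"
proof
  fix B assume "B \<in> blocks s"
  then obtain i where "i < length s" "B = block (length (concat (take i s))) (s ! i)"
    by (auto simp: blocks_eq)
  then show "B \<in> blocks (s @ r)"
    unfolding blocks_eq mem_Collect_eq by (intro exI[of _ i]) (simp add: nth_append)
qed

lemma blocks_snoc: "blocks (s @ [x]) = insert (block (length (concat s)) x) (blocks s)"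
proof
  show "blocks (s @ [x]) \<subseteq> insert (block (length (concat s)) x) (blocks s)"
  proof
    fix B assume "B \<in> blocks (s @ [x])"
    then obtain i where i: "i \<le> length s"
      "B = block (length (concat (take i (s @ [x])))) ((s @ [x]) ! i)"
      by (auto simp: blocks_eq less_Suc_eq_le)
    show "B \<in> insert (block (length (concat s)) x) (blocks s)"
    proof (cases "i = length s")
      case False
      then have "B = block (length (concat (take i s))) (s ! i)" "i < length s"
        using i by (simp_all add: nth_append)
      then show ?thesis by (auto simp: blocks_eq)
    qed (use i in simp)
  qed
  have "block (length (concat s)) x \<in> blocks (s @ [x])"
    unfolding blocks_eq mem_Collect_eq by (intro exI[of _ "length s"]) simp
  then show "insert (block (length (concat s)) x) (blocks s) \<subseteq> blocks (s @ [x])"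
    using blocks_append by blast
qed

lemma blocks_Nil [simp]: "blocks [] = {}"
  by (simp add: blocks_eq)

lemma blocks_snoc_mem: "block (length (concat s)) x \<in> blocks (s @ x # r)"
  using blocks_append[of "s @ [x]" r] by (auto simp: blocks_snoc)

lemma block_inj: "block p x = block p y \<Longrightarrow> x = y"
proof -
  assume eq: "block p x = block p y"
  have len: "length x = card (block p x)" for x :: "'a word"
  proof -
    have "block p x = (\<lambda>j. (1 + p + j, x ! j)) ` {..<length x}" by (auto simp: block_def)
    then show ?thesis by (simp add: card_image inj_on_def)
  qed
  have "x ! j = y ! j" if "j < length x" for j
  proof -
    have "(1 + p + j, x ! j) \<in> block p y" using that eq unfolding block_def by blast
    then show ?thesis by (auto simp: block_def)
  qed
  then show "x = y" using len[of x] len[of y] eq by (intro nth_equalityI) auto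
qed

lemma length_concat_take_mono:
  assumes "i \<le> j"
  shows "length (concat (take i t)) \<le> length (concat (take j t))"
proof -
  have "take j t = take i t @ take (j - i) (drop i t)"
    using assms by (metis take_add le_add_diff_inverse)
  then show ?thesis by simp
qed

lemma length_concat_take_less:
  assumes "t \<in> lists varwords" "i < j" "i < length t"
  shows "length (concat (take i t)) < length (concat (take j t))"
proof -
  have "t ! i \<noteq> []" using assms varwords_nonempty by (metis in_listsD nth_mem)
  then have "length (concat (take i t)) < length (concat (take (Suc i) t))"
    using assms(3) by (simp add: take_Suc_conv_app_nth)
  also have "\<dots> \<le> length (concat (take j t))" using assms(2) by (intro length_concat_take_mono) simp
  finally show ?thesis .
qed

text \<open>The blocks of t tile an initial segment of the positions, so a block of s that starts
  where a common initial part ends must be the next block of t.\<close>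

lemma blocks_subset_imp_prefix:
  assumes "s \<in> lists varwords" "t \<in> lists varwords" "blocks s \<subseteq> blocks t"
  shows "\<exists>r. t = s @ r"
  using assms(1,3)
proof (induction s rule: rev_induct)
  case (snoc x s)
  define h where "h i = length (concat (take i t))" for i
  obtain r where r: "t = s @ r" using snoc by (auto simp: blocks_snoc)
  have hs: "h (length s) = length (concat s)" by (simp add: h_def r)
  have "block (h (length s)) x \<in> blocks t" using snoc.prems(2) hs by (simp add: blocks_snoc)
  then obtain i where i: "i < length t" "block (h (length s)) x = block (h i) (t ! i)"
    by (auto simp: blocks_eq h_def)
  have "x \<noteq> []" using snoc.prems(1) varwords_nonempty by auto
  then have "(1 + h (length s) + 0, x ! 0) \<in> block (h (length s)) x" unfolding block_def by blast
  then have b: "h i \<le> h (length s)" "h (length s) < h i + length (t ! i)"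
    unfolding i(2) by (auto simp: block_def)
  have "h i + length (t ! i) = h (Suc i)" using i(1) by (simp add: h_def take_Suc_conv_app_nth)
  then have "\<not> Suc i \<le> length s" using b(2) length_concat_take_mono[of "Suc i" "length s" t] by (auto simp: h_def)
  moreover have "\<not> length s < i"
    using b(1) length_concat_take_less[OF assms(2), of "length s" i] i(1) by (auto simp: h_def)
  ultimately have "i = length s" by simp
  then have "t ! length s = x" "length s < length t" using i block_inj by metis+
  then have "r = x # tl r" by (cases r) (auto simp: r)
  then have "t = (s @ [x]) @ tl r" unfolding r by simp
  then show ?case ..
qed simp

lemma block_fin_subsets: "block p x \<in> fin_subsets"
proof -
  have "block p x = (\<lambda>j. (1 + p + j, x ! j)) ` {..<length x}" by (auto simp: block_def)
  then show ?thesis by (auto simp: fin_subsets_def)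
qed

lemma blocks_fin_subsets: "blocks s \<subseteq> fin_subsets"
  by (auto simp: blocks_eq block_fin_subsets)

lemma char_fun_eq_one_iff: "B \<in> fin_subsets \<Longrightarrow> char_fun s B = 1 \<longleftrightarrow> B \<in> blocks s"
  by (simp add: char_fun_def indicator_def)

lemma char_fun_range: "char_fun s \<in> fin_subsets \<rightarrow>\<^sub>E {0, 1}"
  by (auto simp: char_fun_def indicator_def)

lemma char_fun_topspace:
  "char_fun s \<in> topspace (product_topology (\<lambda>_. discrete_topology {0, 1}) fin_subsets)"
  unfolding topspace_product_topology topspace_discrete_topology by (rule char_fun_range)

abbreviation cube :: "((nat \<times> 'a option) set \<Rightarrow> nat) topology" where
  "cube \<equiv> product_topology (\<lambda>_. discrete_topology {0, 1}) fin_subsets"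

text \<open>The characteristic functions of the initial segments of b converge to that of the union
  of their blocks, and no finite sequence has all these blocks.\<close>

lemma not_closed_if_branch:
  assumes H: "H \<subseteq> lists varwords" and b: "\<And>n. map b [0..<n] \<in> H"
  shows "\<not> pointwise_closed H"
proof
  assume "pointwise_closed H"
  then have cl: "closedin cube (char_fun ` H)" by (simp add: pointwise_closed_def)
  define B where "B = (\<Union>n. blocks (map b [0..<n]))"
  define f where "f = (restrict (indicator B) fin_subsets :: _ \<Rightarrow> nat)"
  have mono: "blocks (map b [0..<m]) \<subseteq> blocks (map b [0..<n])" if "m \<le> n" for m n
  proof -
    have "map b [0..<n] = map b [0..<m] @ map b [m..<n]"
      using that by (metis le_add_diff_inverse map_append upt_add_eq_append zero_le)
    then show ?thesis using blocks_append by metis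
  qed
  have "limitin cube (\<lambda>n. char_fun (map b [0..<n])) f sequentially"
    unfolding limitin_componentwise
  proof (intro conjI ballI)
    show "f \<in> extensional fin_subsets" by (simp add: f_def)
    show "\<forall>\<^sub>F n in sequentially. char_fun (map b [0..<n]) \<in> topspace cube"
      by (intro always_eventually allI char_fun_topspace)
    fix A :: "(nat \<times> 'a option) set" assume A: "A \<in> fin_subsets"
    have "\<forall>\<^sub>F n in sequentially. char_fun (map b [0..<n]) A = f A"
    proof (cases "A \<in> B")
      case True
      then obtain m where "A \<in> blocks (map b [0..<m])" by (auto simp: B_def)
      then have "A \<in> blocks (map b [0..<n])" if "m \<le> n" for n using mono[OF that] by blast
      then show ?thesis
        using A True
        by (auto simp: eventually_sequentially char_fun_def f_def indicator_def intro!: exI[of _ m])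
    next
      case False
      then show ?thesis using A by (auto simp: B_def char_fun_def f_def)
    qed
    moreover have "f A \<in> {0, 1}" using A by (auto simp: f_def indicator_def)
    ultimately show "limitin (discrete_topology {0, 1}) (\<lambda>n. char_fun (map b [0..<n]) A) (f A) sequentially"
      by (intro limitin_eventually) auto
  qed
  then have "f \<in> char_fun ` H"
    using cl b by (auto intro: limitin_closedin)
  then obtain s where s: "s \<in> H" "f = char_fun s" by blast
  have "n \<le> length s" for n
  proof -
    have "blocks (map b [0..<n]) \<subseteq> blocks s"
    proof
      fix A assume A: "A \<in> blocks (map b [0..<n])"
      then have "A \<in> fin_subsets" "A \<in> B" using blocks_fin_subsets by (auto simp: B_def)
      then have "f A = 1" by (simp add: f_def)
      then show "A \<in> blocks s"
        using s(2) A blocks_fin_subsets char_fun_eq_one_iff by blast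
    qed
    then obtain r where "s = map b [0..<n] @ r"
      using blocks_subset_imp_prefix H b s(1) by blast
    then show ?thesis by simp
  qed
  then show False by (metis Suc_n_not_le_n)
qed

text \<open>Let f be a limit point outside the image of H. A sequence in H whose blocks all have
  value 1 under f can always be extended: f differs from its characteristic function and so accepts
  a further block, and an element of H that approximates f supplies the next term.\<close>

lemma branch_if_not_closed:
  fixes H :: "'a::finite word list set"
  assumes H: "H \<subseteq> lists varwords" "[] \<in> H" "\<And>s r. s @ r \<in> H \<Longrightarrow> s \<in> H"
    and nc: "\<not> pointwise_closed H"
  shows "\<exists>b. \<forall>n. map b [0..<n] \<in> H"
proof -
  have sub: "char_fun ` H \<subseteq> topspace cube" using char_fun_topspace by blast
  then obtain f where f: "f \<in> cube closure_of (char_fun ` H)" "f \<notin> char_fun ` H"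
    using nc by (auto simp: pointwise_closed_def closure_of_subset_eq[symmetric])
  have ftop: "f \<in> topspace cube" using f(1) by (simp add: in_closure_of)
  have approx: "\<exists>t\<in>H. \<forall>A\<in>K. char_fun t A = f A" if K: "finite K" "K \<subseteq> fin_subsets" for K
  proof -
    define T where "T = {g \<in> topspace cube. \<forall>A\<in>K. g A = f A}"
    have "openin cube T"
      unfolding T_def using K
    proof (induction K)
      case (insert A K)
      have "openin cube {g \<in> topspace cube. g A \<in> {f A}}"
        by (rule openin_continuous_map_preimage[OF continuous_map_product_projection])
          (use insert.prems ftop in \<open>auto simp: PiE_iff\<close>)
      then have "openin cube ({g \<in> topspace cube. g A \<in> {f A}} \<inter> {g \<in> topspace cube. \<forall>A\<in>K. g A = f A})"
        using insert by (intro openin_Int) auto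
      moreover have "{g \<in> topspace cube. g A \<in> {f A}} \<inter> {g \<in> topspace cube. \<forall>A\<in>K. g A = f A} =
          {g \<in> topspace cube. \<forall>A\<in>insert A K. g A = f A}" by auto
      ultimately show ?case by simp
    next
      case empty
      then show ?case using openin_topspace[of cube] by (simp del: topspace_product_topology)
    qed
    moreover have "f \<in> T" using ftop by (simp add: T_def)
    ultimately obtain y where "y \<in> char_fun ` H" "y \<in> T"
      using f(1)[unfolded in_closure_of] by blast
    then show ?thesis by (auto simp: T_def)
  qed
  define good where "good s \<longleftrightarrow> s \<in> H \<and> (\<forall>A\<in>blocks s. f A = 1)" for s
  have "\<exists>x. good (s @ [x])" if s: "good s" for s
  proof -
    have "f \<noteq> char_fun s" using f(2) s by (auto simp: good_def)
    moreover have fE: "f \<in> fin_subsets \<rightarrow>\<^sub>E {0, 1}"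
      using ftop unfolding topspace_product_topology topspace_discrete_topology .
    ultimately obtain A where A: "A \<in> fin_subsets" "f A \<noteq> char_fun s A"
      using PiE_ext[OF fE char_fun_range[of s]] by blast
    have "f A \<in> {0, 1}" "char_fun s A \<in> {0, 1}"
      using PiE_mem[OF fE A(1)] PiE_mem[OF char_fun_range[of s] A(1)] .
    moreover have "char_fun s A = 1 \<longleftrightarrow> A \<in> blocks s" by (rule char_fun_eq_one_iff[OF A(1)])
    moreover have "A \<in> blocks s \<Longrightarrow> f A = 1" using s by (simp add: good_def)
    ultimately have A1: "f A = 1" "A \<notin> blocks s" using A(2) by fastforce+
    define N where "N = Max (insert (length (concat s)) (fst ` A))"
    have fin: "finite (insert (length (concat s)) (fst ` A))" using A(1) by (simp add: fin_subsets_def)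
    have N: "length (concat s) \<le> N" "\<And>q. q \<in> A \<Longrightarrow> fst q \<le> N"
      unfolding N_def using fin by (auto intro: Max_ge)
    \<comment> \<open>A finite window of coordinates: all sets of positions up to N, in particular
      the blocks of s and the set A.\<close>
    define K where "K = Pow ({1..N} \<times> (UNIV :: 'a option set))"
    have "finite K" "K \<subseteq> fin_subsets"
      by (auto simp: K_def fin_subsets_def intro: finite_subset)
    then obtain t where t: "t \<in> H" "\<forall>A\<in>K. char_fun t A = f A"
      using approx[of K] by metis
    have inK: "block p x \<in> K" if "p + length x \<le> N" for p x
      using that by (auto simp: K_def block_def)
    have "blocks s \<subseteq> blocks t"
    proof
      fix B assume B: "B \<in> blocks s"
      then obtain i where i: "i < length s" "B = block (length (concat (take i s))) (s ! i)"
        by (auto simp: blocks_eq)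
      have "length (concat (take i s)) + length (s ! i) = length (concat (take (Suc i) s))"
        using i(1) by (simp add: take_Suc_conv_app_nth)
      also have "\<dots> \<le> length (concat s)"
        using length_concat_take_mono[of "Suc i" "length s" s] i(1) by simp
      finally have "B \<in> K" unfolding i(2) using N(1) by (intro inK) simp
      then show "B \<in> blocks t"
        using t(2)[rule_format, of B] s B \<open>K \<subseteq> fin_subsets\<close> char_fun_eq_one_iff[of B t]
        by (auto simp: good_def)
    qed
    moreover have "s \<in> lists varwords" "t \<in> lists varwords"
      using H(1) s t(1) unfolding good_def by blast+
    ultimately obtain r where r: "t = s @ r" using blocks_subset_imp_prefix by metis
    have "A \<in> K" using N(2) A(1) by (fastforce simp: K_def fin_subsets_def)
    then have "A \<in> blocks t" using t(2)[rule_format] A1 A(1) char_fun_eq_one_iff by metis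
    then obtain i where i: "i < length t" "A = block (length (concat (take i t))) (t ! i)"
      by (auto simp: blocks_eq)
    have tl: "t \<in> lists varwords" using t(1) H(1) by blast
    \<comment> \<open>A is a block of t behind s, so the term of t right after s ends no later than
      A does and its block is still in K.\<close>
    have "length s \<le> i"
    proof (rule ccontr)
      assume "\<not> length s \<le> i"
      then have "A \<in> blocks s" using i unfolding r blocks_eq by (auto simp: nth_append)
      then show False using A1 by simp
    qed
    then obtain x r' where x: "r = x # r'" using i(1) r by (cases r) auto
    have "t ! i \<noteq> []" using tl i(1) varwords_nonempty by (metis in_listsD nth_mem)
    then obtain j where j: "length (t ! i) = Suc j" by (cases "length (t ! i)") auto
    then have "(1 + length (concat (take i t)) + j, t ! i ! j) \<in> A" unfolding i(2) block_def by auto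
    then have "length (concat (take i t)) + length (t ! i) \<le> N" using N(2) j by force
    moreover have "length (concat (take i t)) + length (t ! i) = length (concat (take (Suc i) t))"
      using i(1) by (simp add: take_Suc_conv_app_nth)
    moreover have "length (concat (take (Suc (length s)) t)) \<le> length (concat (take (Suc i) t))"
      using \<open>length s \<le> i\<close> by (intro length_concat_take_mono) simp
    moreover have "length (concat (take (Suc (length s)) t)) = length (concat s) + length x"
      by (simp add: r x)
    ultimately have "block (length (concat s)) x \<in> K" by (intro inK) simp
    moreover have "block (length (concat s)) x \<in> blocks t" unfolding r x by (rule blocks_snoc_mem)
    ultimately have "f (block (length (concat s)) x) = 1"
      using t(2) block_fin_subsets char_fun_eq_one_iff by metis
    moreover have "s @ [x] \<in> H" using H(3)[of "s @ [x]" r'] t(1) r x by simp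
    ultimately have "good (s @ [x])" using s by (auto simp: good_def blocks_snoc)
    then show ?thesis ..
  qed
  moreover have "good []" using H(2) by (simp add: good_def)
  ultimately show ?thesis using ex_branch[of good] by (auto simp: good_def)
qed

section \<open>Hereditary families\<close>

lemma red_cong: "(\<And>i. i < length t \<Longrightarrow> v i = w i) \<Longrightarrow> red v t = red w t"
  unfolding reduced_term_def by (intro arg_cong[where f = concat] map_cong) auto

lemma fin_reduction_cong:
  "(\<And>i. i < length (concat t) \<Longrightarrow> v i = w i) \<Longrightarrow> fin_reduction v t = fin_reduction w t"
proof (induction t arbitrary: v w)
  case (Cons x t)
  have "red v x = red w x" by (rule red_cong) (use Cons.prems in simp)
  moreover have "fin_reduction (seq_drop (length x) v) t = fin_reduction (seq_drop (length x) w) t"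
    by (rule Cons.IH) (use Cons.prems in \<open>simp add: seq_drop_def\<close>)
  ultimately show ?case by simp
qed simp

lemma length_fin_reduction [simp]: "length (fin_reduction w t) = length t"
  by (simp add: fin_reduction_def)

lemma take_fin_reduction: "take i (fin_reduction w t) = fin_reduction w (take i t)"
  by (induction t arbitrary: w i) (simp_all add: take_Cons')

lemma fin_reduction_varwords_iff:
  "range w \<subseteq> varwords \<Longrightarrow> fin_reduction w t \<in> lists varwords \<longleftrightarrow> t \<in> lists varwords"
  by (induction t arbitrary: w) (simp_all add: red_varwords_iff range_seq_drop)

lemma fin_reduction_replicate: "fin_reduction w (replicate n [None]) = map w [0..<n]"
proof (induction n arbitrary: w)
  case (Suc n)
  have "map w [0..<Suc n] = w 0 # map (seq_drop 1 w) [0..<n]"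
    by (simp add: map_seq_drop_upt upt_conv_Cons del: upt_Suc)
  then show ?case using Suc by simp
qed simp

lemma VRWfin_append_fin_reduction:
  assumes w: "range w \<subseteq> varwords" and \<tau>: "\<tau> \<in> lists varwords"
  shows "fin_reduction w \<tau> @ s \<in> VRWfin w \<longleftrightarrow> s \<in> VRWfin (seq_drop (length (concat \<tau>)) w)"
proof
  assume "fin_reduction w \<tau> @ s \<in> VRWfin w"
  then obtain \<tau>' where \<tau>': "fin_reduction w \<tau> = fin_reduction w \<tau>'"
    "s \<in> VRWfin (seq_drop (length (concat \<tau>')) w)"
    by (auto simp: VRWfin_append_iff)
  then have "red w (concat \<tau>) = red w (concat \<tau>')" by (metis concat_fin_reduction)
  then show "s \<in> VRWfin (seq_drop (length (concat \<tau>)) w)" using \<tau>'(2) red_inj[OF w] by metis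
qed (use \<tau> in \<open>auto simp: VRWfin_append_iff\<close>)

lemma VRWfin_merge: "t @ x # s \<in> VRWfin w \<Longrightarrow> (concat t @ x) # s \<in> VRWfin w"
proof -
  assume "t @ x # s \<in> VRWfin w"
  then obtain \<tau> y where \<tau>: "t = fin_reduction w \<tau>" "y \<in> varwords"
    "x = red (seq_drop (length (concat \<tau>)) w) y"
    "s \<in> VRWfin (seq_drop (length (concat \<tau>) + length y) w)"
    by (auto simp: VRWfin_append_iff Cons_VRWfin_iff)
  then show "(concat t @ x) # s \<in> VRWfin w"
    unfolding Cons_VRWfin_iff
    by (intro bexI[of _ "concat \<tau> @ y"]) (simp_all add: concat_fin_reduction red_append)
qed

section \<open>Finite reductions as initial segments of infinite ones\<close>

definition prepend :: "'b list \<Rightarrow> (nat \<Rightarrow> 'b) \<Rightarrow> nat \<Rightarrow> 'b" where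
  "prepend t u n = (if n < length t then t ! n else u (n - length t))"

lemma map_prepend: "map (prepend t u) [0..<length t] = t"
  by (rule nth_equalityI) (simp_all add: prepend_def)

lemma map_prepend_add: "map (prepend t u) [0..<length t + n] = t @ map u [0..<n]"
  by (rule nth_equalityI) (auto simp: prepend_def nth_append)

lemma prepend_prec:
  assumes u: "range u \<subseteq> varwords" and \<tau>: "\<tau> \<in> lists varwords"
    and v: "v \<prec> seq_drop (length (concat \<tau>)) u"
  shows "prepend (fin_reduction u \<tau>) v \<prec> u"
proof (rule precI[OF u])
  fix n
  let ?t = "fin_reduction u \<tau>"
  have "map v [0..<n] \<in> VRWfin (seq_drop (length (concat \<tau>)) u)"
    using v prec_iff[OF range_seq_drop[OF u]] by blast
  then have "map (prepend ?t v) [0..<length ?t + n] \<in> VRWfin u"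
    unfolding map_prepend_add VRWfin_append_fin_reduction[OF u \<tau>] .
  moreover have "map (prepend ?t v) [0..<length ?t + n] =
      map (prepend ?t v) [0..<n] @ map (prepend ?t v) [n..<n + length ?t]"
    by (metis add.commute map_append upt_add_eq_append zero_le)
  ultimately show "map (prepend ?t v) [0..<n] \<in> VRWfin u" by (metis VRWfin_appendD)
qed

lemma VRWfin_prepend_append_iff:
  assumes "range (prepend t u) \<subseteq> varwords"
  shows "t @ s \<in> VRWfin (prepend t u) \<longleftrightarrow> s \<in> VRWfin u"
proof -
  have "seq_drop (length t) (prepend t u) = u" by (simp add: seq_drop_def prepend_def fun_eq_iff)
  moreover have "replicate (length t) [None] \<in> lists varwords"
    by (auto simp: varwords_def)
  ultimately show ?thesis
    using VRWfin_append_fin_reduction[OF assms, of "replicate (length t) [None]" s]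
    by (simp add: fin_reduction_replicate map_prepend)
qed

lemma VRWfin_extend:
  assumes u: "range u \<subseteq> varwords" and t: "t \<in> VRWfin u"
  obtains v where "v \<prec> u" "t = map v [0..<length t]"
proof -
  obtain \<tau> where \<tau>: "\<tau> \<in> lists varwords" "t = fin_reduction u \<tau>" using t by (auto simp: VRWfin_def)
  show thesis
    using that[OF prepend_prec[OF u \<tau>(1) prec_refl[OF range_seq_drop[OF u]]]] \<tau>(2) map_prepend
    by metis
qed

text \<open>Let t be the beginning of some \<open>v \<prec> u\<close>; then e is a reduction of v by
  the same index words. Substitution preserves lengths, so every term of e starts where a term of t
  starts.\<close>

lemma VRWlist_imp:
  assumes u: "range u \<subseteq> varwords" and t: "t \<in> VRWfin u" and e: "e \<in> VRWlist t"
  shows "e \<in> VRWfin u" "dset e \<subseteq> dset t"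
proof -
  obtain v where v: "v \<prec> u" "t = map v [0..<length t]" using VRWfin_extend[OF u t] .
  obtain \<sigma> where \<sigma>: "[] \<notin> set \<sigma>" "length (concat \<sigma>) = length t"
    "e = fin_reduction (\<lambda>n. t ! n) \<sigma>" "e \<in> lists varwords"
    using e by (auto simp: VRWlist_def)
  have tv: "t ! i = v i" if "i < length t" for i
    using that by (subst v(2)) simp
  have ev: "e = fin_reduction v \<sigma>"
    unfolding \<sigma>(3) by (rule fin_reduction_cong) (use \<sigma>(2) tv in simp)
  have rv: "range v \<subseteq> varwords" using prec_range[OF v(1) u] .
  have "\<sigma> \<in> lists varwords" using \<sigma>(4) fin_reduction_varwords_iff[OF rv] unfolding ev by blast
  then have "e \<in> VRWfin v" unfolding ev VRWfin_def by blast
  then show "e \<in> VRWfin u" using VRWfin_mono[OF v(1)] by blast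
  show "dset e \<subseteq> dset t"
  proof
    fix z assume "z \<in> dset e"
    then obtain i where i: "z = 1 + (\<Sum>j<i. length (e ! j))" "1 \<le> i" "i < length e"
      by (auto simp: dset_def)
    \<comment> \<open>Term i of e starts with term k of t, both counted from 0;
      \<open>1 \<le> k\<close> and \<open>k < length t\<close> hold because index words are
      nonempty.\<close>
    define k where "k = length (concat (take i \<sigma>))"
    have il: "i < length \<sigma>" using i(3) ev by simp
    have "(\<Sum>j<i. length (e ! j)) = length (red v (concat (take i \<sigma>)))"
      using i(3) by (simp add: sum_length_nth) (simp add: ev take_fin_reduction concat_fin_reduction)
    also have "\<dots> = (\<Sum>j<k. length (v j))" by (simp add: length_red k_def)
    finally have z: "z = 1 + (\<Sum>j<k. length (v j))" using i(1) by simp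
    have "\<sigma> = take i \<sigma> @ \<sigma> ! i # drop (Suc i) \<sigma>" using il by (rule id_take_nth_drop)
    then have "length (concat \<sigma>) = k + length (\<sigma> ! i) + length (concat (drop (Suc i) \<sigma>))"
      unfolding k_def by (metis concat.simps(2) concat_append length_append add.assoc)
    moreover have "\<sigma> ! i \<noteq> []" using \<sigma>(1) il by (metis nth_mem)
    ultimately have k: "k < length t" using \<sigma>(2) by simp
    have "\<sigma> ! 0 \<noteq> []" using \<sigma>(1) il by (metis nth_mem gr_implies_not0 length_greater_0_conv list.size(3))
    moreover have "take i \<sigma> = \<sigma> ! 0 # take (i - 1) (tl \<sigma>)"
      using i(2) il by (cases \<sigma>; cases i) auto
    ultimately have "1 \<le> k" by (simp add: k_def Suc_le_eq)
    moreover have "(\<Sum>j<k. length (v j)) = (\<Sum>j<k. length (t ! j))"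
      using k tv by (intro sum.cong) auto
    ultimately show "z \<in> dset t" using k z by (auto simp: dset_def)
  qed
qed

lemma dpos_merge: "dpos k ((x @ y) # ws) = dpos (k + length x) (y # ws)"
  by (cases ws) (simp_all add: add.assoc)

text \<open>A position missing from s is removed by concatenating the two terms that meet
  there.\<close>

lemma ex_coarsening:
  assumes "range u \<subseteq> varwords" "t \<in> VRWfin u" "t \<noteq> []" "s \<subseteq> dpos k t"
  shows "\<exists>e\<in>VRWfin u. e \<noteq> [] \<and> dpos k e = s"
  using assms
proof (induction k t arbitrary: u s rule: dpos.induct)
  case (2 k x)
  then show ?case by (intro bexI[of _ "[x]"]) auto
next
  case (3 k x y ws)
  obtain \<tau> where \<tau>: "\<tau> \<in> varwords" "x = red u \<tau>" "y # ws \<in> VRWfin (seq_drop (length \<tau>) u)"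
    using 3 by (auto simp: Cons_VRWfin_iff[of x])
  let ?n = "k + length x + 1"
  have "s - {?n} \<subseteq> dpos (k + length x) (y # ws)" using "3.prems"(4) by auto
  then obtain e where e: "e \<in> VRWfin (seq_drop (length \<tau>) u)" "e \<noteq> []" "dpos (k + length x) e = s - {?n}"
    using "3.IH"[OF range_seq_drop[OF "3.prems"(1)] \<tau>(3)] by blast
  obtain y' ws' where y': "e = y' # ws'" using e(2) by (cases e) auto
  show ?case
  proof (cases "?n \<in> s")
    case True
    then have "dpos k (x # e) = s" using e(3) y' by auto
    moreover have "x # e \<in> VRWfin u" using \<tau> e by (auto simp: Cons_VRWfin_iff)
    ultimately show ?thesis by blast
  next
    case False
    then have "dpos k ((x @ y') # ws') = s" using e(3) y' by (simp add: dpos_merge)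
    moreover obtain \<tau>' where "\<tau>' \<in> varwords" "y' = red (seq_drop (length \<tau>) u) \<tau>'"
      "ws' \<in> VRWfin (seq_drop (length \<tau> + length \<tau>') u)"
      using e(1) y' by (auto simp: Cons_VRWfin_iff)
    then have "(x @ y') # ws' \<in> VRWfin u"
      using \<tau> unfolding Cons_VRWfin_iff by (intro bexI[of _ "\<tau> @ \<tau>'"]) (simp_all add: red_append)
    ultimately show ?thesis by blast
  qed
qed simp

lemma finite_dpos: "finite (dpos k ws)"
  by (induction k ws rule: dpos.induct) auto

lemma dset_append:
  assumes "t \<in> lists varwords" "t \<noteq> []" "r \<in> lists varwords" "r \<noteq> []"
  shows "dset t \<subset> dset (t @ r)"
proof
  have eq: "dset ws = {1 + length (concat (take i ws)) | i. 1 \<le> i \<and> i < length ws}" for ws :: "'a word list"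
    unfolding dset_def by (rule Collect_cong) (metis less_imp_le sum_length_nth)
  show "dset t \<subseteq> dset (t @ r)"
    unfolding eq by force
  \<comment> \<open>The start of r is the new position.\<close>
  have "1 + length (concat t) \<in> dset (t @ r)"
    unfolding eq using assms(2,4) by (auto intro!: exI[of _ "length t"] simp: Suc_le_eq)
  moreover have "1 + length (concat t) \<notin> dset t"
  proof
    assume "1 + length (concat t) \<in> dset t"
    then obtain i where "i < length t" "length (concat t) = length (concat (take i t))"
      by (auto simp: eq)
    then show False using length_concat_take_less[OF assms(1), of i "length t"] by simp
  qed
  ultimately show "dset t \<noteq> dset (t @ r)" by blast
qed

lemma tree_appendD: "is_tree F \<Longrightarrow> s @ r \<in> F \<Longrightarrow> s \<in> F"
  unfolding is_tree_def star_def by blast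

lemma Nil_in_tree: "is_tree F \<Longrightarrow> [] \<in> F"
  unfolding is_tree_def star_def by blast

lemma hered_subset: "is_tree F \<Longrightarrow> hered F \<subseteq> F"
  using Nil_in_tree by (auto simp: hered_def)

lemma hered_appendD: "is_tree F \<Longrightarrow> s @ r \<in> hered F \<Longrightarrow> s \<in> hered F"
  using tree_appendD[of F] by (fastforce simp: hered_def)

text \<open>An element of \<open>VRWfin b\<close> with n index letters uses exactly the first n
  terms of b, so it is one of the finite reductions that \<open>hered\<close> controls.\<close>

lemma branch_hered:
  assumes F: "is_tree F" "F \<subseteq> lists varwords" and b: "\<And>n. map b [0..<n] \<in> hered F"
  shows "VRWfin b \<subseteq> F"
proof
  have "map b [0..<Suc n] \<in> lists varwords" for n
    using b hered_subset[OF F(1)] F(2) by blast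
  then have rb: "range b \<subseteq> varwords" by auto
  fix s assume "s \<in> VRWfin b"
  then obtain t where t: "t \<in> lists varwords" "s = fin_reduction b t" by (auto simp: VRWfin_def)
  define n where "n = length (concat t)"
  show "s \<in> F"
  proof (cases "t = []")
    case True
    then show ?thesis using t Nil_in_tree[OF F(1)] by simp
  next
    case False
    then obtain x t' where "t = x # t'" by (cases t) auto
    then have "0 < n" using t(1) varwords_nonempty by (auto simp: n_def)
    define b' where "b' = map b [0..<n]"
    have "b' \<noteq> []" using \<open>0 < n\<close> by (simp add: b'_def)
    then have "VRWlist b' \<subseteq> F" using b[of n] unfolding b'_def[symmetric] hered_def by auto
    moreover have "s = fin_reduction (\<lambda>i. b' ! i) t"
      unfolding t(2) by (rule fin_reduction_cong) (simp add: n_def b'_def)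
    moreover have "[] \<notin> set t" using t(1) varwords_nonempty by auto
    moreover have "s \<in> lists varwords"
      unfolding t(2) fin_reduction_varwords_iff[OF rb] by (rule t(1))
    ultimately show ?thesis by (auto simp: VRWlist_def b'_def n_def)
  qed
qed

section \<open>The strong Cantor--Bendixson index\<close>

lemma sCB_zero: "sCB u X 0 = sCB_step u X"
  by (simp add: sCB_def orec_zero)

lemma sCB_osuc: "sCB u X (osuc \<xi>) = sCB_step u (sCB u X \<xi>)"
  by (simp add: sCB_def orec_succ)

lemma sCB_limit: "is_limit \<xi> \<Longrightarrow> sCB u X \<xi> = (\<Inter>\<beta>\<in>{..<\<xi>}. sCB u X \<beta>)"
  by (simp add: sCB_def[abs_def] orec_limit)

lemma sCB_step_subset: "sCB_step u X \<subseteq> X \<inter> VRWfin u"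
  by (auto simp: sCB_step_def)

lemma sCB_antimono: "\<beta> \<le> \<xi> \<Longrightarrow> sCB u X \<xi> \<subseteq> sCB u X \<beta>"
proof (induction \<xi> rule: omega1_induct)
  case zero
  then show ?case by simp
next
  case (succ \<xi>)
  then show ?case
    using sCB_step_subset[of u "sCB u X \<xi>"]
    by (cases "\<beta> = osuc \<xi>") (auto simp: sCB_osuc order_le_less less_osuc_iff)
next
  case (limit \<xi>)
  then show ?case by (cases "\<beta> = \<xi>") (auto simp: sCB_limit)
qed

lemma sCB_subset: "sCB u X \<xi> \<subseteq> X \<inter> VRWfin u"
  using sCB_antimono[OF zero_le_omega1, of u X \<xi>] sCB_step_subset[of u X] by (auto simp: sCB_zero)

lemma VRWfin_snoc_drop:
  assumes u: "range u \<subseteq> varwords" and t: "t \<in> VRWfin u" and x: "x \<in> VRW u" "propto (concat t) x"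
  shows "t @ [drop (length (concat t)) x] \<in> VRWfin u"
proof -
  obtain \<tau> where \<tau>: "\<tau> \<in> lists varwords" "t = fin_reduction u \<tau>" using t by (auto simp: VRWfin_def)
  obtain y where y: "x = red u y" using x(1) by (auto simp: mem_VRW_iff)
  obtain z where z: "z \<in> varwords" "x = red u (concat \<tau>) @ z"
    using x(2) by (auto simp: propto_def \<tau>(2) concat_fin_reduction)
  obtain s' where s': "z = red (seq_drop (length (concat \<tau>)) u) s'"
    using red_eq_appendD[OF u] y z(2) by metis
  then have "s' \<in> varwords" using z(1) red_varwords_iff[OF range_seq_drop[OF u]] by blast
  then have "[z] \<in> VRWfin (seq_drop (length (concat \<tau>)) u)" by (auto simp: s' Cons_VRWfin_iff)
  then have "t @ [z] \<in> VRWfin u" using VRWfin_append_fin_reduction[OF u \<tau>(1)] \<tau>(2) by blast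
  moreover have "drop (length (concat t)) x = z" by (simp add: z(2) \<tau>(2) concat_fin_reduction)
  ultimately show ?thesis by simp
qed

lemma concat_VRWfin: "s \<in> VRWfin u \<Longrightarrow> s \<noteq> [] \<Longrightarrow> concat s \<in> VRW u"
proof -
  assume "s \<in> VRWfin u" "s \<noteq> []"
  then obtain \<tau> where \<tau>: "\<tau> \<in> lists varwords" "s = fin_reduction u \<tau>" by (auto simp: VRWfin_def)
  then have "concat \<tau> \<in> varwords" using \<open>s \<noteq> []\<close> by (cases \<tau>) auto
  then show "concat s \<in> VRW u" using \<tau> by (auto simp: mem_VRW_iff concat_fin_reduction)
qed

text \<open>Continue t in u and concatenate after one, two, three, ... further terms: this is an
  infinite chain of exceptional words.\<close>

lemma not_mem_sCB_step:
  assumes u: "range u \<subseteq> varwords" and t: "t \<in> VRWfin u"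
    and no: "\<And>x. t @ [x] \<in> VRWfin u \<Longrightarrow> t @ [x] \<notin> Y"
  shows "t \<notin> sCB_step u Y"
proof -
  obtain v where v: "v \<prec> u" "t = map v [0..<length t]" using VRWfin_extend[OF u t] .
  have rv: "range v \<subseteq> varwords" using prec_range[OF v(1) u] .
  define f where "f n = concat (map v [0..<length t + Suc n])" for n
  have "map v [0..<length t + Suc n] \<in> VRWfin u" for n
    using v(1) prec_iff[OF u] by blast
  then have "f n \<in> VRW u" for n unfolding f_def by (intro concat_VRWfin) auto
  moreover have "propto (concat t) (f n)" for n
  proof -
    have "map v [0..<length t + Suc n] = map v [0..<length t] @ map v [length t..<length t + Suc n]"
      by (simp only: upt_add_eq_append[OF zero_le] map_append)
    then have "map v [0..<length t + Suc n] = t @ map v [length t..<length t + Suc n]"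
      unfolding v(2)[symmetric] .
    then have "f n = concat t @ concat (map v [length t..<length t + Suc n])" by (simp add: f_def)
    moreover have "concat (map v [length t..<length t + Suc n]) \<in> varwords" using rv by auto
    ultimately show ?thesis unfolding propto_def by blast
  qed
  ultimately have "f n \<in> sCB_set u Y t" for n
    using VRWfin_snoc_drop[OF u t] no by (simp add: sCB_set_def)
  moreover have "propto (f n) (f (Suc n))" for n
    using rv by (auto simp: f_def propto_def intro!: bexI[of _ "v (Suc (length t + n))"])
  ultimately show ?thesis unfolding sCB_step_def by blast
qed

text \<open>A reduction v offers fewer words, hence fewer infinite chains that could remove a
  sequence.\<close>

lemma sCB_prec_mono:
  assumes u: "range u \<subseteq> varwords" and v: "v \<prec> u"
  shows "sCB u X \<xi> \<inter> VRWfin v \<subseteq> sCB v X \<xi>"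
proof -
  have step: "sCB_step u Y \<inter> VRWfin v \<subseteq> sCB_step v Y'" if Y: "Y \<inter> VRWfin v \<subseteq> Y'" for Y Y'
  proof
    fix t assume t: "t \<in> sCB_step u Y \<inter> VRWfin v"
    have "sCB_set v Y' t \<subseteq> sCB_set u Y t"
    proof
      fix x assume x: "x \<in> sCB_set v Y' t"
      then have "t @ [drop (length (concat t)) x] \<in> VRWfin v"
        using VRWfin_snoc_drop[OF prec_range[OF v u]] t by (auto simp: sCB_set_def)
      then show "x \<in> sCB_set u Y t" using x Y VRW_mono[OF v] by (auto simp: sCB_set_def)
    qed
    then show "t \<in> sCB_step v Y'" using t Y unfolding sCB_step_def by blast
  qed
  show ?thesis
  proof (induction \<xi> rule: omega1_induct)
    case zero
    then show ?case unfolding sCB_zero by (rule step) blast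
  next
    case (succ \<xi>)
    then show ?case unfolding sCB_osuc by (rule step)
  next
    case (limit \<xi>)
    then show ?case by (auto simp: sCB_limit)
  qed
qed

text \<open>Removing the sequences without a one-term extension is a derivation independent of u,
  and its iterates contain the strong derivatives. They cannot decrease strictly at every countable
  ordinal, since there are only countably many finite sequences.\<close>

lemma sCB_vanishes:
  fixes H :: "'a::finite word list set"
  assumes tree: "\<And>s r. s @ r \<in> H \<Longrightarrow> s \<in> H" and nb: "\<nexists>b. \<forall>n. map b [0..<n] \<in> H"
  shows "\<exists>\<xi>. \<forall>u. range u \<subseteq> varwords \<longrightarrow> sCB u H \<xi> = {}"
proof -
  define D where "D X = {t \<in> X. \<exists>x. t @ [x] \<in> X}" for X :: "'a word list set"
  define E where "E = orec (D H) D Inter"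
  have E: "E 0 = D H" "E (osuc \<xi>) = D (E \<xi>)" "is_limit \<xi> \<Longrightarrow> E \<xi> = (\<Inter>\<beta>\<in>{..<\<xi>}. E \<beta>)" for \<xi>
    by (simp_all add: E_def orec_zero orec_succ orec_limit)
  have D: "D X \<subseteq> X" for X by (auto simp: D_def)
  have anti: "\<beta> \<le> \<xi> \<Longrightarrow> E \<xi> \<subseteq> E \<beta>" for \<beta> \<xi>
  proof (induction \<xi> rule: omega1_induct)
    case (succ \<xi>)
    then show ?case
      using D[of "E \<xi>"] by (cases "\<beta> = osuc \<xi>") (auto simp: E order_le_less less_osuc_iff)
  next
    case (limit \<xi>)
    then show ?case by (cases "\<beta> = \<xi>") (auto simp: E)
  qed simp
  have EH: "E \<xi> \<subseteq> H" for \<xi> using anti[OF zero_le_omega1, of \<xi>] D[of H] by (auto simp: E)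
  have sub: "sCB u H \<xi> \<subseteq> E \<xi>" if u: "range u \<subseteq> varwords" for u \<xi>
  proof -
    have step: "sCB_step u Y \<subseteq> D Y'" if "Y \<subseteq> Y'" for Y Y'
    proof
      fix t assume t: "t \<in> sCB_step u Y"
      then have "t \<in> Y" "t \<in> VRWfin u" using sCB_step_subset by blast+
      moreover have "\<exists>x. t @ [x] \<in> Y" using not_mem_sCB_step[OF u \<open>t \<in> VRWfin u\<close>, of Y] t by blast
      ultimately show "t \<in> D Y'" using that by (auto simp: D_def)
    qed
    show ?thesis
    proof (induction \<xi> rule: omega1_induct)
      case zero
      then show ?case unfolding sCB_zero E by (rule step) simp
    next
      case (succ \<xi>)
      then show ?case unfolding sCB_osuc E by (rule step)
    next
      case (limit \<xi>)
      then show ?case by (auto simp: sCB_limit E)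
    qed
  qed
  have "\<exists>\<xi>. E \<xi> = {}"
  proof (rule ccontr)
    assume ne: "\<nexists>\<xi>. E \<xi> = {}"
    \<comment> \<open>At a stage that loses nothing every element has a one-term extension in the
      same stage, and this produces a branch.\<close>
    have "\<exists>t. t \<in> E \<xi> - E (osuc \<xi>)" for \<xi>
    proof (rule ccontr)
      assume "\<nexists>t. t \<in> E \<xi> - E (osuc \<xi>)"
      then have next_word: "\<exists>x. t @ [x] \<in> E \<xi>" if "t \<in> E \<xi>" for t
        using that by (auto simp: E D_def)
      obtain t where "t \<in> E \<xi>" using ne by blast
      have "\<exists>b. \<forall>n. \<exists>r. map b [0..<n] @ r \<in> E \<xi>"
      proof (rule ex_branch[where P = "\<lambda>s. \<exists>r. s @ r \<in> E \<xi>"])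
        show "\<exists>r. [] @ r \<in> E \<xi>" using \<open>t \<in> E \<xi>\<close> by auto
        fix s assume "\<exists>r. s @ r \<in> E \<xi>"
        then obtain x r where "s @ x # r \<in> E \<xi>"
          using next_word by (metis append_Nil2 neq_Nil_conv)
        then show "\<exists>x r. (s @ [x]) @ r \<in> E \<xi>" by auto
      qed
      then show False using nb EH tree by blast
    qed
    then obtain h where h: "\<And>\<xi>. h \<xi> \<in> E \<xi> - E (osuc \<xi>)" by metis
    have "h \<xi> \<noteq> h \<eta>" if "\<xi> < \<eta>" for \<xi> \<eta>
      using h[of \<xi>] h[of \<eta>] anti[of "osuc \<xi>" \<eta>] that by (auto simp: osuc_le_iff)
    then have "inj h" by (metis injI neqE)
    then have "countable (UNIV :: omega1 set)"
      by (rule countable_image_inj_on[rotated]) (rule countableI_type)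
    then show False using uncountable_omega1 by blast
  qed
  then show ?thesis using sub by blast
qed

context front_system
begin

lemma ex_front_extension:
  assumes u: "range u \<subseteq> varwords" and t: "t \<in> VRWfin u"
  shows "\<exists>r. r \<in> front \<xi> k \<and> t @ r \<in> VRWfin u"
proof -
  obtain \<tau> where \<tau>: "\<tau> \<in> lists varwords" "t = fin_reduction u \<tau>" using t by (auto simp: VRWfin_def)
  show ?thesis
    using ex_front_comparable[OF range_seq_drop[OF u, of "length (concat \<tau>)"] Nil_VRWfin,
        where \<xi> = \<xi> and k = k] VRWfin_append_fin_reduction[OF u \<tau>(1)] \<tau>(2) by auto
qed

text \<open>Every one-term extension of t is removed at the successor of a rank below \<xi>, so all
  of them are gone at order \<xi>, and one more derivation removes t.\<close>

lemma sCB_upper: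
  assumes u: "range u \<subseteq> varwords" and t: "t \<in> VRWfin u"
    and disj: "\<And>s. s \<in> front \<xi> (length (concat t)) \<Longrightarrow> t @ s \<in> VRWfin u \<Longrightarrow> t @ s \<notin> X"
  shows "t \<notin> sCB u X (osuc \<xi>)"
  using t disj
proof (induction \<xi> arbitrary: t rule: less_induct)
  case (less \<xi>)
  have vx: "x \<in> varwords" if "t @ [x] \<in> VRWfin u" for x
    using that VRWfin_subset_lists[OF u] by auto
  show ?case
  proof (cases "\<xi> = 0")
    case True
    then have "t @ [x] \<notin> X" if "t @ [x] \<in> VRWfin u" for x
      using less.prems(2)[of "[x]"] vx that by (simp add: Cons_front_iff)
    then have "t \<notin> sCB u X 0" unfolding sCB_zero by (rule not_mem_sCB_step[OF u less.prems(1)])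
    then show ?thesis using sCB_antimono[OF zero_le_omega1] by blast
  next
    case False
    have "t @ [x] \<notin> sCB u X \<xi>" if x: "t @ [x] \<in> VRWfin u" for x
    proof -
      let ?\<eta> = "g \<xi> (length (concat t) + length x + 1)"
      have "?\<eta> < \<xi>" using False g_less by simp
      moreover have "(t @ [x]) @ s \<notin> X"
        if "s \<in> front ?\<eta> (length (concat (t @ [x])))" "(t @ [x]) @ s \<in> VRWfin u" for s
        using less.prems(2)[of "x # s"] that vx[OF x] False by (simp add: Cons_front_iff)
      ultimately have "t @ [x] \<notin> sCB u X (osuc ?\<eta>)" using less.IH x by blast
      moreover have "osuc ?\<eta> \<le> \<xi>" using \<open>?\<eta> < \<xi>\<close> by (simp add: osuc_le_iff)
      ultimately show ?thesis using sCB_antimono by blast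
    qed
    then show ?thesis unfolding sCB_osuc by (rule not_mem_sCB_step[OF u less.prems(1)])
  qed
qed

text \<open>An extension \<open>t @ [x]\<close> survives up to the rank left after x. Along a chain
  of exceptional words the lengths grow without bound, so these ranks eventually reach any \<gamma>
  below \<xi>, and no chain can remove t.\<close>

lemma sCB_lower:
  assumes u: "range u \<subseteq> varwords" and t: "t \<in> VRWfin u"
    and incl: "\<And>s r. s @ r \<in> front \<xi> (length (concat t)) \<Longrightarrow> t @ s @ r \<in> VRWfin u \<Longrightarrow> t @ s \<in> X"
  shows "t \<in> sCB u X \<xi>"
  using t incl
proof (induction \<xi> arbitrary: t rule: less_induct)
  case (less \<xi>)
  define k where "k = length (concat t)"
  have tX: "t \<in> X"
    using ex_front_extension[OF u less.prems(1), of \<xi> k] less.prems(2)[of "[]"] by (auto simp: k_def)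
  have x1: "t @ [x] \<in> X \<and> (\<xi> \<noteq> 0 \<longrightarrow> t @ [x] \<in> sCB u X (g \<xi> (k + length x + 1)))"
    if x: "t @ [x] \<in> VRWfin u" for x
  proof -
    have vx: "x \<in> varwords" using x VRWfin_subset_lists[OF u] by auto
    show ?thesis
    proof (cases "\<xi> = 0")
      case True
      then show ?thesis
        using less.prems(2)[of "[x]" "[]"] x vx by (simp add: Cons_front_iff)
    next
      case False
      let ?\<eta> = "g \<xi> (k + length x + 1)"
      have "t @ [x] \<in> sCB u X ?\<eta>"
      proof (rule less.IH[OF _ x])
        show "?\<eta> < \<xi>" using False g_less by simp
        fix s r assume "s @ r \<in> front ?\<eta> (length (concat (t @ [x])))" "(t @ [x]) @ s @ r \<in> VRWfin u"
        then show "(t @ [x]) @ s \<in> X"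
          using less.prems(2)[of "x # s" r] vx False by (simp add: Cons_front_iff k_def)
      qed
      then show ?thesis using sCB_subset by blast
    qed
  qed
  have snoc: "t @ [drop k x] \<in> VRWfin u" if "x \<in> sCB_set u Y t" for x Y
    using VRWfin_snoc_drop[OF u less.prems(1)] that by (simp add: sCB_set_def k_def)
  have "\<beta> \<le> \<xi> \<Longrightarrow> t \<in> sCB u X \<beta>" for \<beta>
  proof (induction \<beta> rule: omega1_induct)
    case zero
    have "sCB_set u X t = {}" using snoc x1 by (fastforce simp: sCB_set_def k_def)
    then show ?case using tX less.prems(1) by (simp add: sCB_zero sCB_step_def)
  next
    case (succ \<gamma>)
    then have \<gamma>: "\<gamma> < \<xi>" "t \<in> sCB u X \<gamma>" by (auto simp: osuc_le_iff)
    then have "\<xi> \<noteq> 0" by auto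
    have "\<not> (\<forall>n. f n \<in> sCB_set u (sCB u X \<gamma>) t \<and> propto (f n) (f (Suc n)))" for f :: "nat \<Rightarrow> 'a word"
    proof
      assume f: "\<forall>n. f n \<in> sCB_set u (sCB u X \<gamma>) t \<and> propto (f n) (f (Suc n))"
      have "length (f n) < length (f (Suc n))" for n
      proof -
        have "propto (f n) (f (Suc n))" using f by blast
        then obtain z where "z \<in> varwords" "f (Suc n) = f n @ z" by (auto simp: propto_def)
        then show ?thesis using varwords_nonempty[of z] by simp
      qed
      then have len: "n \<le> length (f n)" for n
        by (induction n) (auto simp: Suc_le_eq intro: le_less_trans)
      have "\<gamma> \<le> g \<xi> (length (f n) + 1)" if "\<forall>m\<ge>n. \<gamma> \<le> g \<xi> m" for n
        using that len[of n] by simp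
      \<comment> \<open>At a successor the rank left is constant, at a limit it converges to \<xi>;
        either way it is at least \<gamma> from some position on.\<close>
      moreover have "\<exists>n. \<forall>m\<ge>n. 1 \<le> m \<longrightarrow> \<gamma> \<le> g \<xi> m"
      proof (cases \<xi> rule: omega1_cases)
        case (succ \<zeta>)
        then show ?thesis using \<gamma>(1) g_osuc by (simp add: less_osuc_iff)
      next
        case limit
        then show ?thesis using g_limit[OF _ \<gamma>(1)] by blast
      qed (use \<open>\<xi> \<noteq> 0\<close> in simp)
      then obtain n where "\<gamma> \<le> g \<xi> (length (f n) + 1)"
        using len by (metis le_add2 le_add1 order.trans)
      moreover have x: "f n \<in> sCB_set u (sCB u X \<gamma>) t" using f by blast
      moreover have "k + length (drop k (f n)) = length (f n)"
        using x by (auto simp: sCB_set_def propto_def k_def)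
      ultimately have "t @ [drop k (f n)] \<in> sCB u X \<gamma>"
        using x1[OF snoc[OF x]] \<open>\<xi> \<noteq> 0\<close> sCB_antimono by (metis subsetD)
      then show False using x by (simp add: sCB_set_def k_def)
    qed
    then show ?case using \<gamma>(2) less.prems(1) unfolding sCB_osuc sCB_step_def by blast
  next
    case (limit \<beta>)
    then show ?case by (auto simp: sCB_limit)
  qed
  then show ?case by blast
qed

text \<open>Call \<open>t\<close> in the front bad if some proper subset of its set of positions belongs to the
  same Schreier family. A sequence all of whose front elements are bad would give an infinite
  descent of finite sets.\<close>

lemma ex_front_prefixes_hered:
  fixes u :: "nat \<Rightarrow> 'a::finite word"
  assumes u: "range u \<subseteq> varwords" and F: "is_tree F" and sub: "front \<xi> 0 \<inter> VRWfin u \<subseteq> F"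
  shows "\<exists>v. v \<prec> u \<and> (\<forall>s r. s @ r \<in> front \<xi> 0 \<inter> VRWfin v \<longrightarrow> s \<in> hered F)"
proof -
  define Bad where "Bad = {t :: 'a word list. \<exists>s. s \<subset> dset t \<and> A \<xi> s}"
  obtain v where v: "v \<prec> u" "front \<xi> 0 \<inter> VRWfin v \<subseteq> Bad \<or> front \<xi> 0 \<inter> VRWfin v \<inter> Bad = {}"
    using front_dichotomy[OF u] by blast
  have rv: "range v \<subseteq> varwords" using prec_range[OF v(1) u] .
  have "\<not> front \<xi> 0 \<inter> VRWfin v \<subseteq> Bad"
  proof
    assume bad: "front \<xi> 0 \<inter> VRWfin v \<subseteq> Bad"
    \<comment> \<open>The smaller set that makes t bad is realised by a coarsening of t, which lies
      in the front again and has fewer positions.\<close>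
    have "t \<notin> front \<xi> 0 \<inter> VRWfin v" for t
    proof (induction "card (dset t)" arbitrary: t rule: less_induct)
      case less
      show ?case
      proof
        assume t: "t \<in> front \<xi> 0 \<inter> VRWfin v"
        then have "t \<in> Bad" using bad by blast
        then obtain s where s: "s \<subset> dset t" "A \<xi> s" unfolding Bad_def by blast
        moreover from t have "t \<in> VRWfin v" "t \<noteq> []" by auto
        ultimately obtain e where e: "e \<in> VRWfin v" "e \<noteq> []" "dpos 0 e = s"
          using ex_coarsening[OF rv, of t s 0] unfolding dset_eq_dpos by blast
        then have "e \<in> front \<xi> 0" using s(2) VRWfin_subset_lists[OF rv] by (auto simp: front_def)
        moreover have "card (dset e) < card (dset t)"
          using s(1) e(3) finite_dpos[of 0 t] by (auto simp: dset_eq_dpos intro: psubset_card_mono)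
        ultimately show False using less e(1) by blast
      qed
    qed
    then show False using ex_front_extension[OF rv Nil_VRWfin, of \<xi> 0] by auto
  qed
  then have good: "front \<xi> 0 \<inter> VRWfin v \<inter> Bad = {}" using v(2) by blast
  have subv: "front \<xi> 0 \<inter> VRWfin v \<subseteq> F" using sub VRWfin_mono[OF v(1)] by blast
  have "s \<in> hered F" if sr: "s @ r \<in> front \<xi> 0 \<inter> VRWfin v" for s r
  proof -
    have "s \<in> F" using sr subv tree_appendD[OF F] by blast
    moreover have "VRWlist t1 \<subseteq> F" if t1: "s = t1 @ r1" "t1 \<noteq> []" for t1 r1
    proof
      fix e assume e: "e \<in> VRWlist t1"
      have ts: "t1 @ r1 @ r \<in> VRWfin v" using sr t1(1) by simp
      then have t1v: "t1 \<in> VRWfin v" by (rule VRWfin_appendD)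
      have ev: "e \<in> VRWfin v" "dset e \<subseteq> dset t1" using VRWlist_imp[OF rv t1v e] .
      have "t1 @ r1 @ r \<in> lists varwords" using ts VRWfin_subset_lists[OF rv] by blast
      then have "dset t1 \<subseteq> dset (s @ r)"
        using dset_append[of t1 "r1 @ r"] t1 by (cases "r1 @ r = []") auto
      then have es: "dset e \<subseteq> dset (s @ r)" using ev(2) by blast
      \<comment> \<open>If e reached beyond the front, its part in the front would have a proper
        subset of the positions of \<open>s @ r\<close>, which would then be bad.\<close>
      from ex_front_comparable[OF rv ev(1), of \<xi> 0] show "e \<in> F"
      proof (elim disjE exE conjE)
        fix e1 r1 assume e1: "e = e1 @ r1" "r1 \<noteq> []" "e1 \<in> front \<xi> 0"
        have "dset e1 \<subset> dset e"
          unfolding e1(1) using e1 ev(1) VRWfin_subset_lists[OF rv]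
          by (intro dset_append) (auto simp: front_def)
        then have "dset e1 \<subset> dset (s @ r)" using es by (rule psubset_subset_trans)
        moreover have "A \<xi> (dset e1)" using e1(3) by (simp add: front_def dset_eq_dpos)
        ultimately have "s @ r \<in> Bad" unfolding Bad_def by blast
        then show ?thesis using good sr by blast
      next
        fix r2 assume "e @ r2 \<in> front \<xi> 0 \<inter> VRWfin v"
        then show ?thesis using subv tree_appendD[OF F] by blast
      qed
    qed
    ultimately show ?thesis by (auto simp: hered_def)
  qed
  then show ?thesis using v(1) by blast
qed

text \<open>Decide the continuations of t along the front at offset
  \<open>length (concat t)\<close>. They cannot all miss H, since t would then be removed by order
  \<xi> + 1. Concatenating t with the next term leads back to offset 0.\<close>

lemma ex_front_subset:
  fixes w :: "nat \<Rightarrow> 'a::finite word"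
  assumes w: "range w \<subseteq> varwords" and u: "u \<prec> w"
    and t: "t \<in> sCB u (hered F \<inter> VRWfin w) (osuc \<xi>)"
  shows "\<exists>v. v \<prec> w \<and> front \<xi> 0 \<inter> VRWfin v \<subseteq> F"
proof -
  define H where "H = hered F \<inter> VRWfin w"
  define k where "k = length (concat t)"
  have ru: "range u \<subseteq> varwords" using prec_range[OF u w] .
  have tu: "t \<in> VRWfin u" using t sCB_subset by blast
  then obtain \<tau> where \<tau>: "\<tau> \<in> lists varwords" "t = fin_reduction u \<tau>" by (auto simp: VRWfin_def)
  obtain u' where u': "u' \<prec> seq_drop (length (concat \<tau>)) u"
    "front \<xi> k \<inter> VRWfin u' \<subseteq> {s. t @ s \<in> H} \<or> front \<xi> k \<inter> VRWfin u' \<inter> {s. t @ s \<in> H} = {}"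
    using front_dichotomy[OF range_seq_drop[OF ru]] by blast
  have ru': "range u' \<subseteq> varwords" using prec_range[OF u'(1) range_seq_drop[OF ru]] .
  define v where "v = prepend t u'"
  have v: "v \<prec> u" unfolding v_def \<tau>(2) by (rule prepend_prec[OF ru \<tau>(1) u'(1)])
  have rv: "range v \<subseteq> varwords" using prec_range[OF v ru] .
  have tv: "t @ s \<in> VRWfin v \<longleftrightarrow> s \<in> VRWfin u'" for s
    using VRWfin_prepend_append_iff rv unfolding v_def by blast
  have "\<not> front \<xi> k \<inter> VRWfin u' \<inter> {s. t @ s \<in> H} = {}"
  proof
    assume "front \<xi> k \<inter> VRWfin u' \<inter> {s. t @ s \<in> H} = {}"
    then have "t \<notin> sCB v H (osuc \<xi>)"
      using tv tv[of "[]"] by (intro sCB_upper[OF rv]) (auto simp: k_def)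
    \<comment> \<open>Passing from u to \<open>v\<close> does not remove t from the
      derivative.\<close>
    then show False
      using t sCB_prec_mono[OF ru v] tv[of "[]"] by (auto simp: H_def)
  qed
  then have sub: "front \<xi> k \<inter> VRWfin u' \<subseteq> {s. t @ s \<in> H}" using u'(2) by blast
  \<comment> \<open>With t absorbed into the first term, a reduction of z has the positions of a
    continuation of t at offset k.\<close>
  define z where "z n = (if n = 0 then concat t @ u' 0 else u' n)" for n
  have z: "z \<prec> w"
  proof (rule precI[OF w])
    fix n
    have "map u' [0..<Suc m] \<in> VRWfin u'" for m using map_upt_VRWfin[of u' 0 "Suc m"] by simp
    then have "t @ map u' [0..<Suc m] \<in> VRWfin w" for m
      using tv VRWfin_mono[OF v] VRWfin_mono[OF u] by blast
    then have "t @ u' 0 # map u' [Suc 0..<Suc m] \<in> VRWfin w" for m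
      by (simp add: upt_conv_Cons del: upt_Suc)
    note VRWfin_merge[OF this]
    moreover have "map z [0..<Suc m] = (concat t @ u' 0) # map u' [Suc 0..<Suc m]" for m
      by (simp add: upt_conv_Cons z_def del: upt_Suc)
    ultimately show "map z [0..<n] \<in> VRWfin w" by (cases n) (simp_all del: upt_Suc)
  qed
  have "s \<in> F" if s: "s \<in> front \<xi> 0" "s \<in> VRWfin z" for s
  proof -
    obtain x rest where xr: "s = x # rest" using s(1) by (cases s) auto
    obtain y where y: "y \<in> varwords" "x = red z y" "rest \<in> VRWfin (seq_drop (length y) z)"
      using s(2) xr by (auto simp: Cons_VRWfin_iff)
    obtain a y' where ay: "y = a # y'" using varwords_nonempty[OF y(1)] by (cases y) auto
    have dz: "seq_drop (Suc m) z = seq_drop (Suc m) u'" for m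
      by (simp add: seq_drop_def z_def fun_eq_iff)
    \<comment> \<open>x1 is x without its copy of \<open>concat t\<close>; the letter a, put into
      the first term of z, has acted on both parts.\<close>
    define x1 where "x1 = red u' y"
    have x: "x = subst (concat t) a @ x1"
      using dz[of 0] by (simp add: y(2) ay red_Cons x1_def) (simp add: z_def)
    have s1: "x1 # rest \<in> VRWfin u'"
      using y dz[of "length y'"] by (auto simp: Cons_VRWfin_iff x1_def ay)
    then have "x1 # rest \<in> lists varwords" using VRWfin_subset_lists[OF ru'] by blast
    then have "x1 # rest \<in> front \<xi> k"
      using s(1) by (simp add: front_def xr x dpos_merge k_def)
    then have tsH: "t @ x1 # rest \<in> hered F" using sub s1 by (auto simp: H_def)
    define ws where "ws = t @ x1 # rest"
    have "VRWlist ws \<subseteq> F" using tsH by (auto simp: ws_def hered_def)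
    moreover have "s \<in> VRWlist ws"
    proof -
      \<comment> \<open>Substitute a in every term of t, keep x1, and merge all of these into one
        term: this turns \<open>t @ x1 # rest\<close> into s.\<close>
      let ?\<sigma> = "(replicate (length t) a @ [None]) # replicate (length rest) [None]"
      have "red ((!) ws) (replicate n None) = concat (map ((!) ws) [0..<n])" for n
        by (metis concat_fin_reduction fin_reduction_replicate concat_replicate_single)
      moreover have "map ((!) ws) [0..<length t] = t"
        by (rule nth_equalityI) (simp_all add: ws_def nth_append)
      ultimately have "red ((!) ws) (replicate (length t) None) = concat t" by simp
      moreover have "subst (replicate (length t) None) a = replicate (length t) a"
        by (simp add: subst_def)
      ultimately have "red ((!) ws) (replicate (length t) a) = subst (concat t) a"
        by (metis subst_red)
      then have "red ((!) ws) (replicate (length t) a @ [None]) = x"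
        by (simp add: red_append seq_drop_def ws_def x)
      moreover have "map (seq_drop (Suc (length t)) ((!) ws)) [0..<length rest] = rest"
        by (rule nth_equalityI) (simp_all add: seq_drop_def ws_def nth_append)
      ultimately have "fin_reduction ((!) ws) ?\<sigma> = s"
        by (simp add: fin_reduction_replicate xr)
      moreover have "length (concat ?\<sigma>) = length ws"
        by (simp add: ws_def)
      moreover have "s \<in> lists varwords" using s(1) by (simp add: front_def)
      ultimately show ?thesis unfolding VRWlist_def by (intro CollectI exI[of _ ?\<sigma>]) auto
    qed
    ultimately show ?thesis by blast
  qed
  then show ?thesis using z by blast
qed

end

theorem theorem4p4:
  fixes L :: "omega1 \<Rightarrow> nat \<Rightarrow> omega1"
    and F :: "'a::finite word list set"
    and w :: "nat \<Rightarrow> 'a word"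
  assumes "fundamental_system L"
    and "F \<subseteq> lists varwords"
    and "is_tree F"
    and "range w \<subseteq> varwords"
  defines "H \<equiv> hered F \<inter> VRWfin w"
  shows "(\<not> pointwise_closed H \<longrightarrow> (\<exists>u. u \<prec> w \<and> VRWfin u \<subseteq> F)) \<and>
    (pointwise_closed H \<longrightarrow>
      (\<forall>u. u \<prec> w \<longrightarrow> (\<exists>\<xi>. sCB u H \<xi> = {})) \<and>
      bdd_above {sO u H | u. u \<prec> w} \<and>
      (let \<zeta> = Sup {sO u H | u. u \<prec> w} in
        \<forall>\<xi>.
          (osuc \<xi> < \<zeta> \<longrightarrow>
            (\<exists>u. u \<prec> w \<and> Wfam L \<xi> \<inter> VRWfin u \<subseteq> F)) \<and>
          (\<xi> > \<zeta> \<longrightarrow>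
            (\<forall>u. u \<prec> w \<longrightarrow> (\<exists>u1. u1 \<prec> u \<and>
              Wfam L \<xi> \<inter> VRWfin u1 \<subseteq> lists varwords - F \<and>
              F \<inter> VRWfin u1 \<subseteq> star (Wfam L \<xi>) - Wfam L \<xi>))) \<and>
          (osuc \<xi> = \<zeta> \<or> \<xi> = \<zeta> \<longrightarrow>
            (\<exists>u. u \<prec> w \<and>
              (Wfam L \<xi> \<inter> VRWfin u \<subseteq> F \<or>
               Wfam L \<xi> \<inter> VRWfin u \<subseteq> lists varwords - F)))))"
proof -
  note F = assms(2,3) and w = assms(4)
  obtain g where "front_system (schreier L) g" using front_system_schreier[OF assms(1)] by blast
  then interpret front_system "schreier L" g .
  \<comment> \<open>The separate definition at \<xi> = 0 agrees with the front of rank 0, because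
    one-term sequences are those without positions.\<close>
  have Wfam: "(Wfam L \<xi> :: 'a word list set) = front \<xi> 0" for \<xi>
  proof (cases "\<xi> = 0")
    case True
    have "ws \<in> front 0 0 \<longleftrightarrow> (\<exists>x\<in>varwords. ws = [x])" for ws :: "'a word list"
      by (cases ws) (auto simp: Cons_front_iff)
    then show ?thesis using True by (auto simp: Wfam_def)
  next
    case False
    then show ?thesis by (auto simp: Wfam_def front_def dset_eq_dpos)
  qed
  have Hsub: "H \<subseteq> lists varwords" using VRWfin_subset_lists[OF w] by (auto simp: H_def)
  have Htree: "s \<in> H" if "s @ r \<in> H" for s r
    using that hered_appendD[OF F(2)] VRWfin_appendD unfolding H_def by blast
  have dich: "\<exists>v. v \<prec> u \<and> (Wfam L \<xi> \<inter> VRWfin v \<subseteq> F \<or> Wfam L \<xi> \<inter> VRWfin v \<subseteq> lists varwords - F)"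
    if "range u \<subseteq> varwords" for u :: "nat \<Rightarrow> 'a word" and \<xi>
    using front_dichotomy[OF that, of \<xi> 0 F] unfolding Wfam by (auto simp: front_def)
  have case1: "\<exists>u. u \<prec> w \<and> VRWfin u \<subseteq> F" if nc: "\<not> pointwise_closed H"
  proof -
    have "[] \<in> H" by (simp add: H_def hered_def)
    from branch_if_not_closed[OF Hsub this _ nc] Htree
    obtain b where b: "\<And>n. map b [0..<n] \<in> H" by blast
    have "b \<prec> w" by (rule precI[OF w]) (use b in \<open>auto simp: H_def\<close>)
    moreover have "VRWfin b \<subseteq> F" by (rule branch_hered[OF F(2,1)]) (use b in \<open>auto simp: H_def\<close>)
    ultimately show ?thesis by blast
  qed
  {
    assume "pointwise_closed H"
    then have "\<nexists>b. \<forall>n. map b [0..<n] \<in> H" using not_closed_if_branch[OF Hsub] by blast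
    then obtain \<xi>\<^sub>0 where \<xi>\<^sub>0: "\<And>u. range u \<subseteq> varwords \<Longrightarrow> sCB u H \<xi>\<^sub>0 = {}"
      using sCB_vanishes[of H] Htree by blast
    then have van: "sCB u H \<xi>\<^sub>0 = {}" if "u \<prec> w" for u using prec_range[OF that w] by blast
    let ?S = "{sO u H | u. u \<prec> w}"
    have "sO u H \<le> \<xi>\<^sub>0" if "u \<prec> w" for u unfolding sO_def using van[OF that] by (rule Least_le)
    then have bdd: "bdd_above ?S" by (auto simp: bdd_above_def)
    have ne: "?S \<noteq> {}" using prec_refl[OF w] by blast
    define \<zeta> where "\<zeta> = Sup ?S"
    \<comment> \<open>The derivatives decrease, so they stay empty from the index on.\<close>
    have sO: "sCB u H \<xi> = {} \<longleftrightarrow> sO u H \<le> \<xi>" if "u \<prec> w" for u \<xi>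
    proof
      show "sO u H \<le> \<xi>" if "sCB u H \<xi> = {}" unfolding sO_def using that by (rule Least_le)
      have "sCB u H (sO u H) = {}" unfolding sO_def using van[OF that] by (rule LeastI)
      then show "sCB u H \<xi> = {}" if "sO u H \<le> \<xi>" using sCB_antimono[OF that] by blast
    qed
    have i: "\<exists>u. u \<prec> w \<and> Wfam L \<xi> \<inter> VRWfin u \<subseteq> F" if "osuc \<xi> < \<zeta>" for \<xi>
    proof -
      \<comment> \<open>For this u the derivative of order \<xi> + 1 is nonempty, the order at which
        \<open>ex_front_subset\<close> works.\<close>
      obtain u where u: "u \<prec> w" "osuc \<xi> < sO u H"
        using \<open>osuc \<xi> < \<zeta>\<close> less_cSup_iff[OF ne bdd] by (auto simp: \<zeta>_def)
      then obtain t where "t \<in> sCB u H (osuc \<xi>)" using sO[OF u(1), of "osuc \<xi>"] by auto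
      then show ?thesis using ex_front_subset[OF w u(1)] unfolding Wfam H_def by blast
    qed
    have ii: "\<exists>u1. u1 \<prec> u \<and> Wfam L \<xi> \<inter> VRWfin u1 \<subseteq> lists varwords - F \<and>
        F \<inter> VRWfin u1 \<subseteq> star (Wfam L \<xi>) - Wfam L \<xi>" if \<xi>: "\<zeta> < \<xi>" and u: "u \<prec> w" for \<xi> u
    proof -
      have ru: "range u \<subseteq> varwords" using prec_range[OF u w] .
      obtain v where v: "v \<prec> u"
        "Wfam L \<xi> \<inter> VRWfin v \<subseteq> F \<or> Wfam L \<xi> \<inter> VRWfin v \<subseteq> lists varwords - F"
        using dich[OF ru] by blast
      have rv: "range v \<subseteq> varwords" using prec_range[OF v(1) ru] .
      have vw: "v \<prec> w" using prec_trans[OF w v(1) u] .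
      \<comment> \<open>Otherwise the empty sequence would survive order \<xi> in some v', although
        the index of v' is at most \<zeta> and thus below \<xi>.\<close>
      have "\<not> Wfam L \<xi> \<inter> VRWfin v \<subseteq> F"
      proof
        assume "Wfam L \<xi> \<inter> VRWfin v \<subseteq> F"
        then obtain v' where v': "v' \<prec> v" "\<And>s r. s @ r \<in> front \<xi> 0 \<inter> VRWfin v' \<Longrightarrow> s \<in> hered F"
          using ex_front_prefixes_hered[OF rv F(2)] unfolding Wfam by blast
        have v'w: "v' \<prec> w" using prec_trans[OF w v'(1) vw] .
        have "[] \<in> sCB v' H \<xi>"
        proof (rule sCB_lower[OF prec_range[OF v'w w] Nil_VRWfin])
          fix s r assume "s @ r \<in> front \<xi> (length (concat ([] :: 'a word list)))" "[] @ s @ r \<in> VRWfin v'"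
          then have "s @ r \<in> front \<xi> 0 \<inter> VRWfin v'" by simp
          then have "s \<in> hered F" "s \<in> VRWfin w"
            using v'(2) VRWfin_mono[OF v'w] VRWfin_appendD by blast+
          then show "[] @ s \<in> H" by (simp add: H_def)
        qed
        moreover have "sO v' H \<le> \<zeta>" unfolding \<zeta>_def using v'w bdd by (intro cSup_upper) auto
        ultimately show False using sO[OF v'w, of \<xi>] \<xi> by (metis empty_iff less_imp_le order.trans)
      qed
      then have disj: "Wfam L \<xi> \<inter> VRWfin v \<subseteq> lists varwords - F" using v(2) by blast
      \<comment> \<open>The front misses the tree F, so a sequence of F cannot extend a front
        element and must be extendible to one.\<close>
      have "t \<in> star (Wfam L \<xi>)" if t: "t \<in> F" "t \<in> VRWfin v" for t
        using ex_front_comparable[OF rv t(2), of \<xi> 0]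
      proof (elim disjE exE conjE)
        fix t1 r assume t1: "t = t1 @ r" "t1 \<in> front \<xi> 0"
        then have "t1 \<in> F" "t1 \<in> VRWfin v" using t tree_appendD[OF F(2)] VRWfin_appendD by blast+
        then show ?thesis using disj t1(2) unfolding Wfam by blast
      next
        fix r assume "t @ r \<in> front \<xi> 0 \<inter> VRWfin v"
        then show ?thesis unfolding star_def Wfam by blast
      qed
      then show ?thesis using v(1) disj by blast
    qed
    have iii: "\<exists>u. u \<prec> w \<and> (Wfam L \<xi> \<inter> VRWfin u \<subseteq> F \<or> Wfam L \<xi> \<inter> VRWfin u \<subseteq> lists varwords - F)" for \<xi>
      by (rule dich[OF w])
    have "\<exists>\<xi>. sCB u H \<xi> = {}" if "u \<prec> w" for u using van[OF that] by blast
    note this bdd i[unfolded \<zeta>_def] ii[unfolded \<zeta>_def] iii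
  }
  note case2 = this
  show ?thesis
    unfolding Let_def
  proof (intro conjI impI allI, goal_cases)
    case 1
    then show ?case by (rule case1)
  next
    case (2 u)
    then show ?case by (rule case2(1))
  next
    case 3
    then show ?case by (rule case2(2))
  next
    case (4 \<xi>)
    then show ?case by (rule case2(3))
  next
    case (5 \<xi> u)
    then show ?case by (rule case2(4))
  next
    case (6 \<xi>)
    then show ?case by (intro case2(5))
  qed
qed

end
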